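(* Consider a balanced generalized Pólya urn with replacement matrix $R=\begin{pmatrix} a & b \\ c & d \end{pmatrix}$, composition $U_n$ at time $n$, and $S=a+b=c+d$, $m=a-c=d-b$, $\sigma=m/S$, $v_1=\frac{S}{b+c}\begin{pmatrix} c \\ b \end{pmatrix}$. Assume that the urn is small, i.e. $\sigma<1/2$, and that $bc\neq0$. Then the quadratic strong law holds: $$\lim_{n\to\infty}\frac{1}{\log n}\sum_{k=1}^n\frac{1}{k^2}(U_k-kv_1)(U_k-kv_1)^T=\frac{1}{1-2\sigma}\,\frac{bcm^2}{(b+c)^2}\begin{pmatrix} 1 & -1 \\ -1 & 1 \end{pmatrix}\quad\text{a.s.}$$ In particular, $$\lim_{n\to\infty}\frac{1}{\log n}\sum_{k=1}^n\frac{\|U_k-kv_1\|^2}{k^2}=\frac{2}{1-2\sigma}\,\frac{bcm^2}{(b+c)^2}\quad\text{a.s.}$$ Moreover, the law of iterated logarithm holds: $$\limsup_{n\to\infty}\frac{\|U_n-nv_1\|^2}{2n\log\log n}=\frac{2}{1-2\sigma}\,\frac{bcm^2}{(b+c)^2}\quad\text{a.s.}$$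
   Context: Generalized Pólya urn model: $a,b,c,d$ are nonnegative integers, the replacement matrix $R$ is not diagonal ($b+c\ge1$), and the urn is balanced: $a+b=c+d=S\ge1$. At time $0$ the urn contains $\alpha\ge0$ red balls and $\beta\ge0$ white balls ($\alpha,\beta$ integers), with $\tau=\alpha+\beta\ge1$. At each time $n\ge1$ one ball is drawn uniformly at random from the urn and its color observed. If it is red, it is returned together with $a$ additional red balls and $b$ additional white balls; if it is white, it is returned together with $c$ additional red balls and $d$ additional white balls. $U_n=(X_n,Y_n)^T$, where $X_n$ and $Y_n$ are the numbers of red and white balls at time $n$; $U_0=(\alpha,\beta)^T$ and $X_n+Y_n=\tau_n=\tau+nS$. Equivalently, $U_{n+1}=U_n+R^T(\varepsilon_{n+1},1-\varepsilon_{n+1})^T$, where the conditional distribution of $\varepsilon_{n+1}$ given the past $\mathcal{F}_n$ up to time $n$ is Bernoulli with parameter $X_n/\tau_n$. $\|\cdot\|$ is the Euclidean norm on $\mathbb{R}^2$. *)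

theory Defs
  imports "HOL-Probability.Probability"
begin

definition replacement_matrix :: "nat \<Rightarrow> nat \<Rightarrow> nat \<Rightarrow> nat \<Rightarrow> real^2^2" where
  "replacement_matrix a b c d = vector [vector [real a, real b], vector [real c, real d]]"

text \<open>Component 1 counts the red balls, component 2 the white ones; \<open>red n \<omega>\<close> says that the
  \<open>n\<close>-th ball drawn is red. Draws are numbered from 1, so \<open>red 0\<close> is never used.\<close>

primrec urn_composition ::
  "real^2^2 \<Rightarrow> real^2 \<Rightarrow> (nat \<Rightarrow> 'a \<Rightarrow> bool) \<Rightarrow> nat \<Rightarrow> 'a \<Rightarrow> real^2" where
  "urn_composition R u red 0 \<omega> = u"
| "urn_composition R u red (Suc n) \<omega> = urn_composition R u red n \<omega> +
     transpose R *v vector [of_bool (red (Suc n) \<omega>), 1 - of_bool (red (Suc n) \<omega>)]"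

text \<open>The filtration is any one to which the draws are adapted, for instance the one they
  generate.\<close>

locale balanced_polya_urn = prob_space M + filtration "space M" F
  for M :: "'a measure" and F :: "nat \<Rightarrow> 'a measure" +
  fixes a b c d \<alpha> \<beta> :: nat
    and red :: "nat \<Rightarrow> 'a \<Rightarrow> bool"
    and U :: "nat \<Rightarrow> 'a \<Rightarrow> real^2"
  assumes not_diagonal: "b + c \<ge> 1"
    and balanced: "a + b = c + d"
    and balance_pos: "a + b \<ge> 1"
    and nonempty: "\<alpha> + \<beta> \<ge> 1"
    and U_eq: "U = urn_composition (replacement_matrix a b c d) (vector [real \<alpha>, real \<beta>]) red"
    and subalgebra_F: "\<And>n. subalgebra M (F n)"
    and adapted: "\<And>n. n \<ge> 1 \<Longrightarrow> Measurable.pred (F n) (red n)"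
    and uniform_draw: "\<And>n. AE \<omega> in M.
      real_cond_exp M (F n) (indicator {\<omega> \<in> space M. red (Suc n) \<omega>}) \<omega>
        = U n \<omega> $ 1 / (U n \<omega> $ 1 + U n \<omega> $ 2)"

definition outer_square :: "real^2 \<Rightarrow> real^2^2" where
  "outer_square x = (columnvector x :: real^1^2) ** (rowvector x :: real^2^1)"

end

(*
  Let p = c/(b+c), tau_n = tau + nS, and let Z_n = X_n - p tau_n be the centred number of red balls.
  Up to a constant vector, U_n - n v1 is Z_n (1,-1), and Z_{n+1} = (1 + m/tau_n) Z_n + m xi_n, where
  xi_n is the draw minus its conditional mean q_n = X_n/tau_n.  Dividing by the product pi_n ~ n^sigma
  of the growth factors turns Z into the martingale sum of xi_j / pi_{j+1}, whose squared weights have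
  partial sums V_n with V_n pi_n^2 / n -> 1/(1-2 sigma).

  Since a draw is Bernoulli, the conditional moment generating function of xi_n is explicit, and every
  predictable H yields an exponential martingale.  Ville's inequality along the geometric blocks
  rho^k <= V_n < rho^{k+1} gives the upper half of the law of the iterated logarithm.  For the lower
  half, a combination of three exponential martingales minorizes the indicator of a large block
  increment; its price has a divergent sum over the blocks, which forces infinitely many large
  increments.  The conditional variances q_n (1 - q_n) are only asymptotically p(1-p), so the increments
  are frozen whenever q_n is far from p; that q_n -> p already follows from the crude upper bound with
  variance 1/4.

  For the quadratic law, expand Z_{n+1}^2/(n+1) - Z_n^2/n: it is -(1-2 sigma) Z_n^2/n^2 (1+o(1))
  + m^2 q_n (1-q_n)/(n+1) plus a martingale increment.  Ville's inequality bounds a martingale by a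
  constant plus an arbitrarily small multiple of its sum of squared coefficients, and Z_n^2/n = o(log n).
*)
theory Submission
  imports Defs "HOL-Real_Asymp.Real_Asymp"
begin

text \<open>Two points are delicate. The sharp constant requires q_n -> p, itself a statement on the
  size of Z; the circle opens because u^2 / 8 bounds the logarithmic moment generating function of a
  centred draw for every q, so a law with a worse constant is available without knowledge of q.
  Moreover, block increments are dependent and their conditional variances random. Closing the draws
  at which q_n is far from p, by a predictable factor 0 or 1, keeps the compensator under control on
  every path, and a path with q_n -> p loses only finitely many draws. The minorant of the lower
  half has a deterministic conditional expectation, so that products of factors 1 - G take the place
  of independence.

  Smallness of the urn appears as the divergence of V_n: n / pi_n^2 is a sum of the same squared
  weights with factors tending to 1 - 2 sigma > 0, and averaging these factors gives the limit of
  V_n pi_n^2 / n. The case m = 0 is not separated: the noise then has coefficient 0 and all limits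
  are 0. The factor 2 in the scalar laws is the squared norm of (1,-1).\<close>

section \<open>Bernoulli draws and exponential martingales\<close>

text \<open>The logarithmic moment generating function of a centred Bernoulli(\<open>q\<close>) variable.\<close>

definition cgf :: "real \<Rightarrow> real \<Rightarrow> real" where
  "cgf q u = ln (1 - q + q * exp u) - q * u"

lemma cgf_0 [simp]: "cgf q 0 = 0"
  by (simp add: cgf_def)

lemma mgf_pos:
  fixes q u :: real
  assumes "q \<in> {0..1}"
  shows "1 - q + q * exp u > 0"
proof (cases "q = 1")
  case False
  then have "1 - q > 0" "q * exp u \<ge> 0" using assms by auto
  then show ?thesis by linarith
qed simp

text \<open>For \<open>u \<ge> 0\<close> this is Hoeffding's lemma; for negative \<open>u\<close>,
  success and failure are exchanged, since \<open>cgf q u = cgf (1 - q) (- u)\<close>. The bound is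
  that of a Gaussian with variance 1/4, uniformly in \<open>q\<close>.\<close>

lemma cgf_le_Hoeffding:
  assumes "q \<in> {0..1}"
  shows "cgf q u \<le> u\<^sup>2 / 8"
proof (cases "u \<ge> 0")
  case True
  then show ?thesis
    using Hoeffdings_lemma_aux[of u q] assms by (simp add: cgf_def algebra_simps)
next
  case False
  have "1 - q + q * exp u = exp u * (1 + (1 - q) * (exp (-u) - 1))"
    by (simp add: algebra_simps exp_minus)
  moreover have "1 + (1 - q) * (exp (-u) - 1) > 0"
    using mgf_pos[of "1 - q" "-u"] assms by (simp add: algebra_simps)
  ultimately have "ln (1 - q + q * exp u) = u + ln (1 + (1 - q) * (exp (-u) - 1))"
    by (simp add: ln_mult_pos)
  then show ?thesis
    using Hoeffdings_lemma_aux[of "-u" "1 - q"] False assms by (simp add: cgf_def algebra_simps)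
qed

text \<open>A crude bound (convexity would give 0). It serves to bound \<open>loglik\<close> from
  above at each fixed time, so that its exponential is integrable.\<close>

lemma cgf_lower:
  assumes "q \<in> {0..1}" shows "cgf q u \<ge> - 2 * \<bar>u\<bar>"
proof -
  have "exp (- \<bar>u\<bar>) \<le> 1 - q + q * exp u"
  proof -
    have "(1 - q) * exp (- \<bar>u\<bar>) \<le> (1 - q) * 1" "q * exp (- \<bar>u\<bar>) \<le> q * exp u"
      using assms by (intro mult_left_mono; auto)+
    then show ?thesis by (simp add: algebra_simps)
  qed
  then have "- \<bar>u\<bar> \<le> ln (1 - q + q * exp u)"
    using mgf_pos[OF assms] by (subst ln_ge_iff) auto
  moreover have "q * u \<le> \<bar>u\<bar>" using assms
    by (metis abs_ge_self abs_mult abs_of_nonneg atLeastAtMost_iff mult_left_le_one_le abs_ge_zero order_trans)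
  ultimately show ?thesis by (simp add: cgf_def)
qed

text \<open>Here \<open>e n\<close> is drawn at time \<open>n + 1\<close>, with success probability \<open>q n\<close> given \<open>F n\<close>.\<close>

locale bernoulli_draws = prob_space M + filtration "space M" F
  for M :: "'a measure" and F :: "nat \<Rightarrow> 'a measure" +
  fixes e q :: "nat \<Rightarrow> 'a \<Rightarrow> real"
  assumes subalg: "\<And>n. subalgebra M (F n)"
    and draw: "\<And>n \<omega>. e n \<omega> \<in> {0, 1}"
    and draw_measurable: "\<And>n. e n \<in> borel_measurable (F (Suc n))"
    and q_measurable: "\<And>n. q n \<in> borel_measurable (F n)"
    and q_range: "\<And>n \<omega>. q n \<omega> \<in> {0..1}"
    and draw_expectation: "\<And>n f B. f \<in> borel_measurable (F n) \<Longrightarrow> (\<And>\<omega>. \<bar>f \<omega>\<bar> \<le> B)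
      \<Longrightarrow> expectation (\<lambda>\<omega>. f \<omega> * e n \<omega>) = expectation (\<lambda>\<omega>. f \<omega> * q n \<omega>)"
begin

text \<open>Index \<open>n\<close> goes with \<open>F n\<close> because the noise
  \<open>\<xi> n\<close> is revealed only at time n + 1. The bound may depend on \<open>n\<close>:
  all expectations concern finitely many steps.\<close>

definition predictable :: "(nat \<Rightarrow> 'a \<Rightarrow> real) \<Rightarrow> bool" where
  "predictable H \<longleftrightarrow> (\<forall>n. H n \<in> borel_measurable (F n) \<and> (\<exists>B. \<forall>\<omega>. \<bar>H n \<omega>\<bar> \<le> B))"

definition \<xi> :: "nat \<Rightarrow> 'a \<Rightarrow> real" where
  "\<xi> n \<omega> = e n \<omega> - q n \<omega>"

text \<open>The logarithm of a likelihood ratio: \<open>exp (H * \<xi> - cgf q H)\<close> is the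
  density of the Bernoulli law whose odds are multiplied by \<open>exp H\<close>. Its conditional
  expectation is therefore 1.\<close>

definition loglik :: "(nat \<Rightarrow> 'a \<Rightarrow> real) \<Rightarrow> nat \<Rightarrow> nat \<Rightarrow> 'a \<Rightarrow> real" where
  "loglik H m n \<omega> = (\<Sum>j=m..<n. H j \<omega> * \<xi> j \<omega> - cgf (q j \<omega>) (H j \<omega>))"

lemma measurable_F_mono: "f \<in> borel_measurable (F m) \<Longrightarrow> m \<le> n \<Longrightarrow> f \<in> borel_measurable (F n)"
  using sets_F_mono[of m n] space_F unfolding measurable_def by auto

lemma measurable_F_M: "f \<in> borel_measurable (F m) \<Longrightarrow> f \<in> borel_measurable M"
  by (rule measurable_from_subalg[OF subalg])

lemma q_meas [measurable]: "n \<le> k \<Longrightarrow> q n \<in> borel_measurable (F k)"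
  using measurable_F_mono q_measurable by blast

lemma e_meas [measurable]: "n < k \<Longrightarrow> e n \<in> borel_measurable (F k)"
  using measurable_F_mono draw_measurable by (meson Suc_leI)

lemma xi_meas [measurable]: "n < k \<Longrightarrow> \<xi> n \<in> borel_measurable (F k)"
  unfolding \<xi>_def by simp

lemma xi_bound: "\<bar>\<xi> n \<omega>\<bar> \<le> 1"
  using draw[of n \<omega>] q_range[of n \<omega>] by (auto simp: \<xi>_def)

lemma predictableD: "predictable H \<Longrightarrow> n \<le> k \<Longrightarrow> H n \<in> borel_measurable (F k)"
  using measurable_F_mono unfolding predictable_def by blast

lemma predictable_bound:
  assumes "predictable H" obtains B where "B \<ge> 0" "\<And>\<omega>. \<bar>H n \<omega>\<bar> \<le> B"
  using assms unfolding predictable_def by (metis abs_ge_zero order_trans)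

lemma loglik_meas:
  assumes "predictable H" "n \<le> k"
  shows "loglik H m n \<in> borel_measurable (F k)"
proof -
  have "(\<lambda>\<omega>. H j \<omega> * \<xi> j \<omega> - cgf (q j \<omega>) (H j \<omega>)) \<in> borel_measurable (F k)" if "j < n" for j
  proof -
    have [measurable]: "H j \<in> borel_measurable (F k)" "q j \<in> borel_measurable (F k)"
      "\<xi> j \<in> borel_measurable (F k)"
      using that assms by (auto intro: predictableD)
    show ?thesis unfolding cgf_def by measurable
  qed
  then show ?thesis unfolding loglik_def by (intro borel_measurable_sum) auto
qed

lemma loglik_bound:
  assumes "predictable H"
  obtains B where "\<And>\<omega>. loglik H m n \<omega> \<le> B"
proof -
  obtain B where B: "\<And>j \<omega>. \<bar>H j \<omega>\<bar> \<le> B j" "\<And>j. B j \<ge> 0"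
  proof -
    have "\<forall>j. \<exists>B. \<forall>\<omega>. \<bar>H j \<omega>\<bar> \<le> B" using assms unfolding predictable_def by blast
    from choice[OF this] obtain B where B: "\<And>j \<omega>. \<bar>H j \<omega>\<bar> \<le> B j" by blast
    have "0 \<le> B j" for j using abs_ge_zero B by (rule order_trans)
    with B show ?thesis by (rule that)
  qed
  have "H j \<omega> * \<xi> j \<omega> - cgf (q j \<omega>) (H j \<omega>) \<le> 3 * B j" for j \<omega>
  proof -
    have "H j \<omega> * \<xi> j \<omega> \<le> B j * 1"
    proof -
      have "\<bar>H j \<omega>\<bar> * \<bar>\<xi> j \<omega>\<bar> \<le> B j * 1" using B xi_bound by (intro mult_mono) auto
      then show ?thesis using abs_ge_self[of "H j \<omega> * \<xi> j \<omega>"] unfolding abs_mult by linarith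
    qed
    moreover have "cgf (q j \<omega>) (H j \<omega>) \<ge> - 2 * B j"
    proof -
      have "\<bar>H j \<omega>\<bar> \<le> B j" by (rule B)
      then show ?thesis using cgf_lower[OF q_range[of j \<omega>], of "H j \<omega>"] by linarith
    qed
    ultimately show ?thesis by linarith
  qed
  then have "loglik H m n \<omega> \<le> (\<Sum>j=m..<n. 3 * B j)" for \<omega>
    unfolding loglik_def by (intro sum_mono) auto
  then show ?thesis using that by blast
qed

text \<open>A draw is 0 or 1, so \<open>exp (H * e)\<close> equals 1 + e * (exp H - 1), which is
  affine in e. Replacing e by q through \<open>draw_expectation\<close> produces exactly the
  denominator 1 - q + q * exp H, which cancels.\<close>

lemma expectation_step:
  assumes f: "f \<in> borel_measurable (F n)" "\<And>\<omega>. \<bar>f \<omega>\<bar> \<le> B" and H: "predictable H"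
  shows "expectation (\<lambda>\<omega>. f \<omega> * exp (H n \<omega> * \<xi> n \<omega> - cgf (q n \<omega>) (H n \<omega>))) = expectation f"
proof -
  obtain K where K: "\<And>\<omega>. \<bar>H n \<omega>\<bar> \<le> K" using predictable_bound[OF H, of n] by metis
  define D where "D \<omega> = 1 - q n \<omega> + q n \<omega> * exp (H n \<omega>)" for \<omega>
  define g where "g \<omega> = f \<omega> / D \<omega>" for \<omega>
  define h where "h \<omega> = g \<omega> * (exp (H n \<omega>) - 1)" for \<omega>
  have Dpos: "D \<omega> > 0" for \<omega> unfolding D_def by (rule mgf_pos[OF q_range])
  have [measurable]: "f \<in> borel_measurable (F n)" "H n \<in> borel_measurable (F n)" "q n \<in> borel_measurable (F n)"
    using f H by (auto intro: predictableD)
  \<comment> \<open>A lower bound uniform in \<open>\<omega>\<close> keeps \<open>g\<close> and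
    \<open>h\<close> bounded, as \<open>draw_expectation\<close> demands of its test
    function.\<close>
  have Dge: "D \<omega> \<ge> exp (- K)" for \<omega>
  proof -
    have "(1 - q n \<omega>) * exp (- K) \<le> (1 - q n \<omega>) * 1" "q n \<omega> * exp (- K) \<le> q n \<omega> * exp (H n \<omega>)"
      using q_range[of n \<omega>] K[of \<omega>] by (intro mult_left_mono; auto)+
    then show ?thesis by (simp add: D_def algebra_simps)
  qed
  have gB: "\<bar>g \<omega>\<bar> \<le> B / exp (- K)" for \<omega>
    unfolding g_def abs_divide using f(2)[of \<omega>] Dge[of \<omega>] Dpos[of \<omega>]
    by (intro frac_le) auto
  have Bnn: "B \<ge> 0" using f(2) abs_ge_zero order_trans by blast
  have hB: "\<bar>h \<omega>\<bar> \<le> B / exp (- K) * (exp K + 1)" for \<omega>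
  proof -
    have "exp (H n \<omega>) \<le> exp K" using K[of \<omega>] by auto
    then have "\<bar>exp (H n \<omega>) - 1\<bar> \<le> exp K + 1"
      using exp_gt_zero[of "H n \<omega>"] exp_gt_zero[of K] by linarith
    then show ?thesis unfolding h_def abs_mult using gB Bnn by (intro mult_mono) auto
  qed
  have gm: "g \<in> borel_measurable (F n)" and hm: "h \<in> borel_measurable (F n)"
    unfolding h_def g_def D_def by measurable
  have eB: "\<bar>e n \<omega>\<bar> \<le> 1" "\<bar>q n \<omega>\<bar> \<le> 1" for \<omega> using draw[of n \<omega>] q_range[of n \<omega>] by auto
  have eM: "e n \<in> borel_measurable M" "q n \<in> borel_measurable M"
    using draw_measurable q_measurable measurable_F_M by blast+
  have ig: "integrable M g"
    using gB gm measurable_F_M by (intro integrable_const_bound[where B = "B / exp (- K)"]) auto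
  have ihe: "integrable M (\<lambda>\<omega>. h \<omega> * x \<omega>)" if "x = e n \<or> x = q n" for x
  proof (intro integrable_const_bound[where B = "B / exp (- K) * (exp K + 1)"] AE_I2)
    show "(\<lambda>\<omega>. h \<omega> * x \<omega>) \<in> borel_measurable M"
      using that eM hm measurable_F_M by (intro borel_measurable_times) auto
    show "norm (h \<omega> * x \<omega>) \<le> B / exp (- K) * (exp K + 1)" for \<omega>
      using mult_mono[OF hB[of \<omega>], of "\<bar>x \<omega>\<bar>" 1] that eB[of \<omega>] hB[of \<omega>] by (auto simp: abs_mult)
  qed
  have "f \<omega> * exp (H n \<omega> * \<xi> n \<omega> - cgf (q n \<omega>) (H n \<omega>)) = g \<omega> + h \<omega> * e n \<omega>" for \<omega>
  proof -
    have "exp (H n \<omega> * \<xi> n \<omega> - cgf (q n \<omega>) (H n \<omega>)) = exp (H n \<omega> * e n \<omega>) / D \<omega>"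
    proof -
      have "cgf (q n \<omega>) (H n \<omega>) = ln (D \<omega>) - q n \<omega> * H n \<omega>"
        by (simp add: cgf_def D_def)
      then have "H n \<omega> * \<xi> n \<omega> - cgf (q n \<omega>) (H n \<omega>) = H n \<omega> * e n \<omega> - ln (D \<omega>)"
        by (simp add: \<xi>_def algebra_simps)
      then show ?thesis using Dpos[of \<omega>] by (simp add: exp_diff)
    qed
    also have "exp (H n \<omega> * e n \<omega>) = 1 + e n \<omega> * (exp (H n \<omega>) - 1)"
      using draw[of n \<omega>] by auto
    finally have "f \<omega> * exp (H n \<omega> * \<xi> n \<omega> - cgf (q n \<omega>) (H n \<omega>))
      = f \<omega> * ((1 + e n \<omega> * (exp (H n \<omega>) - 1)) / D \<omega>)" by simp
    also have "\<dots> = g \<omega> + h \<omega> * e n \<omega>"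
      using Dpos[of \<omega>] by (simp add: h_def g_def field_simps)
    finally show ?thesis .
  qed
  then have "expectation (\<lambda>\<omega>. f \<omega> * exp (H n \<omega> * \<xi> n \<omega> - cgf (q n \<omega>) (H n \<omega>)))
     = expectation g + expectation (\<lambda>\<omega>. h \<omega> * e n \<omega>)"
    using ig ihe by simp
  also have "\<dots> = expectation g + expectation (\<lambda>\<omega>. h \<omega> * q n \<omega>)"
    using draw_expectation[OF hm hB] by simp
  also have "\<dots> = expectation (\<lambda>\<omega>. g \<omega> + h \<omega> * q n \<omega>)"
    using ig ihe by simp
  also have "(\<lambda>\<omega>. g \<omega> + h \<omega> * q n \<omega>) = f"
  proof
    fix \<omega> have "g \<omega> + h \<omega> * q n \<omega> = g \<omega> * D \<omega>" by (simp add: h_def D_def algebra_simps)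
    then show "g \<omega> + h \<omega> * q n \<omega> = f \<omega>" using Dpos[of \<omega>] by (simp add: g_def)
  qed
  finally show ?thesis .
qed

text \<open>The bounded \<open>F m\<close>-measurable factor \<open>f\<close> expresses the
  martingale property given \<open>F m\<close> without conditional expectations; in this form it is
  iterated over blocks.\<close>

lemma expectation_loglik:
  assumes f: "f \<in> borel_measurable (F m)" "\<And>\<omega>. \<bar>f \<omega>\<bar> \<le> B" and H: "predictable H" and "m \<le> n"
  shows "expectation (\<lambda>\<omega>. f \<omega> * exp (loglik H m n \<omega>)) = expectation f"
  using \<open>m \<le> n\<close>
proof (induction n rule: dec_induct)
  case base
  then show ?case by (simp add: loglik_def)
next
  case (step n)
  obtain C where C: "\<And>\<omega>. loglik H m n \<omega> \<le> C" using loglik_bound[OF H] by metis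
  have m: "(\<lambda>\<omega>. f \<omega> * exp (loglik H m n \<omega>)) \<in> borel_measurable (F n)"
    using measurable_F_mono[OF f(1) step(1)] loglik_meas[OF H order_refl, of m n] by measurable
  have b: "\<bar>f \<omega> * exp (loglik H m n \<omega>)\<bar> \<le> B * exp C" for \<omega>
    unfolding abs_mult using f(2)[of \<omega>] C[of \<omega>] by (intro mult_mono) (auto intro: order_trans[OF abs_ge_zero])
  have "exp (loglik H m (Suc n) \<omega>) = exp (loglik H m n \<omega>) * exp (H n \<omega> * \<xi> n \<omega> - cgf (q n \<omega>) (H n \<omega>))" for \<omega>
    using step(1) unfolding loglik_def by (simp add: exp_add[symmetric])
  then show ?case using expectation_step[OF m b H] step(3) by (simp add: mult.assoc)
qed

text \<open>Freezing \<open>H\<close> at the first passage of the level \<open>x\<close> reduces the supremum to Markov's inequality.\<close>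

lemma Ville:
  assumes H: "predictable H"
  shows "prob {\<omega> \<in> space M. \<exists>n. loglik H 0 n \<omega> \<ge> x} \<le> exp (- x)" (is "prob ?E \<le> _")
proof -
  define A where "A n = {\<omega> \<in> space M. \<exists>i\<le>n. loglik H 0 i \<omega> \<ge> x}" for n
  define H' where "H' j \<omega> = (if \<forall>i\<le>j. loglik H 0 i \<omega> < x then H j \<omega> else 0)" for j \<omega>
  have lM [measurable]: "loglik H 0 n \<in> borel_measurable M" for n
    using loglik_meas[OF H order_refl] measurable_F_M by blast
  have AM: "A n \<in> events" for n unfolding A_def by measurable
  have H': "predictable H'"
    unfolding predictable_def
  proof (intro allI conjI)
    fix n
    have [measurable]: "loglik H 0 i \<in> borel_measurable (F n)" if "i \<le> n" for i
      using loglik_meas[OF H that] .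
    have [measurable]: "H n \<in> borel_measurable (F n)" using predictableD[OF H] by auto
    have "H' n = (\<lambda>\<omega>. if \<forall>i\<in>{..n}. loglik H 0 i \<omega> < x then H n \<omega> else 0)"
      unfolding H'_def by auto
    also have "\<dots> \<in> borel_measurable (F n)"
      by (intro measurable_If pred_intros_finite) auto
    finally show "H' n \<in> borel_measurable (F n)" .
    obtain B where "B \<ge> 0" "\<And>\<omega>. \<bar>H n \<omega>\<bar> \<le> B" using predictable_bound[OF H] by metis
    then have "\<forall>\<omega>. \<bar>H' n \<omega>\<bar> \<le> B" by (auto simp: H'_def)
    then show "\<exists>B. \<forall>\<omega>. \<bar>H' n \<omega>\<bar> \<le> B" by blast
  qed
  have stop: "(\<exists>i\<le>n. loglik H 0 i \<omega> \<ge> x \<and> loglik H' 0 n \<omega> \<ge> x)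
      \<or> ((\<forall>i\<le>n. loglik H 0 i \<omega> < x) \<and> loglik H' 0 n \<omega> = loglik H 0 n \<omega>)" for n \<omega>
  proof (induction n)
    case 0
    then show ?case by (auto simp: loglik_def)
  next
    case (Suc n)
    have eq: "loglik H' 0 (Suc n) \<omega> = loglik H' 0 n \<omega> + (H' n \<omega> * \<xi> n \<omega> - cgf (q n \<omega>) (H' n \<omega>))"
       "loglik H 0 (Suc n) \<omega> = loglik H 0 n \<omega> + (H n \<omega> * \<xi> n \<omega> - cgf (q n \<omega>) (H n \<omega>))"
      by (auto simp: loglik_def)
    from Suc show ?case
    proof
      assume a: "\<exists>i\<le>n. loglik H 0 i \<omega> \<ge> x \<and> loglik H' 0 n \<omega> \<ge> x"
      then have "H' n \<omega> = 0" by (auto simp: H'_def)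
      then show ?case using a eq by (auto intro: le_SucI)
    next
      assume a: "(\<forall>i\<le>n. loglik H 0 i \<omega> < x) \<and> loglik H' 0 n \<omega> = loglik H 0 n \<omega>"
      then have "H' n \<omega> = H n \<omega>" by (auto simp: H'_def)
      then show ?case using a eq by (metis le_Suc_eq linorder_not_less)
    qed
  qed
  have PA: "prob (A n) \<le> exp (- x)" for n
  proof -
    obtain C where C: "\<And>\<omega>. loglik H' 0 n \<omega> \<le> C" using loglik_bound[OF H'] by metis
    have mm: "loglik H' 0 n \<in> borel_measurable M" using loglik_meas[OF H' order_refl] measurable_F_M by blast
    have int: "integrable M (\<lambda>\<omega>. exp (loglik H' 0 n \<omega>))"
      using C mm by (intro integrable_const_bound[where B = "exp C"]) auto
    have "exp x * prob (A n) = expectation (\<lambda>\<omega>. exp x * indicator (A n) \<omega>)"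
      using AM by simp
    also have "\<dots> \<le> expectation (\<lambda>\<omega>. exp (loglik H' 0 n \<omega>))"
    proof (rule integral_mono)
      show "integrable M (\<lambda>\<omega>. exp x * indicator (A n) \<omega>)"
        using AM by (intro integrable_mult_right integrable_real_indicator) (auto simp: emeasure_eq_measure)
      show "exp x * indicator (A n) \<omega> \<le> exp (loglik H' 0 n \<omega>)" for \<omega>
        using stop[of n \<omega>] by (fastforce simp: A_def indicator_def)
    qed (fact int)
    also have "\<dots> = 1"
      using expectation_loglik[of "\<lambda>_. 1" 0 1 H' n] H' prob_space by simp
    finally show ?thesis by (simp add: exp_minus field_simps)
  qed
  have "(\<lambda>n. prob (A n)) \<longlonglongrightarrow> prob (\<Union>n. A n)"
    using AM by (intro finite_Lim_measure_incseq) (auto simp: incseq_def A_def intro: order_trans)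
  moreover have "(\<Union>n. A n) = ?E" by (auto simp: A_def)
  ultimately show ?thesis using PA by (metis LIMSEQ_le_const2)
qed

end

section \<open>The law of the iterated logarithm for weighted sums of draws\<close>

lemma geometric_bracket:
  fixes \<rho> v :: real
  assumes "\<rho> > 1" "v \<ge> 1"
  obtains k where "\<rho> ^ k \<le> v" "v < \<rho> ^ Suc k"
proof -
  define k where "k = (LEAST k. v < \<rho> ^ Suc k)"
  obtain n where "v < \<rho> ^ n" using real_arch_pow[OF assms(1)] by blast
  then have "v < \<rho> ^ Suc n" using assms(1) power_increasing[of n "Suc n" \<rho>] by linarith
  then have 1: "v < \<rho> ^ Suc k" unfolding k_def by (rule LeastI)
  have "\<rho> ^ k \<le> v"
  proof (cases k)
    case (Suc l)
    then have "l < (LEAST k. v < \<rho> ^ Suc k)" unfolding k_def by (metis lessI)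
    from not_less_Least[OF this] show ?thesis using Suc by simp
  qed (use assms in auto)
  then show ?thesis using 1 that by blast
qed

text \<open>Kolmogorov's condition has an iterated logarithm where \<open>w_negligible\<close> has a
  logarithm. The stronger form is at hand for the urn, where the quotient is of order ln n / n, and
  it makes the tilted weights uniformly small on each geometric block.\<close>

locale lil_weights =
  fixes w V :: "nat \<Rightarrow> real"
  assumes V_eq: "V n = (\<Sum>j<n. (w j)\<^sup>2)"
    and V_unbounded: "filterlim V at_top sequentially"
    and w_negligible: "(\<lambda>n. (w n)\<^sup>2 * ln (V (Suc n)) / V (Suc n)) \<longlonglongrightarrow> 0"
begin

definition \<phi> :: "nat \<Rightarrow> real" where
  "\<phi> n = sqrt (2 * V n * ln (ln (V n)))"

lemma V_mono: "m \<le> n \<Longrightarrow> V m \<le> V n"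
  unfolding V_eq by (intro sum_mono2) auto

lemma V_Suc: "V (Suc n) = V n + (w n)\<^sup>2"
  by (simp add: V_eq)

lemma V_nonneg: "V n \<ge> 0"
  by (simp add: V_eq sum_nonneg)

lemma V_eventually_ge: "eventually (\<lambda>n. V n \<ge> x) sequentially"
  using V_unbounded unfolding filterlim_at_top by blast

text \<open>The quotient ln x / x decreases beyond e, which carries the estimate from x =
  \<open>V (Suc j)\<close> to every larger \<open>v\<close>. The finitely many early weights are
  bounded by \<open>V J\<close>, and \<open>V J * ln v / v\<close> tends to 0.\<close>

lemma w_small:
  assumes "\<epsilon> > 0"
  shows "eventually (\<lambda>v. \<forall>j. V (Suc j) \<le> v \<longrightarrow> (w j)\<^sup>2 * ln v \<le> \<epsilon> * v) at_top"
proof -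
  have "eventually (\<lambda>n. (w n)\<^sup>2 * ln (V (Suc n)) / V (Suc n) < \<epsilon>) sequentially"
    using order_tendstoD(2)[OF w_negligible assms] .
  moreover have "eventually (\<lambda>n. V (Suc n) \<ge> exp 1) sequentially"
    using V_eventually_ge[of "exp 1"] eventually_sequentially_Suc[of "\<lambda>n. V n \<ge> exp 1"] by simp
  ultimately have "eventually (\<lambda>n. (w n)\<^sup>2 * ln (V (Suc n)) / V (Suc n) < \<epsilon> \<and> V (Suc n) \<ge> exp 1) sequentially"
    by (rule eventually_conj)
  then obtain J where J: "\<And>n. n \<ge> J \<Longrightarrow> (w n)\<^sup>2 * ln (V (Suc n)) / V (Suc n) < \<epsilon>"
    "\<And>n. n \<ge> J \<Longrightarrow> V (Suc n) \<ge> exp 1"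
    unfolding eventually_sequentially by blast
  have "((\<lambda>v::real. V J * ln v / v) \<longlongrightarrow> 0) at_top"
    by real_asymp
  then have "eventually (\<lambda>v. V J * ln v / v < \<epsilon>) at_top"
    using assms by (intro order_tendstoD)
  then show ?thesis
    using eventually_ge_at_top[of "exp 1"]
  proof eventually_elim
    case (elim v)
    have vpos: "v > 0" using elim(2) exp_gt_zero[of 1] by linarith
    have lnv: "ln v \<ge> 1" using elim(2) vpos by (subst ln_ge_iff) auto
    show ?case
    proof (intro allI impI)
      fix j assume j: "V (Suc j) \<le> v"
      show "(w j)\<^sup>2 * ln v \<le> \<epsilon> * v"
      proof (cases "j < J")
        case True
        then have "(w j)\<^sup>2 \<le> V J"
          unfolding V_eq by (intro member_le_sum) auto
        then have "(w j)\<^sup>2 * ln v \<le> V J * ln v" using lnv by (intro mult_right_mono) auto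
        also have "\<dots> \<le> \<epsilon> * v" using elim(1) vpos by (simp add: divide_simps split: if_splits)
        finally show ?thesis .
      next
        case False
        define x where "x = V (Suc j)"
        have x: "x \<ge> exp 1" "(w j)\<^sup>2 * ln x / x < \<epsilon>" using J[of j] False by (auto simp: x_def)
        have xpos: "x > 0" using x(1) exp_gt_zero[of 1] by linarith
        have lnx: "ln x \<ge> 1" using x xpos by (subst ln_ge_iff) auto
        \<comment> \<open>Monotonicity of the quotient beyond e without derivatives: ln (v / x)
          \<le> v / x - 1 \<le> ln x * (v / x - 1).\<close>
        have "ln v * x \<le> ln x * v"
        proof -
          have "v / x > 0" "ln (v / x) \<le> v / x - 1" using xpos vpos by (auto intro: ln_le_minus_one)
          then have "ln v \<le> ln x + (v / x - 1)" using xpos vpos by (simp add: ln_div)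
          also have "\<dots> \<le> ln x + ln x * (v / x - 1)"
            using lnx j xpos mult_right_mono[of 1 "ln x" "v / x - 1"] by (simp add: x_def)
          also have "\<dots> = ln x * (v / x)" by (simp add: algebra_simps)
          finally show ?thesis using xpos by (simp add: field_simps)
        qed
        then have "(w j)\<^sup>2 * (ln v * x) \<le> (w j)\<^sup>2 * (ln x * v)" by (rule mult_left_mono) simp
        also have "\<dots> = ((w j)\<^sup>2 * ln x / x) * (x * v)" using xpos by simp
        also have "\<dots> \<le> \<epsilon> * (x * v)" using x(2) xpos vpos by (intro mult_right_mono) auto
        finally show ?thesis using xpos by (simp add: algebra_simps)
      qed
    qed
  qed
qed

text \<open>From \<rho>^k \<le> v follows k * ln \<rho> \<le> ln v. The factor k, larger than the ln
  k that the tilts of the k-th block contain, comes from the full logarithm in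
  \<open>w_negligible\<close>.\<close>

lemma w_small_geometric:
  assumes "\<rho> > 1" "u > 0"
  shows "eventually (\<lambda>k. \<forall>j v. \<rho> ^ k \<le> v \<longrightarrow> V (Suc j) \<le> v \<longrightarrow> (w j)\<^sup>2 * real k \<le> u * v) sequentially"
proof -
  have "eventually (\<lambda>v. \<forall>j. V (Suc j) \<le> v \<longrightarrow> (w j)\<^sup>2 * ln v \<le> u * ln \<rho> * v) at_top"
    using assms by (intro w_small) auto
  then obtain K where K: "\<And>v j. v \<ge> K \<Longrightarrow> V (Suc j) \<le> v \<Longrightarrow> (w j)\<^sup>2 * ln v \<le> u * ln \<rho> * v"
    unfolding eventually_at_top_linorder by blast
  have "eventually (\<lambda>k. \<rho> ^ k \<ge> K) sequentially"
    using filterlim_realpow_sequentially_gt1[of \<rho>] assms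
    unfolding filterlim_at_infinity_conv_norm_at_top filterlim_at_top by (auto elim!: eventually_mono[of _ _ "\<lambda>k. \<rho> ^ k \<ge> K"] allE[of _ K])
  then show ?thesis
  proof eventually_elim
    case (elim k)
    show ?case
    proof (intro allI impI)
      fix j v assume v: "\<rho> ^ k \<le> v" "V (Suc j) \<le> v"
      have vp: "0 < \<rho> ^ k" using assms by simp
      have "real k * ln \<rho> \<le> ln v"
        using v(1) vp order_less_le_trans[OF vp v(1)] assms by (simp add: ln_realpow[symmetric])
      then have "(w j)\<^sup>2 * (real k * ln \<rho>) \<le> (w j)\<^sup>2 * ln v" by (intro mult_left_mono) auto
      also have "\<dots> \<le> u * ln \<rho> * v" using K[of v j] v elim by auto
      finally show "(w j)\<^sup>2 * real k \<le> u * v" using assms(1) by (simp add: algebra_simps)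
    qed
  qed
qed

end

locale weighted_bernoulli_sums = bernoulli_draws M F e q + lil_weights w V
  for M :: "'a measure" and F :: "nat \<Rightarrow> 'a measure" and e q w V
begin

text \<open>Ville's inequality at level \<rho> * ln k has probability at most k^(-\<rho>), which is
  summable. The gate \<open>g\<close> restricts the hypothesis on \<open>cgf\<close> to open draws:
  the constant gate with Hoeffding's bound yields the crude law, a gate that is open near
  \<open>p\<close> the sharp one.\<close>

lemma upper_LIL_predictable:
  assumes g: "predictable g" "\<And>n \<omega>. g n \<omega> \<in> {0, 1}"
    and s: "s > 0" and u0: "u0 > 0"
    and cgf: "\<And>n \<omega> u. g n \<omega> = 1 \<Longrightarrow> \<bar>u\<bar> \<le> u0 \<Longrightarrow> cgf (q n \<omega>) u \<le> s\<^sup>2 * u\<^sup>2 / 2"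
    and \<delta>: "\<delta> > 0"
  shows "AE \<omega> in M. eventually (\<lambda>n. (\<Sum>j<n. w j * g j \<omega> * \<xi> j \<omega>) \<le> (1 + \<delta>) * s * \<phi> n) sequentially"
proof -
  \<comment> \<open>Any value strictly between 1 and 1 + \<delta> serves. The block ratio costs a
    factor \<rho>, and the gap between \<rho>^2 and (1 + \<delta>)^2 absorbs the constant ln (ln
    \<rho>) by which ln (ln (V n)) can fall short of ln k.\<close>
  define \<rho> where "\<rho> = 1 + \<delta> / 2"
  have \<rho>: "\<rho> > 1" using \<delta> by (simp add: \<rho>_def)
  \<comment> \<open>The optimal tilt for the level \<rho> * ln k and the variance s^2 *
    \<rho>^(k+1): the compensator at the end of the block is then at most \<rho> * ln k as
    well.\<close>
  define \<theta> where "\<theta> k = sqrt (2 * ln (real k) / (s\<^sup>2 * \<rho> ^ k))" for k :: nat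
  \<comment> \<open>The tilt acts from time 0 up to the deterministic end of the k-th block and is
    switched off afterwards, so the smallness of \<theta> * w is asked for on this range
    only.\<close>
  define H where "H k j \<omega> = (if V (Suc j) < \<rho> ^ Suc k then \<theta> k * w j * g j \<omega> else 0)" for k j \<omega>
  have H: "predictable (H k)" for k
    unfolding predictable_def
  proof (intro allI conjI)
    fix j
    have [measurable]: "g j \<in> borel_measurable (F j)" using g predictableD by blast
    show "H k j \<in> borel_measurable (F j)" unfolding H_def by measurable
    have "\<bar>H k j \<omega>\<bar> \<le> \<bar>\<theta> k * w j\<bar>" for \<omega> using g(2)[of j \<omega>] by (auto simp: H_def)
    then show "\<exists>B. \<forall>\<omega>. \<bar>H k j \<omega>\<bar> \<le> B" by blast
  qed
  define E where "E k = {\<omega> \<in> space M. \<exists>n. loglik (H k) 0 n \<omega> \<ge> \<rho> * ln (real k)}" for k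
  have [measurable]: "loglik (H k) 0 n \<in> borel_measurable M" for k n
    using loglik_meas[OF H order_refl] measurable_F_M by blast
  have EM: "E k \<in> events" for k unfolding E_def by measurable
  have PE: "prob (E k) \<le> real k powr (- \<rho>)" if "k > 0" for k
    using Ville[OF H[of k], of "\<rho> * ln (real k)"] that by (simp add: E_def powr_def)
  have "summable (\<lambda>k. prob (E k))"
  proof (rule summable_comparison_test_ev)
    show "eventually (\<lambda>k. norm (prob (E k)) \<le> real k powr (- \<rho>)) sequentially"
      using eventually_gt_at_top[of 0] by eventually_elim (use PE in auto)
    show "summable (\<lambda>k. real k powr (- \<rho>))" using \<rho> by (simp add: summable_real_powr_iff)
  qed
  then have BC: "AE \<omega> in M. eventually (\<lambda>k. \<omega> \<in> space M - E k) sequentially"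
    using EM by (intro borel_cantelli_AE1) (auto simp: emeasure_eq_measure)
  have small: "eventually (\<lambda>k. \<forall>j. V (Suc j) < \<rho> ^ Suc k \<longrightarrow> \<bar>\<theta> k * w j\<bar> \<le> u0) sequentially"
  proof -
    define \<epsilon> where "\<epsilon> = u0\<^sup>2 * s\<^sup>2 / (2 * \<rho>)"
    have "\<epsilon> > 0" using u0 s \<rho> by (simp add: \<epsilon>_def)
    from w_small_geometric[OF \<rho> this] show ?thesis
      using eventually_ge_at_top[of 1]
    proof eventually_elim
      case (elim k)
      show ?case
      proof (intro allI impI)
        fix j assume j: "V (Suc j) < \<rho> ^ Suc k"
        have "(w j)\<^sup>2 * real k \<le> \<epsilon> * \<rho> ^ Suc k"
          using elim(1) j \<rho> power_increasing[of k "Suc k" \<rho>] by auto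
        moreover have "(w j)\<^sup>2 * ln (real k) \<le> (w j)\<^sup>2 * real k"
          using elim(2) ln_le_minus_one[of "real k"] by (intro mult_left_mono) auto
        ultimately have "2 * ((w j)\<^sup>2 * ln (real k)) \<le> u0\<^sup>2 * (s\<^sup>2 * \<rho> ^ k)"
          using \<rho> by (simp add: \<epsilon>_def field_simps)
        then have "(\<theta> k * w j)\<^sup>2 \<le> u0\<^sup>2"
          using elim(2) s \<rho> by (simp add: \<theta>_def power_mult_distrib field_simps)
        then show "\<bar>\<theta> k * w j\<bar> \<le> u0" using u0 by (metis abs_le_square_iff abs_of_pos)
      qed
    qed
  qed
  have lnln: "eventually (\<lambda>k. \<rho>\<^sup>2 * ln (real k) \<le> (1 + \<delta>)\<^sup>2 * (ln (real k) + ln (ln \<rho>))) sequentially"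
  proof -
    have "\<rho>\<^sup>2 < (1 + \<delta>)\<^sup>2" using \<delta> by (intro power_strict_mono) (auto simp: \<rho>_def)
    then have d: "(1 + \<delta>)\<^sup>2 - \<rho>\<^sup>2 > 0" by simp
    have "eventually (\<lambda>k. ln (real k) \<ge> - (1 + \<delta>)\<^sup>2 * ln (ln \<rho>) / ((1 + \<delta>)\<^sup>2 - \<rho>\<^sup>2)) sequentially"
      using filterlim_compose[OF ln_at_top filterlim_real_sequentially] unfolding filterlim_at_top by blast
    then show ?thesis
    proof eventually_elim
      case (elim k)
      then have "- (1 + \<delta>)\<^sup>2 * ln (ln \<rho>) \<le> ln (real k) * ((1 + \<delta>)\<^sup>2 - \<rho>\<^sup>2)"
        using d unfolding pos_divide_le_eq[OF d] by simp
      then show ?case by (simp add: algebra_simps)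
    qed
  qed
  from BC show ?thesis
  proof eventually_elim
    case (elim \<omega>)
    from eventually_conj[OF elim eventually_conj[OF small lnln]]
    obtain K where K: "\<And>k. k \<ge> K \<Longrightarrow> \<omega> \<in> space M - E k"
      "\<And>k j. k \<ge> K \<Longrightarrow> V (Suc j) < \<rho> ^ Suc k \<Longrightarrow> \<bar>\<theta> k * w j\<bar> \<le> u0"
      "\<And>k. k \<ge> K \<Longrightarrow> \<rho>\<^sup>2 * ln (real k) \<le> (1 + \<delta>)\<^sup>2 * (ln (real k) + ln (ln \<rho>))"
      unfolding eventually_sequentially by blast
    show ?case
      using V_eventually_ge[of "\<rho> ^ max K 2"]
    proof eventually_elim
      case (elim n)
      have "1 \<le> \<rho> ^ max K 2" using \<rho> by simp
      then have "V n \<ge> 1" using elim by linarith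
      then obtain k where k: "\<rho> ^ k \<le> V n" "V n < \<rho> ^ Suc k"
        using geometric_bracket[OF \<rho>] by blast
      have "\<rho> ^ max K 2 < \<rho> ^ Suc k" using elim k by linarith
      then have kK: "k \<ge> max K 2" using \<rho> by (simp add: power_strict_increasing_iff del: power_Suc)
      define S where "S = (\<Sum>j<n. w j * g j \<omega> * \<xi> j \<omega>)"
      have \<theta>: "\<theta> k > 0" using kK s \<rho> by (simp add: \<theta>_def)
      have \<theta>2: "(\<theta> k)\<^sup>2 = 2 * ln (real k) / (s\<^sup>2 * \<rho> ^ k)" using kK s \<rho> by (simp add: \<theta>_def)
      have Hk: "H k j \<omega> = \<theta> k * w j * g j \<omega>" "\<bar>\<theta> k * w j\<bar> \<le> u0" if "j < n" for j
      proof -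
        have "V (Suc j) < \<rho> ^ Suc k" using V_mono[of "Suc j" n] that k(2) by linarith
        then show "H k j \<omega> = \<theta> k * w j * g j \<omega>" "\<bar>\<theta> k * w j\<bar> \<le> u0" 
          using K(2)[of k j] kK by (auto simp: H_def)
      qed
      have "\<rho> * ln (real k) > loglik (H k) 0 n \<omega>"
        using K(1)[of k] kK by (auto simp: E_def not_le)
      also have "loglik (H k) 0 n \<omega> = \<theta> k * S - (\<Sum>j<n. cgf (q j \<omega>) (H k j \<omega>))"
        unfolding loglik_def S_def sum_subtractf sum_distrib_left using Hk
        by (auto simp: atLeast0LessThan intro!: sum.cong)
      finally have 1: "\<theta> k * S < \<rho> * ln (real k) + (\<Sum>j<n. cgf (q j \<omega>) (H k j \<omega>))" by simp
      have "(\<Sum>j<n. cgf (q j \<omega>) (H k j \<omega>)) \<le> (\<Sum>j<n. s\<^sup>2 * (\<theta> k)\<^sup>2 / 2 * (w j)\<^sup>2)"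
      proof (rule sum_mono)
        fix j assume j: "j \<in> {..<n}"
        show "cgf (q j \<omega>) (H k j \<omega>) \<le> s\<^sup>2 * (\<theta> k)\<^sup>2 / 2 * (w j)\<^sup>2"
        proof (cases "g j \<omega> = 1")
          case True
          then show ?thesis using cgf[of j \<omega> "\<theta> k * w j"] Hk[of j] j by (simp add: power_mult_distrib)
        next
          case False
          then have "g j \<omega> = 0" using g(2)[of j \<omega>] by simp
          then show ?thesis using Hk[of j] j by simp
        qed
      qed
      also have "\<dots> = s\<^sup>2 * (\<theta> k)\<^sup>2 / 2 * V n" by (simp add: V_eq sum_distrib_left)
      also have "\<dots> \<le> s\<^sup>2 * (\<theta> k)\<^sup>2 / 2 * \<rho> ^ Suc k" using k by (intro mult_left_mono) auto
      also have "\<dots> = \<rho> * ln (real k)" unfolding \<theta>2 using s \<rho> by (simp add: field_simps)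
      finally have 2: "\<theta> k * S < \<rho> * (2 * ln (real k))" using 1 by simp
      have "\<theta> k * (s * sqrt (2 * \<rho> ^ k * ln (real k))) = 2 * ln (real k)"
      proof -
        have "(\<theta> k * (s * sqrt (2 * \<rho> ^ k * ln (real k))))\<^sup>2 = (\<theta> k)\<^sup>2 * (s\<^sup>2 * (2 * \<rho> ^ k * ln (real k)))"
          using kK \<rho> by (simp add: power_mult_distrib)
        also have "\<dots> = (2 * ln (real k))\<^sup>2"
          unfolding \<theta>2 using s \<rho> by (simp add: power2_eq_square)
        finally show ?thesis
          by (rule power2_eq_imp_eq) (use \<theta> s kK \<rho> in auto)
      qed
      then have "\<theta> k * S < \<theta> k * (\<rho> * (s * sqrt (2 * \<rho> ^ k * ln (real k))))"
        using 2 by (simp add: mult.left_commute)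
      then have "S < \<rho> * (s * sqrt (2 * \<rho> ^ k * ln (real k)))" using \<theta> by simp
      also have "\<dots> = s * sqrt (2 * \<rho> ^ k * (\<rho>\<^sup>2 * ln (real k)))"
        using \<rho> by (simp add: real_sqrt_mult)
      also have "\<dots> \<le> s * sqrt (2 * V n * ((1 + \<delta>)\<^sup>2 * ln (ln (V n))))"
      proof -
        have "real k * ln \<rho> \<le> ln (V n)" using k(1) \<rho> \<open>V n \<ge> 1\<close> by (simp add: ln_realpow[symmetric])
        moreover have "real k * ln \<rho> > 0" using kK \<rho> by simp
        ultimately have "ln (real k * ln \<rho>) \<le> ln (ln (V n))" by simp
        moreover have "ln (real k * ln \<rho>) = ln (real k) + ln (ln \<rho>)"
          using kK \<rho> by (simp add: ln_mult_pos)
        ultimately have "(1 + \<delta>)\<^sup>2 * (ln (real k) + ln (ln \<rho>)) \<le> (1 + \<delta>)\<^sup>2 * ln (ln (V n))"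
          by (intro mult_left_mono) auto
        then have "\<rho>\<^sup>2 * ln (real k) \<le> (1 + \<delta>)\<^sup>2 * ln (ln (V n))" using K(3)[of k] kK by simp
        then have "2 * \<rho> ^ k * (\<rho>\<^sup>2 * ln (real k)) \<le> 2 * V n * ((1 + \<delta>)\<^sup>2 * ln (ln (V n)))"
          using k(1) kK V_nonneg[of n] by (intro mult_mono[of "2 * \<rho> ^ k"]) auto
        then show ?thesis using s by (intro mult_left_mono real_sqrt_le_mono) auto
      qed
      also have "\<dots> = (1 + \<delta>) * s * \<phi> n" using \<delta> by (simp add: \<phi>_def real_sqrt_mult)
      finally show ?case by (simp add: S_def)
    qed
  qed
qed

end

text \<open>Taylor's formula of order two. The second derivative of \<open>cgf q\<close> at t is the
  variance Q * (1 - Q) of the tilted draw, whose success probability Q differs from q by at most exp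
  \<bar>t\<bar> - 1; and x * (1 - x) is 1-Lipschitz on [0,1].\<close>

lemma cgf_quadratic:
  fixes p \<kappa> :: real
  assumes p: "0 < p" "p < 1" and \<kappa>: "\<kappa> > 0"
  obtains r u0 where "r > 0" "u0 > 0"
    "\<And>q u. q \<in> {0..1} \<Longrightarrow> \<bar>q - p\<bar> \<le> r \<Longrightarrow> \<bar>u\<bar> \<le> u0 \<Longrightarrow>
       \<bar>cgf q u - p * (1 - p) * u\<^sup>2 / 2\<bar> \<le> \<kappa> * (p * (1 - p)) * u\<^sup>2 / 2"
proof -
  \<comment> \<open>Half of the permitted deviation \<kappa> * p * (1 - p) is left to the distance
    from q to p, the other half to the effect of the tilt.\<close>
  define z where "z = \<kappa> * (p * (1 - p)) / 2"
  have z: "z > 0" using assms by (simp add: z_def)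
  show thesis
  proof (rule that[of z "ln (1 + z)"])
    show "z > 0" "ln (1 + z) > 0" using z by auto
    fix q u :: real
    assume q: "q \<in> {0..1}" "\<bar>q - p\<bar> \<le> z" and u: "\<bar>u\<bar> \<le> ln (1 + z)"
    define D where "D t = 1 - q + q * exp t" for t
    define Q where "Q t = q * exp t / D t" for t
    have D: "D t > 0" for t unfolding D_def by (rule mgf_pos[OF q(1)])
    have D1: "(cgf q has_real_derivative Q t - q) (at t)" for t
      unfolding cgf_def[abs_def] Q_def using D[of t]
      by (auto simp: D_def intro!: derivative_eq_intros)
    have D2: "((\<lambda>t. Q t - q) has_real_derivative Q t * (1 - Q t)) (at t)" for t
    proof -
      have "(D has_real_derivative q * exp t) (at t)"
        unfolding D_def by (auto intro!: derivative_eq_intros)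
      then have "((\<lambda>t. Q t - q) has_real_derivative
          (q * exp t * D t - q * exp t * (q * exp t)) / (D t * D t)) (at t)"
        unfolding Q_def using D[of t] by (auto intro!: derivative_eq_intros)
      also have "(q * exp t * D t - q * exp t * (q * exp t)) / (D t * D t) = Q t * (1 - Q t)"
        using D[of t] by (simp add: Q_def field_simps)
      finally show ?thesis .
    qed
    define diff where "diff m = (if m = 0 then cgf q else if m = 1 then (\<lambda>t. Q t - q) else (\<lambda>t. Q t * (1 - Q t)))"
      for m :: nat
    have "\<exists>t. \<bar>t\<bar> \<le> \<bar>u\<bar> \<and> cgf q u = (\<Sum>m<2. diff m 0 / fact m * u ^ m) + diff 2 t / fact 2 * u ^ 2"
    proof (rule Maclaurin_bi_le)
      show "diff 0 = cgf q" by (simp add: diff_def)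
      show "\<forall>m t. m < 2 \<and> \<bar>t\<bar> \<le> \<bar>u\<bar> \<longrightarrow> (diff m has_real_derivative diff (Suc m) t) (at t)"
        using D1 D2 by (auto simp: diff_def less_2_cases_iff)
    qed
    then obtain t where t: "\<bar>t\<bar> \<le> \<bar>u\<bar>" "cgf q u = Q t * (1 - Q t) / 2 * u\<^sup>2"
      by (auto simp: diff_def numeral_2_eq_2 Q_def D_def)
    have et: "exp \<bar>t\<bar> - 1 \<le> z"
    proof -
      have "exp \<bar>t\<bar> \<le> exp (ln (1 + z))" using t(1) u by (intro exp_le_cancel_iff[THEN iffD2]) linarith
      then show ?thesis using z by simp
    qed
    have Q01: "Q t \<in> {0..1}" using D[of t] q(1) by (auto simp: Q_def D_def divide_simps)
    have "\<bar>Q t - q\<bar> \<le> z"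
    proof -
      have "Q t - q = q * (1 - q) * ((exp t - 1) / D t)"
        using D[of t] by (simp add: Q_def D_def field_simps)
      then have "\<bar>Q t - q\<bar> = q * (1 - q) * \<bar>(exp t - 1) / D t\<bar>"
        using q(1) by (simp add: abs_mult)
      also have "\<dots> \<le> 1 * \<bar>(exp t - 1) / D t\<bar>"
        using q(1) mult_mono[of q 1 "1 - q" 1] by (intro mult_right_mono) auto
      also have "\<bar>(exp t - 1) / D t\<bar> \<le> exp \<bar>t\<bar> - 1"
      proof (cases "t \<ge> 0")
        case True
        then have "D t \<ge> 1" using q(1) mult_left_mono[of 1 "exp t" q] by (simp add: D_def)
        then show ?thesis using True by (simp add: divide_le_eq mult_le_cancel_left1)
      next
        case False
        have "D t \<ge> exp t"
          using False q(1) mult_left_mono[of "exp t" 1 "1 - q"] by (simp add: D_def algebra_simps)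
        then have "(1 - exp t) / D t \<le> (1 - exp t) / exp t"
          using False by (intro divide_left_mono) (auto intro: mult_pos_pos D)
        then show ?thesis using False D[of t] by (simp add: exp_minus field_simps)
      qed
      finally show ?thesis using et by simp
    qed
    then have Qp: "\<bar>Q t - p\<bar> \<le> \<kappa> * (p * (1 - p))" using q(2) unfolding z_def by linarith
    have "Q t * (1 - Q t) - p * (1 - p) = (Q t - p) * (1 - Q t - p)" by (simp add: algebra_simps)
    then have "\<bar>Q t * (1 - Q t) - p * (1 - p)\<bar> \<le> \<bar>Q t - p\<bar> * 1"
      unfolding abs_mult[symmetric] using Q01 p by (simp only: abs_mult) (intro mult_left_mono, auto)
    then have "\<bar>Q t * (1 - Q t) - p * (1 - p)\<bar> * (u\<^sup>2 / 2) \<le> \<kappa> * (p * (1 - p)) * (u\<^sup>2 / 2)"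
      using Qp by (intro mult_right_mono) auto
    also have "\<bar>Q t * (1 - Q t) - p * (1 - p)\<bar> * (u\<^sup>2 / 2) = \<bar>(Q t * (1 - Q t) - p * (1 - p)) * (u\<^sup>2 / 2)\<bar>"
      by (simp add: abs_mult)
    also have "(Q t * (1 - Q t) - p * (1 - p)) * (u\<^sup>2 / 2) = cgf q u - p * (1 - p) * u\<^sup>2 / 2"
      unfolding t(2) by (simp add: field_simps)
    finally show "\<bar>cgf q u - p * (1 - p) * u\<^sup>2 / 2\<bar> \<le> \<kappa> * (p * (1 - p)) * u\<^sup>2 / 2" by simp
  qed
qed

section \<open>Lower deviations over a block and their infinite recurrence\<close>

context bernoulli_draws
begin

text \<open>A conditional large deviation lower bound. The combination \<open>G\<close> of the exponential martingales
  with tilts \<open>\<mu>\<close> and \<open>(1 \<plusminus> \<eta>) * \<mu>\<close> is at most 1 and, unless \<open>g\<close> freezes a draw of the block, positive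
  only if the increment over the block is almost \<open>s\<^sup>2 * \<mu> * B\<close>; its conditional expectation is explicit.\<close>

lemma tilted_block:
  fixes w :: "nat \<Rightarrow> real" and \<mu> \<eta> s u0 B :: real
  assumes ab: "a \<le> b" and B: "B = (\<Sum>j=a..<b. (w j)\<^sup>2)"
    and g: "predictable g" "\<And>n \<omega>. g n \<omega> \<in> {0, 1}"
    and \<mu>: "\<mu> > 0" and \<eta>: "0 < \<eta>" "\<eta> \<le> 1/4" 
    and cgf: "\<And>n \<omega> u. g n \<omega> = 1 \<Longrightarrow> \<bar>u\<bar> \<le> u0 \<Longrightarrow> 
       \<bar>cgf (q n \<omega>) u - s\<^sup>2 * u\<^sup>2 / 2\<bar> \<le> \<eta>\<^sup>2 / 2 * s\<^sup>2 * u\<^sup>2 / 2"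
    and small: "\<And>j. a \<le> j \<Longrightarrow> j < b \<Longrightarrow> 2 * \<mu> * \<bar>w j\<bar> \<le> u0"
  obtains G where "G \<in> borel_measurable (F b)" "\<exists>C. \<forall>\<omega>. \<bar>G \<omega>\<bar> \<le> C" "\<And>\<omega>. G \<omega> \<le> 1"
    "\<And>\<omega>. G \<omega> > 0 \<Longrightarrow> \<forall>j\<in>{a..<b}. g j \<omega> = 1 \<Longrightarrow>
       (\<Sum>j=a..<b. w j * \<xi> j \<omega>) \<ge> (1 - \<eta>) * s\<^sup>2 * \<mu> * B - ln 4 / (\<eta> * \<mu>)"
    "\<And>f C. f \<in> borel_measurable (F a) \<Longrightarrow> (\<And>\<omega>. \<bar>f \<omega>\<bar> \<le> C) \<Longrightarrow>
       expectation (\<lambda>\<omega>. f \<omega> * G \<omega>)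
       = exp (- ((1 + 3 * \<eta>) / 2 * s\<^sup>2 * \<mu>\<^sup>2 * B + ln 4 / \<eta>)) / 2 * expectation f"
proof -
  define H where "H \<theta> j \<omega> = \<theta> * w j * g j \<omega>" for \<theta> j \<omega>
  define D where "D \<theta> \<omega> = exp (loglik (H \<theta>) a b \<omega>)" for \<theta> \<omega>
  define S where "S \<omega> = (\<Sum>j=a..<b. w j * g j \<omega> * \<xi> j \<omega>)" for \<omega>
  define \<Lambda> where "\<Lambda> \<theta> \<omega> = (\<Sum>j=a..<b. cgf (q j \<omega>) (H \<theta> j \<omega>))" for \<theta> \<omega>
  define B' where "B' \<omega> = (\<Sum>j=a..<b. (w j)\<^sup>2 * g j \<omega>)" for \<omega>
  \<comment> \<open>An upper bound for the logarithm of \<open>D \<mu>\<close> at every point where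
    \<open>D \<mu>\<close> exceeds a quarter of the exponential with the larger tilt; see the proof
    of \<open>G \<omega> \<le> 1\<close>.\<close>
  define c where "c = (1 + 3 * \<eta>) / 2 * s\<^sup>2 * \<mu>\<^sup>2 * B + ln 4 / \<eta>"
  \<comment> \<open>If \<open>S\<close> is far above its tilted mean, the exponential with tilt (1 +
    \<eta>) * \<mu> outweighs \<open>D \<mu>\<close>; if far below, the one with tilt (1 - \<eta>) *
    \<mu> does. Either makes the bracket nonpositive. The coefficients leave the expectation 1 - 1/4
    - 1/4 = 1/2, and exp (- c) normalises the maximum.\<close>
  define G where "G \<omega> = exp (- c) * (D \<mu> \<omega> - D ((1 + \<eta>) * \<mu>) \<omega> / 4 - D ((1 - \<eta>) * \<mu>) \<omega> / 4)" for \<omega>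
  have H: "predictable (H \<theta>)" for \<theta>
    unfolding predictable_def
  proof (intro allI conjI)
    fix j
    have [measurable]: "g j \<in> borel_measurable (F j)" using g predictableD by blast
    show "H \<theta> j \<in> borel_measurable (F j)" unfolding H_def by measurable
    have "\<bar>H \<theta> j \<omega>\<bar> \<le> \<bar>\<theta> * w j\<bar>" for \<omega> using g(2)[of j \<omega>] by (auto simp: H_def)
    then show "\<exists>B. \<forall>\<omega>. \<bar>H \<theta> j \<omega>\<bar> \<le> B" by blast
  qed
  have Dlog: "D \<theta> \<omega> = exp (\<theta> * S \<omega> - \<Lambda> \<theta> \<omega>)" for \<theta> \<omega>
    by (simp add: D_def loglik_def S_def \<Lambda>_def H_def sum_subtractf sum_distrib_left mult.assoc)
  have Dpos: "D \<theta> \<omega> > 0" for \<theta> \<omega> by (simp add: D_def)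
  have DM [measurable]: "D \<theta> \<in> borel_measurable (F b)" for \<theta>
    using loglik_meas[OF H order_refl, of \<theta> a b] unfolding D_def by measurable
  have "\<exists>C. \<forall>\<omega>. \<bar>D \<theta> \<omega>\<bar> \<le> C" for \<theta>
    using loglik_bound[OF H[of \<theta>], of a b] unfolding D_def by (metis abs_exp_cancel exp_le_cancel_iff)
  then obtain DC where DC: "\<And>\<theta> \<omega>. \<bar>D \<theta> \<omega>\<bar> \<le> DC \<theta>" by metis
  have B'B: "0 \<le> B' \<omega>" "B' \<omega> \<le> B" for \<omega>
  proof -
    have "0 \<le> g j \<omega>" "g j \<omega> \<le> 1" for j using g(2)[of j \<omega>] by auto
    then show "0 \<le> B' \<omega>" "B' \<omega> \<le> B"
      unfolding B'_def B by (auto intro!: sum_nonneg sum_mono mult_left_le)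
  qed
  have \<Lambda>: "\<bar>\<Lambda> \<theta> \<omega> - \<theta>\<^sup>2 * (s\<^sup>2 * B' \<omega> / 2)\<bar> \<le> \<eta>\<^sup>2 / 2 * (\<theta>\<^sup>2 * (s\<^sup>2 * B' \<omega> / 2))"
    if "0 \<le> \<theta>" "\<theta> \<le> 2 * \<mu>" for \<theta> \<omega>
  proof -
    have *: "\<bar>cgf (q j \<omega>) (H \<theta> j \<omega>) - \<theta>\<^sup>2 * s\<^sup>2 / 2 * ((w j)\<^sup>2 * g j \<omega>)\<bar>
        \<le> \<eta>\<^sup>2 / 2 * (\<theta>\<^sup>2 * s\<^sup>2 / 2) * ((w j)\<^sup>2 * g j \<omega>)" if j: "j \<in> {a..<b}" for j
    proof (cases "g j \<omega> = 1")
      case True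
      have "\<bar>\<theta> * w j\<bar> \<le> 2 * \<mu> * \<bar>w j\<bar>"
        using \<open>0 \<le> \<theta>\<close> \<open>\<theta> \<le> 2 * \<mu>\<close> by (simp add: abs_mult mult_right_mono)
      also have "\<dots> \<le> u0" using small[of j] j by auto
      finally show ?thesis using cgf[OF True, of "\<theta> * w j"] True by (simp add: H_def power_mult_distrib field_simps)
    next
      case False
      then have "g j \<omega> = 0" using g(2)[of j \<omega>] by simp
      then show ?thesis by (simp add: H_def)
    qed
    have "\<bar>\<Lambda> \<theta> \<omega> - \<theta>\<^sup>2 * s\<^sup>2 / 2 * B' \<omega>\<bar> \<le> \<eta>\<^sup>2 / 2 * (\<theta>\<^sup>2 * s\<^sup>2 / 2) * B' \<omega>"
      unfolding \<Lambda>_def B'_def sum_distrib_left sum_subtractf[symmetric]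
      by (rule order_trans[OF sum_abs sum_mono]) (rule *)
    then show ?thesis by (simp add: field_simps)
  qed
  have \<Lambda>3: "\<bar>\<Lambda> \<mu> \<omega> - X\<bar> \<le> \<eta>\<^sup>2 / 2 * X"
    "\<bar>\<Lambda> ((1 + \<eta>) * \<mu>) \<omega> - (1 + \<eta>)\<^sup>2 * X\<bar> \<le> \<eta>\<^sup>2 / 2 * ((1 + \<eta>)\<^sup>2 * X)"
    "\<bar>\<Lambda> ((1 - \<eta>) * \<mu>) \<omega> - (1 - \<eta>)\<^sup>2 * X\<bar> \<le> \<eta>\<^sup>2 / 2 * ((1 - \<eta>)\<^sup>2 * X)"
    if "X = \<mu>\<^sup>2 * (s\<^sup>2 * B' \<omega> / 2)" for \<omega> X
  proof -
    have X: "(x * \<mu>)\<^sup>2 * (s\<^sup>2 * B' \<omega> / 2) = x\<^sup>2 * X" for x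
      by (simp add: that power_mult_distrib)
    have "0 \<le> (1 + \<eta>) * \<mu>" "(1 + \<eta>) * \<mu> \<le> 2 * \<mu>" "0 \<le> (1 - \<eta>) * \<mu>" "(1 - \<eta>) * \<mu> \<le> 2 * \<mu>"
      using \<mu> \<eta> by (auto intro!: mult_right_mono)
    then show "\<bar>\<Lambda> ((1 + \<eta>) * \<mu>) \<omega> - (1 + \<eta>)\<^sup>2 * X\<bar> \<le> \<eta>\<^sup>2 / 2 * ((1 + \<eta>)\<^sup>2 * X)"
      "\<bar>\<Lambda> ((1 - \<eta>) * \<mu>) \<omega> - (1 - \<eta>)\<^sup>2 * X\<bar> \<le> \<eta>\<^sup>2 / 2 * ((1 - \<eta>)\<^sup>2 * X)"
      using \<Lambda>[of "(1 + \<eta>) * \<mu>" \<omega>] \<Lambda>[of "(1 - \<eta>) * \<mu>" \<omega>] unfolding X by blast+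
    show "\<bar>\<Lambda> \<mu> \<omega> - X\<bar> \<le> \<eta>\<^sup>2 / 2 * X" using \<Lambda>[of \<mu> \<omega>] \<mu> unfolding that by simp
  qed
  have dev: "(1 - k) * Y \<le> L" "L \<le> (1 + k) * Y" if "\<bar>L - Y\<bar> \<le> k * Y" for L Y k :: real
    using that by (auto simp: algebra_simps abs_le_iff)
  have Xnn: "\<mu>\<^sup>2 * (s\<^sup>2 * B' \<omega> / 2) \<ge> 0" for \<omega> using B'B(1)[of \<omega>] by simp
  show thesis
  proof (rule that[of G])
    show "G \<in> borel_measurable (F b)" unfolding G_def by measurable
    show "\<exists>C. \<forall>\<omega>. \<bar>G \<omega>\<bar> \<le> C"
    proof (intro exI allI)
      fix \<omega>
      show "\<bar>G \<omega>\<bar> \<le> exp (- c) * (DC \<mu> + DC ((1 + \<eta>) * \<mu>) / 4 + DC ((1 - \<eta>) * \<mu>) / 4)"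
        unfolding G_def abs_mult abs_exp_cancel
        using DC[of \<mu> \<omega>] DC[of "(1 + \<eta>) * \<mu>" \<omega>] DC[of "(1 - \<eta>) * \<mu>" \<omega>]
        by (intro mult_left_mono) auto
    qed
    show "G \<omega> \<le> 1" for \<omega>
    proof -
      define X where "X = \<mu>\<^sup>2 * (s\<^sup>2 * B' \<omega> / 2)"
      \<comment> \<open>Unless the larger tilt cancels \<open>D \<mu>\<close>, the ratio of the two
        exponentials bounds \<open>S\<close> from above, and with it \<open>D \<mu>\<close>.\<close>
      have "D \<mu> \<omega> - D ((1 + \<eta>) * \<mu>) \<omega> / 4 \<le> exp c"
      proof (cases "D \<mu> \<omega> \<le> D ((1 + \<eta>) * \<mu>) \<omega> / 4")
        case True
        then show ?thesis using exp_gt_zero[of c] by linarith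
      next
        case False
        then have "exp ((1 + \<eta>) * \<mu> * S \<omega> - \<Lambda> ((1 + \<eta>) * \<mu>) \<omega> - ln 4) < exp (\<mu> * S \<omega> - \<Lambda> \<mu> \<omega>)"
          by (simp add: Dlog exp_diff)
        then have "\<eta> * (\<mu> * S \<omega>) < \<Lambda> ((1 + \<eta>) * \<mu>) \<omega> - \<Lambda> \<mu> \<omega> + ln 4"
          by (simp add: algebra_simps)
        then have "\<eta> * (\<mu> * S \<omega> - \<Lambda> \<mu> \<omega>) \<le> \<Lambda> ((1 + \<eta>) * \<mu>) \<omega> - (1 + \<eta>) * \<Lambda> \<mu> \<omega> + ln 4"
          by (simp add: algebra_simps)
        also have "\<dots> \<le> (1 + \<eta>\<^sup>2 / 2) * (1 + \<eta>)\<^sup>2 * X - (1 + \<eta>) * ((1 - \<eta>\<^sup>2 / 2) * X) + ln 4"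
        proof -
          have "(1 + \<eta>) * ((1 - \<eta>\<^sup>2 / 2) * X) \<le> (1 + \<eta>) * \<Lambda> \<mu> \<omega>"
            using dev(1)[OF \<Lambda>3(1)[OF X_def]] \<eta> by (intro mult_left_mono) auto
          moreover have "\<Lambda> ((1 + \<eta>) * \<mu>) \<omega> \<le> (1 + \<eta>\<^sup>2 / 2) * (1 + \<eta>)\<^sup>2 * X"
            using dev(2)[OF \<Lambda>3(2)[OF X_def]] by (simp only: mult.assoc)
          ultimately show ?thesis by linarith
        qed
        \<comment> \<open>The inequality is about to be divided by \<eta>. A relative error of order
          \<eta>^2 in the compensators then remains of order \<eta>, whence the precision demanded
          of \<open>cgf\<close>.\<close>
        also have "\<dots> \<le> \<eta> * ((1 + 3 * \<eta>) * X) + ln 4"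
        proof -
          have "(1 + \<eta>\<^sup>2 / 2) * (1 + \<eta>)\<^sup>2 - (1 + \<eta>) * (1 - \<eta>\<^sup>2 / 2) 
             = \<eta> * (1 + 3 * \<eta>) - \<eta>\<^sup>2 * (1 - 3 / 2 * \<eta> - \<eta>\<^sup>2 / 2)"
            by (simp add: power2_eq_square field_simps)
          also have "\<dots> \<le> \<eta> * (1 + 3 * \<eta>)"
          proof -
            have "\<eta>\<^sup>2 \<le> 1" using \<eta> by (simp add: power_le_one)
            then show ?thesis using \<eta> by (simp add: mult_nonneg_nonneg)
          qed
          finally have "((1 + \<eta>\<^sup>2 / 2) * (1 + \<eta>)\<^sup>2 - (1 + \<eta>) * (1 - \<eta>\<^sup>2 / 2)) * X \<le> \<eta> * (1 + 3 * \<eta>) * X"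
            using Xnn[of \<omega>] by (intro mult_right_mono) (auto simp: X_def)
          then show ?thesis by (simp add: algebra_simps)
        qed
        finally have "\<mu> * S \<omega> - \<Lambda> \<mu> \<omega> \<le> (1 + 3 * \<eta>) * X + ln 4 / \<eta>"
          using \<eta> by (simp add: field_simps)
        also have "\<dots> \<le> c"
        proof -
          have "X \<le> \<mu>\<^sup>2 * (s\<^sup>2 * B / 2)"
            unfolding X_def using B'B(2)[of \<omega>] by (intro mult_left_mono divide_right_mono) auto
          then have "(1 + 3 * \<eta>) * X \<le> (1 + 3 * \<eta>) * (\<mu>\<^sup>2 * (s\<^sup>2 * B / 2))"
            using \<eta> by (intro mult_left_mono) auto
          then show ?thesis by (simp add: c_def algebra_simps)
        qed
        finally have "D \<mu> \<omega> \<le> exp c" by (simp add: Dlog)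
        then show ?thesis using Dpos[of "(1 + \<eta>) * \<mu>" \<omega>] by linarith
      qed
      then have "D \<mu> \<omega> - D ((1 + \<eta>) * \<mu>) \<omega> / 4 - D ((1 - \<eta>) * \<mu>) \<omega> / 4 \<le> exp c"
        using Dpos[of "(1 - \<eta>) * \<mu>" \<omega>] by linarith
      then have "G \<omega> \<le> exp (- c) * exp c" unfolding G_def by (intro mult_left_mono) auto
      then show ?thesis by (simp add: exp_minus)
    qed
    show "(\<Sum>j=a..<b. w j * \<xi> j \<omega>) \<ge> (1 - \<eta>) * s\<^sup>2 * \<mu> * B - ln 4 / (\<eta> * \<mu>)"
      if G: "G \<omega> > 0" and g1: "\<forall>j\<in>{a..<b}. g j \<omega> = 1" for \<omega>
    proof -
      define X where "X = \<mu>\<^sup>2 * (s\<^sup>2 * B / 2)"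
      have BB: "B' \<omega> = B" "S \<omega> = (\<Sum>j=a..<b. w j * \<xi> j \<omega>)" using g1 by (auto simp: B'_def B S_def)
      then have X: "X = \<mu>\<^sup>2 * (s\<^sup>2 * B' \<omega> / 2)" by (simp add: X_def)
      have "D \<mu> \<omega> - D ((1 + \<eta>) * \<mu>) \<omega> / 4 - D ((1 - \<eta>) * \<mu>) \<omega> / 4 > 0"
        using G by (simp add: G_def zero_less_mult_iff)
      then have "D ((1 - \<eta>) * \<mu>) \<omega> / 4 < D \<mu> \<omega>"
        using Dpos[of "(1 + \<eta>) * \<mu>" \<omega>] by linarith
      then have "exp ((1 - \<eta>) * \<mu> * S \<omega> - \<Lambda> ((1 - \<eta>) * \<mu>) \<omega> - ln 4) < exp (\<mu> * S \<omega> - \<Lambda> \<mu> \<omega>)"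
        by (simp add: Dlog exp_diff)
      then have "\<Lambda> \<mu> \<omega> - \<Lambda> ((1 - \<eta>) * \<mu>) \<omega> - ln 4 \<le> \<eta> * \<mu> * S \<omega>"
        by (simp add: algebra_simps)
      moreover have "(1 - \<eta>\<^sup>2 / 2) * X - (1 + \<eta>\<^sup>2 / 2) * ((1 - \<eta>)\<^sup>2 * X) \<le> \<Lambda> \<mu> \<omega> - \<Lambda> ((1 - \<eta>) * \<mu>) \<omega>"
        using dev(1)[OF \<Lambda>3(1)[OF X]] dev(2)[OF \<Lambda>3(3)[OF X]] by linarith
      moreover have "2 * \<eta> * (1 - \<eta>) * X \<le> (1 - \<eta>\<^sup>2 / 2) * X - (1 + \<eta>\<^sup>2 / 2) * ((1 - \<eta>)\<^sup>2 * X)"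
      proof -
        have "(1 - \<eta>\<^sup>2 / 2) - (1 + \<eta>\<^sup>2 / 2) * (1 - \<eta>)\<^sup>2 = 2 * \<eta> * (1 - \<eta>) + \<eta>\<^sup>2 * (\<eta> * (1 - \<eta> / 2))"
          by (simp add: power2_eq_square algebra_simps)
        moreover have "\<eta>\<^sup>2 * (\<eta> * (1 - \<eta> / 2)) \<ge> 0" using \<eta> by (intro mult_nonneg_nonneg) auto
        ultimately have "2 * \<eta> * (1 - \<eta>) \<le> (1 - \<eta>\<^sup>2 / 2) - (1 + \<eta>\<^sup>2 / 2) * (1 - \<eta>)\<^sup>2" by linarith
        then have "2 * \<eta> * (1 - \<eta>) * X \<le> ((1 - \<eta>\<^sup>2 / 2) - (1 + \<eta>\<^sup>2 / 2) * (1 - \<eta>)\<^sup>2) * X"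
          using Xnn[of \<omega>] X by (intro mult_right_mono) auto
        then show ?thesis by (simp add: algebra_simps)
      qed
      ultimately have "2 * \<eta> * (1 - \<eta>) * X - ln 4 \<le> \<eta> * \<mu> * S \<omega>" by linarith
      moreover have "2 * \<eta> * (1 - \<eta>) * X = \<eta> * \<mu> * ((1 - \<eta>) * s\<^sup>2 * \<mu> * B)"
        by (simp add: X_def power2_eq_square)
      ultimately have "((1 - \<eta>) * s\<^sup>2 * \<mu> * B - ln 4 / (\<eta> * \<mu>)) * (\<eta> * \<mu>) \<le> S \<omega> * (\<eta> * \<mu>)"
      proof -
        have "(Z - ln 4 / (\<eta> * \<mu>)) * (\<eta> * \<mu>) = \<eta> * \<mu> * Z - ln 4" for Z
          using \<eta> \<mu> by (simp add: left_diff_distrib)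
        moreover assume "2 * \<eta> * (1 - \<eta>) * X - ln 4 \<le> \<eta> * \<mu> * S \<omega>"
          "2 * \<eta> * (1 - \<eta>) * X = \<eta> * \<mu> * ((1 - \<eta>) * s\<^sup>2 * \<mu> * B)"
        ultimately show ?thesis by (simp only: mult.commute[of "S \<omega>"])
      qed
      then have "(1 - \<eta>) * s\<^sup>2 * \<mu> * B - ln 4 / (\<eta> * \<mu>) \<le> S \<omega>"
        by (rule mult_right_le_imp_le) (use \<eta> \<mu> in simp)
      then show ?thesis using BB by simp
    qed
    fix f :: "'a \<Rightarrow> real" and C assume f: "f \<in> borel_measurable (F a)" "\<And>\<omega>. \<bar>f \<omega>\<bar> \<le> C"
    have E: "expectation (\<lambda>\<omega>. f \<omega> * D \<theta> \<omega>) = expectation f" for \<theta>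
      unfolding D_def using expectation_loglik[OF f H ab] .
    have I: "integrable M (\<lambda>\<omega>. f \<omega> * D \<theta> \<omega>)" for \<theta>
    proof (intro integrable_const_bound[where B = "C * DC \<theta>"] AE_I2)
      show "(\<lambda>\<omega>. f \<omega> * D \<theta> \<omega>) \<in> borel_measurable M"
        by (rule borel_measurable_times[OF measurable_F_M[OF f(1)] measurable_F_M[OF DM]])
      show "norm (f \<omega> * D \<theta> \<omega>) \<le> C * DC \<theta>" for \<omega>
        unfolding real_norm_def abs_mult using f(2)[of \<omega>] DC[of \<theta> \<omega>] by (intro mult_mono) auto
    qed
    have "f \<omega> * G \<omega> = exp (- c) * (f \<omega> * D \<mu> \<omega> - f \<omega> * D ((1 + \<eta>) * \<mu>) \<omega> / 4
        - f \<omega> * D ((1 - \<eta>) * \<mu>) \<omega> / 4)" for \<omega>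
      unfolding G_def by (simp only: right_diff_distrib times_divide_eq_right mult.left_commute)
    then have "expectation (\<lambda>\<omega>. f \<omega> * G \<omega>) = exp (- c) * (expectation (\<lambda>\<omega>. f \<omega> * D \<mu> \<omega>)
        - expectation (\<lambda>\<omega>. f \<omega> * D ((1 + \<eta>) * \<mu>) \<omega>) / 4 - expectation (\<lambda>\<omega>. f \<omega> * D ((1 - \<eta>) * \<mu>) \<omega>) / 4)"
      using I by (simp only: integral_mult_right_zero integral_divide_zero
          Bochner_Integration.integral_diff Bochner_Integration.integrable_diff integrable_divide)
    also have "\<dots> = exp (- c) / 2 * expectation f" unfolding E by simp
    finally have "expectation (\<lambda>\<omega>. f \<omega> * G \<omega>) = exp (- c) / 2 * expectation f" .
    then show "expectation (\<lambda>\<omega>. f \<omega> * G \<omega>)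
       = exp (- ((1 + 3 * \<eta>) / 2 * s\<^sup>2 * \<mu>\<^sup>2 * B + ln 4 / \<eta>)) / 2 * expectation f"
      by (simp add: c_def)
  qed
qed

text \<open>A substitute for the conditional Borel-Cantelli lemma: on the event that no \<open>G i\<close> with
  \<open>K \<le> i < k\<close> is positive, the product of the factors \<open>1 - G i\<close> is at least 1, while its
  expectation is the product of the factors \<open>1 - P i\<close>.\<close>

lemma infinitely_often_pos:
  fixes N :: "nat \<Rightarrow> nat" and G :: "nat \<Rightarrow> 'a \<Rightarrow> real" and P :: "nat \<Rightarrow> real"
  assumes N: "mono N"
    and G: "\<And>k. G k \<in> borel_measurable (F (N (Suc k)))" "\<And>k. \<exists>C. \<forall>\<omega>. \<bar>G k \<omega>\<bar> \<le> C" "\<And>k \<omega>. G k \<omega> \<le> 1"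
    and E: "\<And>k f C. f \<in> borel_measurable (F (N k)) \<Longrightarrow> (\<And>\<omega>. \<bar>f \<omega>\<bar> \<le> C) \<Longrightarrow>
       expectation (\<lambda>\<omega>. f \<omega> * G k \<omega>) = P k * expectation f"
    and P: "\<And>k. P k \<ge> 0" "\<not> summable P"
  shows "AE \<omega> in M. frequently (\<lambda>k. G k \<omega> > 0) sequentially"
proof -
  have GM [measurable]: "G k \<in> borel_measurable M" for k using G(1) measurable_F_M by blast
  define A where "A K = {\<omega> \<in> space M. \<forall>k\<ge>K. G k \<omega> \<le> 0}" for K
  have AM: "A K \<in> events" for K unfolding A_def by measurable
  define Q where "Q K k \<omega> = (\<Prod>i=K..<k. 1 - G i \<omega>)" for K k \<omega>
  have Qm: "Q K k \<in> borel_measurable (F (N k))" if "K \<le> k" for K k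
    unfolding Q_def
  proof (intro borel_measurable_prod borel_measurable_diff borel_measurable_const)
    fix i assume "i \<in> {K..<k}"
    then show "G i \<in> borel_measurable (F (N k))"
      using measurable_F_mono[OF G(1)[of i]] monoD[OF N, of "Suc i" k] by auto
  qed
  have Q0: "Q K k \<omega> \<ge> 0" for K k \<omega> unfolding Q_def using G(3) by (intro prod_nonneg) simp
  have Qb: "\<exists>C. \<forall>\<omega>. \<bar>Q K k \<omega>\<bar> \<le> C" for K k
  proof -
    obtain C where C: "\<And>k \<omega>. \<bar>G k \<omega>\<bar> \<le> C k" using G(2) by metis
    have "\<bar>Q K k \<omega>\<bar> \<le> (\<Prod>i=K..<k. 1 + C i)" for \<omega>
      unfolding Q_def abs_prod using C
      by (intro prod_mono) (auto intro: order_trans[OF abs_triangle_ineq4])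
    then show ?thesis by blast
  qed
  have Qi: "integrable M (Q K k)" if "K \<le> k" for K k
  proof -
    obtain C where "\<And>\<omega>. \<bar>Q K k \<omega>\<bar> \<le> C" using Qb by blast
    then show ?thesis using measurable_F_M[OF Qm[OF that]]
      by (intro integrable_const_bound[where B = C]) auto
  qed
  have EQ: "expectation (Q K k) = (\<Prod>i=K..<k. 1 - P i)" if "K \<le> k" for K k
    using that
  proof (induction k rule: dec_induct)
    case base
    then show ?case by (simp add: Q_def prob_space)
  next
    case (step k)
    obtain C where C: "\<And>\<omega>. \<bar>Q K k \<omega>\<bar> \<le> C" using Qb by blast
    have eq: "Q K (Suc k) \<omega> = Q K k \<omega> - Q K k \<omega> * G k \<omega>" for \<omega>
      using step(1) by (simp add: Q_def algebra_simps)
    have "integrable M (\<lambda>\<omega>. Q K k \<omega> - Q K (Suc k) \<omega>)"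
      using step by (intro Bochner_Integration.integrable_diff Qi) auto
    then have "integrable M (\<lambda>\<omega>. Q K k \<omega> * G k \<omega>)" by (simp add: eq)
    then have "expectation (Q K (Suc k)) = expectation (Q K k) - expectation (\<lambda>\<omega>. Q K k \<omega> * G k \<omega>)"
      unfolding eq[abs_def] using Qi[OF step(1)] by simp
    also have "\<dots> = expectation (Q K k) * (1 - P k)"
      using E[OF Qm[OF step(1)] C] by (simp add: algebra_simps)
    finally show ?case using step by simp
  qed
  have "prob (A K) = 0" for K
  proof -
    have le: "prob (A K) \<le> exp (- (\<Sum>i=K..<k. P i))" if "K \<le> k" for k
    proof -
      have "prob (A K) = expectation (indicator (A K))" using AM by simp
      also have "\<dots> \<le> expectation (Q K k)"
      proof (rule integral_mono)
        show "integrable M (indicator (A K) :: 'a \<Rightarrow> real)"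
          using AM by (intro integrable_real_indicator) (auto simp: emeasure_eq_measure)
        show "indicator (A K) \<omega> \<le> Q K k \<omega>" for \<omega>
        proof (cases "\<omega> \<in> A K")
          case True
          then have "1 \<le> Q K k \<omega>" unfolding Q_def by (intro prod_ge_1) (auto simp: A_def)
          then show ?thesis using True by simp
        qed (use Q0 in simp)
      qed (fact Qi[OF that])
      also have "\<dots> = (\<Prod>i=K..<k. 1 - P i)" by (rule EQ[OF that])
      also have "\<dots> \<le> (\<Prod>i=K..<k. exp (- P i))"
      proof (intro prod_mono conjI)
        fix i assume i: "i \<in> {K..<k}"
        show "1 - P i \<le> exp (- P i)" using exp_ge_add_one_self[of "- P i"] by simp
        \<comment> \<open>The bound P i \<le> 1 is derived: 1 - P i is the expectation of a single
          factor 1 - G i, and G i \<le> 1.\<close>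
        have "expectation (Q i (Suc i)) = 1 - P i" using EQ[of i "Suc i"] by simp
        moreover have "expectation (Q i (Suc i)) \<ge> 0" using Q0 by (intro integral_nonneg_AE) auto
        ultimately show "0 \<le> 1 - P i" by simp
      qed
      also have "\<dots> = exp (- (\<Sum>i=K..<k. P i))" by (simp add: exp_sum sum_negf[symmetric])
      finally show ?thesis .
    qed
    have "prob (A K) \<le> \<epsilon>" if "\<epsilon> > 0" for \<epsilon> :: real
    proof -
      have "\<exists>k\<ge>K. (\<Sum>i=K..<k. P i) \<ge> - ln \<epsilon>"
      proof (rule ccontr)
        assume "\<not> ?thesis"
        then have *: "(\<Sum>i=K..<k. P i) < - ln \<epsilon>" if "k \<ge> K" for k using that by (meson not_le)
        have "(\<Sum>i<n. P i) \<le> (\<Sum>i<K. P i) + (- ln \<epsilon>)" for n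
        proof -
          have "(\<Sum>i<n. P i) \<le> (\<Sum>i<n+K. P i)" by (intro sum_mono2) (auto simp: P)
          also have "(\<Sum>i<n+K. P i) = (\<Sum>i<K. P i) + (\<Sum>i=K..<n+K. P i)"
            using sum.atLeastLessThan_concat[of 0 K "n+K" P] by (simp add: atLeast0LessThan)
          also have "(\<Sum>i=K..<n+K. P i) \<le> - ln \<epsilon>" using *[of "n+K"] by simp
          finally show ?thesis by simp
        qed
        then have "summable P" using P(1) by (intro summableI_nonneg_bounded)
        then show False using P(2) by simp
      qed
      then obtain k where k: "k \<ge> K" "- (\<Sum>i=K..<k. P i) \<le> ln \<epsilon>" by force
      then have "exp (- (\<Sum>i=K..<k. P i)) \<le> exp (ln \<epsilon>)" by simp
      then show ?thesis using le[OF k(1)] that by simp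
    qed
    then have "prob (A K) \<le> 0" by (rule field_le_epsilon[where y = 0, simplified])
    then show ?thesis by (simp add: measure_le_0_iff)
  qed
  then have "A K \<in> null_sets M" for K
    using AM by (intro null_setsI) (simp_all add: emeasure_eq_measure)
  then have "AE \<omega> in M. \<omega> \<notin> A K" for K by (rule AE_not_in)
  then have "AE \<omega> in M. \<forall>K. \<omega> \<notin> A K" by (simp add: AE_all_countable)
  then show ?thesis
    using AE_space
  proof eventually_elim
    case (elim \<omega>)
    then show ?case by (auto simp: A_def frequently_sequentially not_le)
  qed
qed

end

section \<open>Upper bounds for the martingale: variance 1/4, then p (1 - p)\<close>

context lil_weights
begin

lemma \<phi>_at_top: "filterlim \<phi> at_top sequentially"
proof -
  have "filterlim (\<lambda>v::real. sqrt (2 * v * ln (ln v))) at_top at_top" by real_asymp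
  from filterlim_compose[OF this V_unbounded] show ?thesis by (simp add: \<phi>_def[abs_def])
qed

lemma \<phi>_eventually_ge: "eventually (\<lambda>n. \<phi> n \<ge> x) sequentially"
  using \<phi>_at_top unfolding filterlim_at_top by blast

text \<open>A change of sign of the weights leaves \<open>V\<close> and \<open>\<phi>\<close> as
  they are and reverses the martingale; every one-sided bound so becomes two-sided.\<close>

lemma lil_weights_uminus: "lil_weights (\<lambda>n. - w n) V"
  using V_eq V_unbounded w_negligible by unfold_locales auto

end

context weighted_bernoulli_sums
begin

definition mart :: "nat \<Rightarrow> 'a \<Rightarrow> real" where
  "mart n \<omega> = (\<Sum>j<n. w j * \<xi> j \<omega>)"

lemma weighted_bernoulli_sums_uminus: "weighted_bernoulli_sums M F e q (\<lambda>n. - w n) V"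
  by (intro weighted_bernoulli_sums.intro bernoulli_draws_axioms lil_weights_uminus)

lemma mart_uminus: "weighted_bernoulli_sums.mart e q (\<lambda>n. - w n) n \<omega> = - mart n \<omega>"
proof -
  interpret neg: weighted_bernoulli_sums M F e q "\<lambda>n. - w n" V
    by (rule weighted_bernoulli_sums_uminus)
  show ?thesis by (simp add: neg.mart_def mart_def sum_negf)
qed

text \<open>For s = 1/2 the hypothesis on \<open>cgf\<close> is Hoeffding's bound, valid for every
  q, and \<delta> = 1 turns the constant (1 + \<delta>) * s into 1. No limit of \<open>q\<close>
  enters, so the bound may be used to establish that limit.\<close>

lemma mart_le_crude: "AE \<omega> in M. eventually (\<lambda>n. mart n \<omega> \<le> \<phi> n) sequentially"
proof -
  have "predictable (\<lambda>_ _. 1)" unfolding predictable_def by auto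
  from upper_LIL_predictable[OF this, of "1/2" 1 1] show ?thesis
    using cgf_le_Hoeffding[OF q_range] by (simp add: mart_def power2_eq_square)
qed

lemma mart_bound_crude: "AE \<omega> in M. eventually (\<lambda>n. \<bar>mart n \<omega>\<bar> \<le> \<phi> n) sequentially"
  using mart_le_crude weighted_bernoulli_sums.mart_le_crude[OF weighted_bernoulli_sums_uminus]
  unfolding mart_uminus
proof eventually_elim
  case (elim \<omega>)
  from elim show ?case by eventually_elim auto
qed

end

locale convergent_bernoulli_sums = weighted_bernoulli_sums M F e q w V
  for M :: "'a measure" and F :: "nat \<Rightarrow> 'a measure" and e q w V +
  fixes p :: real
  assumes p: "0 < p" "p < 1"
    and q_lim: "AE \<omega> in M. (\<lambda>n. q n \<omega>) \<longlonglongrightarrow> p"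
begin

definition s :: real where "s = sqrt (p * (1 - p))"

lemma s: "s > 0" "s \<le> 1" "s\<^sup>2 = p * (1 - p)"
proof -
  show "s\<^sup>2 = p * (1 - p)" using p by (simp add: s_def)
  have "p * (1 - p) \<le> 1 * 1" using p by (intro mult_mono) auto
  then show "s \<le> 1" by (simp add: s_def)
qed (use p in \<open>simp add: s_def\<close>)

text \<open>This gate looks only at the current \<open>q n\<close>, which is known before the draw.
  It may close and reopen; on a path along which \<open>q\<close> tends to \<open>p\<close> it is
  closed finitely often.\<close>

lemma predictable_near: "predictable (\<lambda>n \<omega>. if \<bar>q n \<omega> - p\<bar> \<le> r then 1 else 0)"
  unfolding predictable_def
proof (intro allI conjI)
  fix n
  show "(\<lambda>\<omega>. if \<bar>q n \<omega> - p\<bar> \<le> r then 1 else 0) \<in> borel_measurable (F n)"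
    using q_measurable[of n] by measurable
  show "\<exists>B. \<forall>\<omega>. \<bar>if \<bar>q n \<omega> - p\<bar> \<le> r then 1 else 0 :: real\<bar> \<le> B" by (intro exI[of _ 1]) auto
qed

lemma eventually_near:
  assumes "r > 0" "(\<lambda>n. q n \<omega>) \<longlonglongrightarrow> p"
  shows "\<exists>J. \<forall>j\<ge>J. \<bar>q j \<omega> - p\<bar> \<le> r"
  using assms(2)[unfolded LIMSEQ_def, rule_format, OF assms(1)] by (auto simp: dist_real_def intro: less_imp_le)

lemma upper_LIL_one_sided:
  assumes \<delta>: "\<delta> > 0"
  shows "AE \<omega> in M. eventually (\<lambda>n. mart n \<omega> \<le> (1 + \<delta>) * s * \<phi> n) sequentially"
proof -
  define d where "d = min 1 (\<delta> / 4)"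
  have d: "d > 0" "d \<le> 1" "4 * d \<le> \<delta>" using \<delta> by (auto simp: d_def)
  obtain r u0 where r: "r > 0" "u0 > 0"
    and cgf: "\<And>q u. q \<in> {0..1} \<Longrightarrow> \<bar>q - p\<bar> \<le> r \<Longrightarrow> \<bar>u\<bar> \<le> u0 \<Longrightarrow>
       \<bar>cgf q u - p * (1 - p) * u\<^sup>2 / 2\<bar> \<le> d * (p * (1 - p)) * u\<^sup>2 / 2"
    using cgf_quadratic[OF p d(1)] by metis
  define g where "g n \<omega> = (if \<bar>q n \<omega> - p\<bar> \<le> r then 1 else 0 :: real)" for n \<omega>
  have "AE \<omega> in M. eventually (\<lambda>n. (\<Sum>j<n. w j * g j \<omega> * \<xi> j \<omega>) \<le> (1 + d) * ((1 + d) * s) * \<phi> n) sequentially"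
  proof (rule upper_LIL_predictable[OF _ _ _ r(2) _ d(1)])
    show "predictable g" unfolding g_def by (rule predictable_near)
    show "g n \<omega> \<in> {0, 1}" for n \<omega> by (simp add: g_def)
    show "(1 + d) * s > 0" using d s by simp
    fix n \<omega> u assume "g n \<omega> = 1" "\<bar>u\<bar> \<le> u0"
    then have "\<bar>cgf (q n \<omega>) u - s\<^sup>2 * u\<^sup>2 / 2\<bar> \<le> d * s\<^sup>2 * u\<^sup>2 / 2"
      unfolding s(3) using cgf[OF q_range] by (auto simp: g_def split: if_splits)
    then have "cgf (q n \<omega>) u \<le> s\<^sup>2 * u\<^sup>2 / 2 + d * s\<^sup>2 * u\<^sup>2 / 2" by linarith
    also have "\<dots> = (1 + d) * (s\<^sup>2 * u\<^sup>2 / 2)" by (simp add: field_simps)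
    also have "\<dots> \<le> (1 + d)\<^sup>2 * (s\<^sup>2 * u\<^sup>2 / 2)" using d
      by (intro mult_right_mono) (auto simp: power2_eq_square)
    finally show "cgf (q n \<omega>) u \<le> ((1 + d) * s)\<^sup>2 * u\<^sup>2 / 2" by (simp add: power_mult_distrib)
  qed
  then show ?thesis using q_lim
  proof eventually_elim
    case (elim \<omega>)
    obtain J where "\<forall>j\<ge>J. \<bar>q j \<omega> - p\<bar> \<le> r" using eventually_near[OF r(1) elim(2)] by blast
    then have J: "g j \<omega> = 1" if "j \<ge> J" for j using that by (simp add: g_def)
    define C where "C = (\<Sum>j<J. w j * (1 - g j \<omega>) * \<xi> j \<omega>)"
    have "eventually (\<lambda>n. \<phi> n \<ge> C / (d * s)) sequentially" by (rule \<phi>_eventually_ge)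
    then show ?case using elim(1) eventually_ge_at_top[of J] \<phi>_eventually_ge[of 0]
    proof eventually_elim
      case (elim n)
      have "mart n \<omega> - (\<Sum>j<n. w j * g j \<omega> * \<xi> j \<omega>) = (\<Sum>j<n. w j * (1 - g j \<omega>) * \<xi> j \<omega>)"
        by (simp add: mart_def sum_subtractf[symmetric] algebra_simps)
      also have "\<dots> = C" unfolding C_def using elim J by (intro sum.mono_neutral_right) auto
      finally have "mart n \<omega> = (\<Sum>j<n. w j * g j \<omega> * \<xi> j \<omega>) + C" by simp
      also have "C \<le> d * s * \<phi> n" using elim(1) d s by (simp add: divide_le_eq mult.commute)
      also have "(\<Sum>j<n. w j * g j \<omega> * \<xi> j \<omega>) + d * s * \<phi> n \<le> ((1 + d) * (1 + d) + d) * (s * \<phi> n)"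
        using elim(2) by (simp add: algebra_simps)
      also have "\<dots> \<le> (1 + \<delta>) * (s * \<phi> n)"
      proof (rule mult_right_mono)
        have "d * d \<le> d" using d by (simp add: mult_left_le)
        then show "(1 + d) * (1 + d) + d \<le> 1 + \<delta>" using d(3) by (simp add: algebra_simps)
      qed (use elim s in simp)
      finally show ?case by (simp add: mult.assoc)
    qed
  qed
qed

lemma convergent_bernoulli_sums_uminus: "convergent_bernoulli_sums M F e q (\<lambda>n. - w n) V p"
  using p q_lim weighted_bernoulli_sums_uminus
  by (simp add: convergent_bernoulli_sums_def convergent_bernoulli_sums_axioms_def)

lemma upper_LIL:
  assumes \<delta>: "\<delta> > 0"
  shows "AE \<omega> in M. eventually (\<lambda>n. \<bar>mart n \<omega>\<bar> \<le> (1 + \<delta>) * s * \<phi> n) sequentially"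
  using upper_LIL_one_sided[OF \<delta>]
    convergent_bernoulli_sums.upper_LIL_one_sided[OF convergent_bernoulli_sums_uminus \<delta>]
  unfolding mart_uminus
proof eventually_elim
  case (elim \<omega>)
  from elim show ?case by eventually_elim auto
qed

end

section \<open>Geometric blocks and the lower half of the law\<close>

context lil_weights
begin

text \<open>The block ends are deterministic, since \<open>V\<close> sums the squared weights and
  not the random conditional variances; so \<open>F (hit \<rho> k)\<close> is simply a member of the
  filtration.\<close>

definition hit :: "real \<Rightarrow> nat \<Rightarrow> nat" where
  "hit \<rho> k = (LEAST n. V n \<ge> \<rho> ^ k)"

lemma V_hit: "V (hit \<rho> k) \<ge> \<rho> ^ k"
proof -
  obtain n where "V n \<ge> \<rho> ^ k"
    using V_eventually_ge[of "\<rho> ^ k"] unfolding eventually_sequentially by blast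
  then show ?thesis unfolding hit_def by (rule LeastI)
qed

lemma mono_hit: "\<rho> \<ge> 1 \<Longrightarrow> mono (hit \<rho>)"
proof (rule monoI)
  fix j k :: nat assume "\<rho> \<ge> 1" "j \<le> k"
  then have "\<rho> ^ j \<le> V (hit \<rho> k)" using V_hit[of \<rho> k] power_increasing[of j k \<rho>] by linarith
  then show "hit \<rho> j \<le> hit \<rho> k" unfolding hit_def[of \<rho> j] by (rule Least_le)
qed

lemma hit_at_top:
  assumes "\<rho> > 1"
  shows "filterlim (hit \<rho>) at_top sequentially"
  unfolding filterlim_at_top
proof
  fix J
  have "filterlim (\<lambda>k. \<rho> ^ k) at_top sequentially"
    using assms by real_asymp
  then have "eventually (\<lambda>k. \<rho> ^ k > V J) sequentially" unfolding filterlim_at_top_dense by blast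
  then show "eventually (\<lambda>k. J \<le> hit \<rho> k) sequentially"
  proof eventually_elim
    case (elim k)
    then have "V J < V (hit \<rho> k)" using V_hit[of \<rho> k] by linarith
    then show ?case using V_mono[of "hit \<rho> k" J] by (meson linear not_less)
  qed
qed

text \<open>The overshoot at the passage is less than the last squared weight, which
  \<open>w_small_geometric\<close> with u = 1/2 makes at most half of the value reached.\<close>

lemma V_hit_le:
  assumes "\<rho> > 1"
  shows "eventually (\<lambda>k. V (hit \<rho> k) \<le> 2 * \<rho> ^ k) sequentially"
  using w_small_geometric[OF assms, of "1/2", simplified] eventually_ge_at_top[of 1]
proof eventually_elim
  case (elim k)
  have "\<rho> ^ k > 0" using assms by simp
  then have "hit \<rho> k \<noteq> 0" using V_hit[of \<rho> k] by (auto simp: V_eq intro: ccontr)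
  then obtain j where j: "hit \<rho> k = Suc j" using not0_implies_Suc by blast
  have "\<not> V j \<ge> \<rho> ^ k" using j unfolding hit_def by (intro not_less_Least) auto
  moreover have "(w j)\<^sup>2 * real k \<le> V (Suc j) / 2"
    using elim(1)[rule_format, of "V (Suc j)" j] V_hit[of \<rho> k] j by simp
  moreover have "(w j)\<^sup>2 * 1 \<le> (w j)\<^sup>2 * real k" using elim(2) by (intro mult_left_mono) auto
  ultimately show ?case using V_Suc[of j] j by simp
qed

end

context convergent_bernoulli_sums
begin

text \<open>With \<open>\<rho> = 2 / \<eta>\<^sup>2\<close> the blocks grow so fast that the martingale at the start of a block is
  negligible against the increment over it.\<close>

lemma lower_LIL:
  assumes \<delta>: "\<delta> > 0"
  shows "AE \<omega> in M. frequently (\<lambda>n. mart n \<omega> \<ge> (1 - \<delta>) * s * \<phi> n) sequentially"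
proof -
  \<comment> \<open>The bound 1/4 is required by \<open>tilted_block\<close> and keeps 1 - 3 *
    \<eta> positive. The inequality 8 * \<eta> \<le> s * \<delta> pays for all losses: at most 6 *
    \<eta> in the factor of s, and \<eta> each for the logarithmic error and for the martingale at
    the start of the block.\<close>
  define \<eta> where "\<eta> = min (1/4) (s * \<delta> / 8)"
  have \<eta>: "\<eta> > 0" "\<eta> \<le> 1/4" "8 * \<eta> \<le> s * \<delta>" using s(1,2) \<delta> by (auto simp: \<eta>_def)
  have \<eta>2: "0 < \<eta>\<^sup>2" "\<eta>\<^sup>2 \<le> 1/16"
    using \<eta> power_mono[of \<eta> "1/4" 2] by (auto simp: power2_eq_square)
  define \<rho> where "\<rho> = 2 / \<eta>\<^sup>2"
  have \<rho>: "\<rho> \<ge> 32" using \<eta>2 unfolding \<rho>_def by (subst pos_le_divide_eq) auto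
  have \<rho>1: "\<rho> > 1" using \<rho> by simp
  have ln\<rho>: "ln \<rho> \<ge> 1"
  proof -
    have "exp 1 \<le> \<rho>" using e_less_272 \<rho> by simp
    then show ?thesis using \<rho>1 by (subst ln_ge_iff) auto
  qed
  obtain r u0 where r: "r > 0" "u0 > 0"
    and cgf: "\<And>q u. q \<in> {0..1} \<Longrightarrow> \<bar>q - p\<bar> \<le> r \<Longrightarrow> \<bar>u\<bar> \<le> u0 \<Longrightarrow>
       \<bar>cgf q u - p * (1 - p) * u\<^sup>2 / 2\<bar> \<le> \<eta>\<^sup>2 / 2 * (p * (1 - p)) * u\<^sup>2 / 2"
    using cgf_quadratic[OF p, of "\<eta>\<^sup>2 / 2"] \<eta>2 by auto
  define g where "g n \<omega> = (if \<bar>q n \<omega> - p\<bar> \<le> r then 1 else 0 :: real)" for n \<omega>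
  define N where "N = hit \<rho>"
  define v where "v k = V (N (Suc k))" for k
  define B where "B k = v k - V (N k)" for k
  \<comment> \<open>With the factor 1 - 3 * \<eta> the exponent (1 + 3 * \<eta>) / 2 * s^2 * \<mu>^2
    * B in the price of a block becomes (1 - 9 * \<eta>^2) * ln k. The price is thus at least a
    constant times 1 / k, and its sum diverges.\<close>
  define \<mu> where "\<mu> k = sqrt (2 * (1 - 3 * \<eta>) * ln (real k) / (s\<^sup>2 * B k))" for k
  \<comment> \<open>From v k \<le> 2 * \<rho>^(k+1) follows ln (v k) \<le> (k + 1) * c; hence ln (ln
    (v k)) exceeds ln k only by a factor tending to 1.\<close>
  define c where "c = ln 2 + ln \<rho>"
  have N: "mono N" unfolding N_def using \<rho>1 by (intro mono_hit) simp
  have NM: "N k \<le> N (Suc k)" for k using N by (simp add: mono_def)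
  have vge: "v k \<ge> \<rho> ^ Suc k" for k unfolding v_def N_def by (rule V_hit)
  have vpos: "v k > 0" for k using vge[of k] zero_less_power[of \<rho> "Suc k"] \<rho>1 by linarith
  have ev1: "eventually (\<lambda>k. V (N k) \<le> 2 * \<rho> ^ k) sequentially"
    unfolding N_def by (rule V_hit_le[OF \<rho>1])
  then have ev2: "eventually (\<lambda>k. v k \<le> 2 * \<rho> ^ Suc k) sequentially"
    unfolding v_def using eventually_sequentially_Suc[of "\<lambda>k. V (N k) \<le> 2 * \<rho> ^ k"] by simp
  have ev3: "eventually (\<lambda>k. V (N k) \<le> \<eta>\<^sup>2 * v k) sequentially"
    using ev1
  proof eventually_elim
    case (elim k)
    have "2 * \<rho> ^ k = \<eta>\<^sup>2 * \<rho> ^ Suc k" using \<eta>2 by (simp add: \<rho>_def)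
    also have "\<dots> \<le> \<eta>\<^sup>2 * v k" using vge \<eta>2 by (intro mult_left_mono) auto
    finally show ?case using elim by simp
  qed
  have lnk: "eventually (\<lambda>k. ln (real k) \<ge> x) sequentially" for x
    using filterlim_compose[OF ln_at_top filterlim_real_sequentially] unfolding filterlim_at_top by blast
  have ev4: "eventually (\<lambda>k. \<forall>j. j < N (Suc k) \<longrightarrow> 2 * \<mu> k * \<bar>w j\<bar> \<le> u0) sequentially"
  proof -
    have "u0\<^sup>2 * s\<^sup>2 / 16 > 0" using r s(1) by (intro divide_pos_pos mult_pos_pos zero_less_power) auto
    from w_small_geometric[OF \<rho>1 this] show ?thesis
      using ev3 eventually_ge_at_top[of 1]
    proof eventually_elim
      case (elim k)
      show ?case
      proof (intro allI impI)
        fix j assume j: "j < N (Suc k)"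
        have "\<rho> ^ k \<le> v k" using vge[of k] power_increasing[of k "Suc k" \<rho>] \<rho>1 by linarith
        moreover have "V (Suc j) \<le> v k" unfolding v_def using j by (intro V_mono) simp
        ultimately have "(w j)\<^sup>2 * real k \<le> u0\<^sup>2 * s\<^sup>2 / 16 * v k" using elim(1) by blast
        moreover have "(w j)\<^sup>2 * ln (real k) \<le> (w j)\<^sup>2 * real k"
          using elim(3) ln_le_minus_one[of "real k"] by (intro mult_left_mono) auto
        moreover have "v k \<le> 2 * B k"
        proof -
          have "\<eta>\<^sup>2 * v k \<le> 1/16 * v k" using \<eta>2 vpos[of k] by (intro mult_right_mono) auto
          with elim(2) have "V (N k) \<le> 1/16 * v k" by (rule order_trans)
          then show ?thesis using vpos[of k] by (simp add: B_def)
        qed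
        then have "u0\<^sup>2 * s\<^sup>2 / 16 * v k \<le> u0\<^sup>2 * s\<^sup>2 / 16 * (2 * B k)" by (intro mult_left_mono) auto
        ultimately have 1: "8 * ((w j)\<^sup>2 * ln (real k)) \<le> u0\<^sup>2 * (s\<^sup>2 * B k)"
          by (simp add: algebra_simps)
        have Bpos: "B k > 0" using \<open>v k \<le> 2 * B k\<close> vpos[of k] by linarith
        have "(2 * \<mu> k * \<bar>w j\<bar>)\<^sup>2 = (1 - 3 * \<eta>) * (8 * ((w j)\<^sup>2 * ln (real k))) / (s\<^sup>2 * B k)"
        proof -
          have "2 * (1 - 3 * \<eta>) * ln (real k) / (s\<^sup>2 * B k) \<ge> 0"
            using elim(3) Bpos \<eta> by (intro divide_nonneg_nonneg mult_nonneg_nonneg) auto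
          then have "(\<mu> k)\<^sup>2 = 2 * (1 - 3 * \<eta>) * ln (real k) / (s\<^sup>2 * B k)" unfolding \<mu>_def by simp
          then show ?thesis by (simp add: power_mult_distrib)
        qed
        also have "\<dots> \<le> 1 * (8 * ((w j)\<^sup>2 * ln (real k))) / (s\<^sup>2 * B k)"
          using \<eta> s(1,2) Bpos elim(3) by (intro divide_right_mono mult_right_mono) auto
        also have "\<dots> \<le> u0\<^sup>2" using 1 s(1,2) Bpos by (simp add: divide_le_eq)
        finally show "2 * \<mu> k * \<bar>w j\<bar> \<le> u0" by (rule power2_le_imp_le) (use r in simp)
      qed
    qed
  qed
  have ev5: "eventually (\<lambda>k. (1 - \<eta>) * (ln (real k + 1) + ln c) \<le> ln (real k)) sequentially"
    using \<eta>(1) by real_asymp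
  \<comment> \<open>The deterministic comparison: the increment granted by
    \<open>tilted_block\<close>, less all that the martingale may have lost before the block, still
    reaches the target.\<close>
  have key: "eventually (\<lambda>k. (1 - \<eta>) * s\<^sup>2 * \<mu> k * B k - ln 4 / (\<eta> * \<mu> k) - \<phi> (N k)
      \<ge> (1 - \<delta>) * s * \<phi> (N (Suc k))) sequentially"
    using ev2 ev3 ev5 lnk[of "ln 4 / (2 * \<eta>\<^sup>2 * (1 - 3 * \<eta>))"] eventually_ge_at_top[of 2]
  proof eventually_elim
    case (elim k)
    define x where "x = ln (real k)"
    define l where "l = ln (ln (v k))"
    define \<Phi> where "\<Phi> = sqrt (2 * v k * l)"
    have x: "x > 0" using elim(5) by (simp add: x_def)
    have lnv: "real (Suc k) * ln \<rho> \<le> ln (v k)"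
      using vge[of k] vpos[of k] \<rho>1 by (subst ln_realpow[symmetric]) (auto simp del: power_Suc)
    have "real (Suc k) * 1 \<le> real (Suc k) * ln \<rho>" using ln\<rho> by (intro mult_left_mono) auto
    from order_trans[OF this lnv] have lnvk: "real k \<le> ln (v k)" by simp
    have xl: "x \<le> l" unfolding x_def l_def using lnvk elim(5) by simp
    have lx: "(1 - \<eta>) * l \<le> x"
    proof -
      have "ln (v k) \<le> ln (2 * \<rho> ^ Suc k)" using elim(1) vpos[of k] by simp
      also have "\<dots> = ln 2 + real (Suc k) * ln \<rho>" using \<rho>1 
        by (simp add: ln_mult_pos ln_realpow del: power_Suc)
      also have "\<dots> \<le> real (Suc k) * c" unfolding c_def by (simp add: algebra_simps)
      finally have "ln (v k) \<le> (real k + 1) * c" by (simp add: algebra_simps)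
      then have "l \<le> ln ((real k + 1) * c)" using lnvk elim(5) by (simp add: l_def)
      also have "\<dots> = ln (real k + 1) + ln c" using ln\<rho> by (intro ln_mult_pos) (auto simp: c_def add_pos_pos)
      finally have "(1 - \<eta>) * l \<le> (1 - \<eta>) * (ln (real k + 1) + ln c)" using \<eta> by (intro mult_left_mono) auto
      then show ?thesis using elim(3) by (simp add: x_def)
    qed
    have Bv: "(1 - \<eta>\<^sup>2) * v k \<le> B k" using elim(2) by (simp add: B_def algebra_simps)
    have Bv': "B k \<le> v k" using V_nonneg by (simp add: B_def)
    have Bpos: "B k > 0"
    proof -
      have "(1 - \<eta>\<^sup>2) * v k > 0" using \<eta>2 vpos[of k] by (intro mult_pos_pos) auto
      then show ?thesis using Bv by linarith
    qed
    have \<mu>: "\<mu> k > 0" "(\<mu> k)\<^sup>2 = 2 * (1 - 3 * \<eta>) * x / (s\<^sup>2 * B k)"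
      using \<eta> x s(1,2) Bpos by (auto simp: \<mu>_def x_def[symmetric])
    have mB: "s\<^sup>2 * (\<mu> k)\<^sup>2 * B k = 2 * (1 - 3 * \<eta>) * x" using \<mu>(2) s(1) Bpos by simp
    \<comment> \<open>The leading term of the increment. Its upper bound by \<open>\<Phi>\<close>
      controls the error ln 4 / (\<eta> * \<mu>), its lower bound gives the claim.\<close>
    define y where "y = s\<^sup>2 * \<mu> k * B k"
    have ypos: "y > 0" using s(1,2) \<mu> Bpos by (simp add: y_def)
    have y2: "y\<^sup>2 = s\<^sup>2 * (2 * (1 - 3 * \<eta>) * x * B k)"
    proof -
      have "y\<^sup>2 = s\<^sup>2 * (s\<^sup>2 * (\<mu> k)\<^sup>2 * B k * B k)" by (simp add: y_def power2_eq_square)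
      then show ?thesis unfolding mB .
    qed
    have \<Phi>: "\<Phi> \<ge> 0" "\<Phi>\<^sup>2 = 2 * v k * l" using xl x vpos[of k] by (auto simp: \<Phi>_def)
    have y_le: "y \<le> \<Phi>"
    proof (rule power2_le_imp_le)
      have "s\<^sup>2 * (2 * (1 - 3 * \<eta>) * x * B k) \<le> 1 * (2 * 1 * l * v k)"
        using s(1,2) \<eta> x xl Bpos Bv' vpos[of k] by (intro mult_mono) (auto simp: power_le_one)
      then show "y\<^sup>2 \<le> \<Phi>\<^sup>2" unfolding y2 \<Phi>(2) by (simp add: algebra_simps)
    qed (rule \<Phi>)
    have y_ge: "s * ((1 - 3 * \<eta>) * (1 - \<eta>) * (1 - \<eta>\<^sup>2)) * \<Phi> \<le> y"
    proof (rule power2_le_imp_le)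
      define z where "z = (1 - 3 * \<eta>) * (1 - \<eta>) * (1 - \<eta>\<^sup>2)"
      have z: "0 \<le> z" "z \<le> 1"
      proof -
        have "(1 - 3 * \<eta>) * (1 - \<eta>) * (1 - \<eta>\<^sup>2) \<le> 1 * 1 * 1"
          using \<eta> \<eta>2 by (intro mult_mono) auto
        then show "z \<le> 1" by (simp add: z_def)
        show "0 \<le> z" unfolding z_def using \<eta> \<eta>2 by (intro mult_nonneg_nonneg) auto
      qed
      have "z\<^sup>2 \<le> z" using z by (simp add: power2_eq_square mult_left_le)
      have "(s * z * \<Phi>)\<^sup>2 = s\<^sup>2 * (z\<^sup>2 * (2 * v k * l))" using \<Phi>(2) by (simp add: power_mult_distrib)
      also have "\<dots> \<le> s\<^sup>2 * (z * (2 * v k * l))"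
        using \<open>z\<^sup>2 \<le> z\<close> vpos[of k] xl x by (intro mult_left_mono mult_right_mono) auto
      also have "\<dots> = s\<^sup>2 * (2 * (1 - 3 * \<eta>) * ((1 - \<eta>) * l) * ((1 - \<eta>\<^sup>2) * v k))"
        by (simp add: z_def)
      also have "\<dots> \<le> s\<^sup>2 * (2 * (1 - 3 * \<eta>) * x * B k)"
        using lx Bv \<eta> \<eta>2 x xl vpos[of k] by (intro mult_left_mono mult_mono) auto
      finally show "(s * ((1 - 3 * \<eta>) * (1 - \<eta>) * (1 - \<eta>\<^sup>2)) * \<Phi>)\<^sup>2 \<le> y\<^sup>2"
        by (simp add: y2 z_def)
    qed (use ypos in simp)
    have err: "ln 4 / (\<eta> * \<mu> k) \<le> \<eta> * \<Phi>"
    proof -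
      have e3: "1 - 3 * \<eta> > 0" using \<eta> by simp
      have yx: "y * \<mu> k = 2 * (1 - 3 * \<eta>) * x"
        unfolding mB[symmetric] by (simp add: y_def power2_eq_square)
      have "ln 4 \<le> x * (2 * \<eta>\<^sup>2 * (1 - 3 * \<eta>))"
        using elim(4) e3 \<eta>2 unfolding x_def[symmetric] by (subst (asm) pos_divide_le_eq) auto
      also have "\<dots> = \<eta>\<^sup>2 * (y * \<mu> k)" unfolding yx by simp
      also have "\<dots> \<le> \<eta>\<^sup>2 * (\<Phi> * \<mu> k)" using y_le \<mu>(1) by (intro mult_left_mono mult_right_mono) auto
      also have "\<dots> = \<eta> * \<Phi> * (\<eta> * \<mu> k)" by (simp add: power2_eq_square)
      finally show ?thesis using \<eta> \<mu>(1) by (subst pos_divide_le_eq) auto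
    qed
    have prev: "\<phi> (N k) \<le> \<eta> * \<Phi>"
    proof -
      have "\<rho> ^ 1 \<le> \<rho> ^ k" using elim(5) \<rho>1 by (intro power_increasing) auto
      then have "V (N k) > exp 1" using V_hit[of \<rho> k] \<rho> e_less_272 by (simp add: N_def)
      moreover from this have "V (N k) > 0" using exp_gt_zero[of 1] less_trans by blast
      ultimately have V1: "ln (V (N k)) > 1" "V (N k) > 0"
        using ln_less_cancel_iff[of "exp 1" "V (N k)"] by auto
      have "ln (ln (V (N k))) \<le> l"
      proof -
        have "V (N k) \<le> v k" unfolding v_def using NM by (intro V_mono)
        then have "ln (V (N k)) \<le> ln (v k)" using V1 by simp
        then show ?thesis using V1 unfolding l_def by (subst ln_le_cancel_iff) linarith+
      qed
      then have "2 * V (N k) * ln (ln (V (N k))) \<le> 2 * (\<eta>\<^sup>2 * v k) * l"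
        using elim(2) V1 vpos[of k] by (intro mult_mono) auto
      also have "\<dots> = (\<eta> * \<Phi>)\<^sup>2" using \<Phi>(2) by (simp add: power_mult_distrib)
      finally show ?thesis unfolding \<phi>_def using \<Phi> \<eta> by (intro real_le_lsqrt) auto
    qed
    have "(1 - \<delta>) * s * \<Phi> \<le> (s * ((1 - \<eta>) * ((1 - 3 * \<eta>) * (1 - \<eta>) * (1 - \<eta>\<^sup>2))) - 2 * \<eta>) * \<Phi>"
    proof (rule mult_right_mono)
      have "1 - 6 * \<eta> \<le> (1 - \<eta>) * ((1 - 3 * \<eta>) * (1 - \<eta>) * (1 - \<eta>\<^sup>2))"
      proof -
        have b: "1 - (x + y) \<le> (1 - x) * (1 - y)" if "0 \<le> x" "0 \<le> y" for x y :: real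
          using that by (simp add: algebra_simps)
        have "1 - 4 * \<eta> \<le> (1 - 3 * \<eta>) * (1 - \<eta>)" using b[of "3 * \<eta>" \<eta>] \<eta> by simp
        then have "(1 - 4 * \<eta>) * (1 - \<eta>\<^sup>2) \<le> (1 - 3 * \<eta>) * (1 - \<eta>) * (1 - \<eta>\<^sup>2)"
          using \<eta>2 by (intro mult_right_mono) auto
        then have "1 - (4 * \<eta> + \<eta>\<^sup>2) \<le> (1 - 3 * \<eta>) * (1 - \<eta>) * (1 - \<eta>\<^sup>2)"
          using b[of "4 * \<eta>" "\<eta>\<^sup>2"] \<eta> by simp
        then have "(1 - \<eta>) * (1 - (4 * \<eta> + \<eta>\<^sup>2)) \<le> (1 - \<eta>) * ((1 - 3 * \<eta>) * (1 - \<eta>) * (1 - \<eta>\<^sup>2))"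
          using \<eta> by (intro mult_left_mono) auto
        moreover have "\<eta>\<^sup>2 \<le> \<eta>" using \<eta> by (simp add: power2_eq_square mult_left_le)
        moreover have "1 - (\<eta> + (4 * \<eta> + \<eta>\<^sup>2)) \<le> (1 - \<eta>) * (1 - (4 * \<eta> + \<eta>\<^sup>2))"
          using b[of \<eta> "4 * \<eta> + \<eta>\<^sup>2"] \<eta> by simp
        ultimately show ?thesis by linarith
      qed
      then have "s * (1 - 6 * \<eta>) \<le> s * ((1 - \<eta>) * ((1 - 3 * \<eta>) * (1 - \<eta>) * (1 - \<eta>\<^sup>2)))"
        using s(1,2) by (intro mult_left_mono) auto
      moreover have "s * \<eta> \<le> \<eta>" using s(1,2) \<eta> by (simp add: mult_right_le_one_le)
      ultimately show "(1 - \<delta>) * s \<le> s * ((1 - \<eta>) * ((1 - 3 * \<eta>) * (1 - \<eta>) * (1 - \<eta>\<^sup>2))) - 2 * \<eta>"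
        using \<eta>(3) by (simp add: algebra_simps)
    qed (rule \<Phi>)
    also have "\<dots> = (1 - \<eta>) * (s * ((1 - 3 * \<eta>) * (1 - \<eta>) * (1 - \<eta>\<^sup>2)) * \<Phi>) - \<eta> * \<Phi> - \<eta> * \<Phi>"
      by (simp add: algebra_simps)
    also have "\<dots> \<le> (1 - \<eta>) * y - ln 4 / (\<eta> * \<mu> k) - \<phi> (N k)"
      using y_ge err prev \<eta> by (intro diff_mono mult_left_mono) auto
    finally show ?case by (simp add: \<Phi>_def l_def \<phi>_def v_def[symmetric] y_def mult.assoc)
  qed
  from eventually_conj[OF ev4 eventually_conj[OF ev3 eventually_ge_at_top[of 2]]]
  obtain k0 where k0: "\<And>k j. k \<ge> k0 \<Longrightarrow> j < N (Suc k) \<Longrightarrow> 2 * \<mu> k * \<bar>w j\<bar> \<le> u0"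
    "\<And>k. k \<ge> k0 \<Longrightarrow> V (N k) \<le> \<eta>\<^sup>2 * v k" "\<And>k. k \<ge> k0 \<Longrightarrow> k \<ge> 2"
    unfolding eventually_sequentially by blast
  have Bpos: "B k > 0" if "k \<ge> k0" for k
  proof -
    have "\<eta>\<^sup>2 * v k \<le> 1/16 * v k" using \<eta>2 vpos[of k] by (intro mult_right_mono) auto
    with k0(2)[OF that] have "V (N k) \<le> 1/16 * v k" by (rule order_trans)
    then show ?thesis using vpos[of k] by (simp add: B_def)
  qed
  define P where "P k = exp (- ((1 + 3 * \<eta>) / 2 * s\<^sup>2 * (\<mu> k)\<^sup>2 * B k + ln 4 / \<eta>)) / 2" for k
  have "\<exists>G. G \<in> borel_measurable (F (N (Suc k))) \<and> (\<exists>C. \<forall>\<omega>. \<bar>G \<omega>\<bar> \<le> C) \<and> (\<forall>\<omega>. G \<omega> \<le> 1) \<and>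
    (\<forall>\<omega>. G \<omega> > 0 \<longrightarrow> (\<forall>j\<in>{N k..<N (Suc k)}. g j \<omega> = 1) \<longrightarrow>
       (\<Sum>j=N k..<N (Suc k). w j * \<xi> j \<omega>) \<ge> (1 - \<eta>) * s\<^sup>2 * \<mu> k * B k - ln 4 / (\<eta> * \<mu> k)) \<and>
    (\<forall>f C. f \<in> borel_measurable (F (N k)) \<longrightarrow> (\<forall>\<omega>. \<bar>f \<omega>\<bar> \<le> C) \<longrightarrow>
       expectation (\<lambda>\<omega>. f \<omega> * G \<omega>) = P k * expectation f)" if k: "k \<ge> k0" for k
  proof -
    have B: "B k = (\<Sum>j=N k..<N (Suc k). (w j)\<^sup>2)"
      using sum.atLeastLessThan_concat[of 0 "N k" "N (Suc k)" "\<lambda>j. (w j)\<^sup>2"] NM[of k]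
      by (simp add: B_def v_def V_eq atLeast0LessThan)
    have g: "predictable g" "\<And>n \<omega>. g n \<omega> \<in> {0, 1}"
      unfolding g_def using predictable_near by auto
    have \<mu>: "\<mu> k > 0" using \<eta> s(1,2) Bpos[OF k] k0(3)[OF k] by (auto simp: \<mu>_def)
    have cg: "\<bar>cgf (q n \<omega>) u - s\<^sup>2 * u\<^sup>2 / 2\<bar> \<le> \<eta>\<^sup>2 / 2 * s\<^sup>2 * u\<^sup>2 / 2"
      if "g n \<omega> = 1" "\<bar>u\<bar> \<le> u0" for n \<omega> u
      unfolding s(3) using that cgf[OF q_range] by (auto simp: g_def split: if_splits)
    show ?thesis
    proof (rule tilted_block[where ?u0.0 = u0 and s = s, OF NM B g \<mu> \<eta>(1,2)], goal_cases)
      case (1 n \<omega> u)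
      then show ?case by (rule cg)
    next
      case (2 j)
      then show ?case using k0(1)[OF k] by blast
    next
      case (3 G)
      then show ?case unfolding P_def by (intro exI[of _ G] conjI allI impI) blast+
    qed
  qed
  \<comment> \<open>The smallness of the weights and the size of the blocks are guaranteed from
    \<open>k0\<close> on, so the blocks are renumbered as k = k0 + i.\<close>
  then have "\<forall>i. \<exists>G. G \<in> borel_measurable (F (N (Suc (k0 + i)))) \<and> (\<exists>C. \<forall>\<omega>. \<bar>G \<omega>\<bar> \<le> C) \<and> (\<forall>\<omega>. G \<omega> \<le> 1) \<and>
    (\<forall>\<omega>. G \<omega> > 0 \<longrightarrow> (\<forall>j\<in>{N (k0 + i)..<N (Suc (k0 + i))}. g j \<omega> = 1) \<longrightarrow>
       (\<Sum>j=N (k0 + i)..<N (Suc (k0 + i)). w j * \<xi> j \<omega>)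
         \<ge> (1 - \<eta>) * s\<^sup>2 * \<mu> (k0 + i) * B (k0 + i) - ln 4 / (\<eta> * \<mu> (k0 + i))) \<and>
    (\<forall>f C. f \<in> borel_measurable (F (N (k0 + i))) \<longrightarrow> (\<forall>\<omega>. \<bar>f \<omega>\<bar> \<le> C) \<longrightarrow>
       expectation (\<lambda>\<omega>. f \<omega> * G \<omega>) = P (k0 + i) * expectation f)"
    using le_add1 by blast
  from choice[OF this] obtain G where
    G: "\<And>i. G i \<in> borel_measurable (F (N (Suc (k0 + i))))" "\<And>i. \<exists>C. \<forall>\<omega>. \<bar>G i \<omega>\<bar> \<le> C" "\<And>i \<omega>. G i \<omega> \<le> 1"
    and Gpos: "\<And>i \<omega>. G i \<omega> > 0 \<Longrightarrow> \<forall>j\<in>{N (k0 + i)..<N (Suc (k0 + i))}. g j \<omega> = 1 \<Longrightarrow>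
       (\<Sum>j=N (k0 + i)..<N (Suc (k0 + i)). w j * \<xi> j \<omega>)
         \<ge> (1 - \<eta>) * s\<^sup>2 * \<mu> (k0 + i) * B (k0 + i) - ln 4 / (\<eta> * \<mu> (k0 + i))"
    and GE: "\<And>i f C. f \<in> borel_measurable (F (N (k0 + i))) \<Longrightarrow> (\<And>\<omega>. \<bar>f \<omega>\<bar> \<le> C) \<Longrightarrow>
       expectation (\<lambda>\<omega>. f \<omega> * G i \<omega>) = P (k0 + i) * expectation f"
    by blast
  have "\<not> summable (\<lambda>i. P (k0 + i))"
  proof
    assume "summable (\<lambda>i. P (k0 + i))"
    then have sP: "summable (\<lambda>i. 2 * exp (ln 4 / \<eta>) * P (i + k0))"
      by (intro summable_mult) (simp add: add.commute)
    have "summable (\<lambda>i. inverse (real (i + k0)))"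
    proof (rule summable_comparison_test'[OF sP, of 0])
      fix i :: nat
      define k where "k = i + k0"
      have k: "k \<ge> k0" "k \<ge> 2" using k0(3)[of k] by (auto simp: k_def)
      have "s\<^sup>2 * (\<mu> k)\<^sup>2 * B k = 2 * (1 - 3 * \<eta>) * ln (real k)"
        using s(1,2) Bpos[OF k(1)] \<eta> k(2) by (simp add: \<mu>_def)
      then have "(1 + 3 * \<eta>) / 2 * s\<^sup>2 * (\<mu> k)\<^sup>2 * B k = (1 + 3 * \<eta>) / 2 * (2 * (1 - 3 * \<eta>) * ln (real k))"
        by (metis mult.assoc)
      also have "\<dots> = (1 - (3 * \<eta>)\<^sup>2) * ln (real k)" by (simp add: power2_eq_square field_simps)
      also have "\<dots> \<le> 1 * ln (real k)" using k(2) by (intro mult_right_mono) auto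
      finally have "P k \<ge> exp (- (ln (real k) + ln 4 / \<eta>)) / 2" by (simp add: P_def)
      then have "2 * exp (ln 4 / \<eta>) * P k \<ge> 2 * exp (ln 4 / \<eta>) * (exp (- (ln (real k) + ln 4 / \<eta>)) / 2)"
        by (intro mult_left_mono) auto
      also have "2 * exp (ln 4 / \<eta>) * (exp (- (ln (real k) + ln 4 / \<eta>)) / 2) = inverse (real k)"
        using k(2) by (simp add: exp_diff exp_minus field_simps)
      finally show "norm (inverse (real (i + k0))) \<le> 2 * exp (ln 4 / \<eta>) * P (i + k0)"
        by (simp add: k_def)
    qed
    then have "summable (\<lambda>n. inverse (real n))" by (simp only: summable_iff_shift[of "\<lambda>n. inverse (real n)" k0])
    then show False using not_summable_harmonic[where ?'a = real] by simp
  qed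
  moreover have "mono (\<lambda>i. N (k0 + i))" using N by (auto simp: mono_def)
  moreover have "P k \<ge> 0" for k by (simp add: P_def)
  ultimately have "AE \<omega> in M. frequently (\<lambda>i. G i \<omega> > 0) sequentially"
    using G(1) by (intro infinitely_often_pos[where N = "\<lambda>i. N (k0 + i)" and P = "\<lambda>i. P (k0 + i)"] G(2,3) GE) auto
  \<comment> \<open>The crude bound is enough at the start of a block: \<open>key\<close> already
    subtracts the whole of \<phi> (N k) there.\<close>
  then show ?thesis using q_lim mart_bound_crude
  proof eventually_elim
    case (elim \<omega>)
    obtain J where "\<forall>j\<ge>J. \<bar>q j \<omega> - p\<bar> \<le> r" using eventually_near[OF r(1) elim(2)] by blast
    then have J: "g j \<omega> = 1" if "j \<ge> J" for j using that by (simp add: g_def)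
    have NT: "filterlim N at_top sequentially" unfolding N_def by (rule hit_at_top[OF \<rho>1])
    have "eventually (\<lambda>k. \<bar>mart (N k) \<omega>\<bar> \<le> \<phi> (N k)) sequentially"
      using eventually_compose_filterlim[OF elim(3) NT] .
    moreover have "eventually (\<lambda>k. N k \<ge> J) sequentially" using NT unfolding filterlim_at_top by blast
    ultimately have good: "eventually (\<lambda>k. \<bar>mart (N k) \<omega>\<bar> \<le> \<phi> (N k) \<and> N k \<ge> J
        \<and> (1 - \<eta>) * s\<^sup>2 * \<mu> k * B k - ln 4 / (\<eta> * \<mu> k) - \<phi> (N k) \<ge> (1 - \<delta>) * s * \<phi> (N (Suc k))) sequentially"
      using key by eventually_elim auto
    show ?case
      unfolding frequently_sequentially
    proof
      fix n0
      have *: "eventually (\<lambda>k. N k \<ge> n0) sequentially" using NT unfolding filterlim_at_top by blast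
      then obtain K where K: "\<And>k. k \<ge> K \<Longrightarrow> \<bar>mart (N k) \<omega>\<bar> \<le> \<phi> (N k)" "\<And>k. k \<ge> K \<Longrightarrow> N k \<ge> J"
        "\<And>k. k \<ge> K \<Longrightarrow> (1 - \<eta>) * s\<^sup>2 * \<mu> k * B k - ln 4 / (\<eta> * \<mu> k) - \<phi> (N k) \<ge> (1 - \<delta>) * s * \<phi> (N (Suc k))"
        "\<And>k. k \<ge> K \<Longrightarrow> N k \<ge> n0"
        using eventually_conj[OF good *] unfolding eventually_sequentially by blast
      obtain i where i: "i \<ge> K" "G i \<omega> > 0" using elim(1) unfolding frequently_sequentially by blast
      define k where "k = k0 + i"
      have k: "k \<ge> K" using i by (simp add: k_def)
      have "(\<Sum>j=N k..<N (Suc k). w j * \<xi> j \<omega>) \<ge> (1 - \<eta>) * s\<^sup>2 * \<mu> k * B k - ln 4 / (\<eta> * \<mu> k)"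
        unfolding k_def by (rule Gpos[OF i(2)]) (use J K(2)[OF k] in \<open>auto simp: k_def\<close>)
      moreover have "mart (N (Suc k)) \<omega> = mart (N k) \<omega> + (\<Sum>j=N k..<N (Suc k). w j * \<xi> j \<omega>)"
        using sum.atLeastLessThan_concat[of 0 "N k" "N (Suc k)" "\<lambda>j. w j * \<xi> j \<omega>"] NM[of k]
        by (simp add: mart_def atLeast0LessThan)
      ultimately have "mart (N (Suc k)) \<omega> \<ge> (1 - \<delta>) * s * \<phi> (N (Suc k))"
        using K(1,3)[OF k] by (simp add: abs_le_iff)
      moreover have "N (Suc k) \<ge> n0" using K(4)[of "Suc k"] k by simp
      ultimately show "\<exists>n\<ge>n0. (1 - \<delta>) * s * \<phi> n \<le> mart n \<omega>" by blast
    qed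
  qed
qed

end

section \<open>Martingales controlled by their sums of squared coefficients\<close>

context bernoulli_draws
begin

text \<open>Ville's inequality for the tilt 8 * \<theta> * H: Hoeffding's bound gives the
  compensator 8 * \<theta>^2 * H^2, and division by 8 * \<theta> leaves \<theta> * H^2. The levels
  0, 1, 2, ... have summable probabilities, so almost surely some level is never reached and serves
  as the constant.\<close>

lemma martingale_le_quadratic:
  assumes H: "predictable H" and \<theta>: "\<theta> > 0"
  shows "AE \<omega> in M. \<exists>C. \<forall>n. (\<Sum>j<n. H j \<omega> * \<xi> j \<omega>) \<le> C + \<theta> * (\<Sum>j<n. (H j \<omega>)\<^sup>2)"
proof -
  define K where "K j \<omega> = 8 * \<theta> * H j \<omega>" for j \<omega>
  have K: "predictable K"
    unfolding predictable_def
  proof (intro allI conjI)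
    fix j
    have [measurable]: "H j \<in> borel_measurable (F j)" using H predictableD by blast
    show "K j \<in> borel_measurable (F j)" unfolding K_def by measurable
    obtain B where B: "\<And>\<omega>. \<bar>H j \<omega>\<bar> \<le> B" using predictable_bound[OF H, of j] by metis
    have "\<bar>K j \<omega>\<bar> \<le> 8 * \<theta> * B" for \<omega> using B \<theta> by (simp add: K_def abs_mult)
    then show "\<exists>B. \<forall>\<omega>. \<bar>K j \<omega>\<bar> \<le> B" by blast
  qed
  define A where "A i = {\<omega> \<in> space M. \<exists>n. loglik K 0 n \<omega> \<ge> real i}" for i :: nat
  have [measurable]: "loglik K 0 n \<in> borel_measurable M" for n
    using loglik_meas[OF K order_refl] measurable_F_M by blast
  have AM: "A i \<in> events" for i unfolding A_def by measurable
  have "prob (A i) \<le> exp (- 1) ^ i" for i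
    using Ville[OF K, of "real i"] by (simp add: A_def exp_of_nat_mult[symmetric])
  then have "summable (\<lambda>i. prob (A i))"
    by (intro summable_comparison_test'[OF summable_geometric[of "exp (- 1) :: real"], of 0]) auto
  then have "AE \<omega> in M. eventually (\<lambda>i. \<omega> \<in> space M - A i) sequentially"
    using AM by (intro borel_cantelli_AE1) (auto simp: emeasure_eq_measure)
  then show ?thesis
  proof eventually_elim
    case (elim \<omega>)
    then obtain i where i: "\<omega> \<in> space M - A i" unfolding eventually_sequentially by blast
    have "(\<Sum>j<n. H j \<omega> * \<xi> j \<omega>) \<le> real i / (8 * \<theta>) + \<theta> * (\<Sum>j<n. (H j \<omega>)\<^sup>2)" for n
    proof -
      have "loglik K 0 n \<omega> < real i" using i by (auto simp: A_def not_le)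
      moreover have "loglik K 0 n \<omega> \<ge> (\<Sum>j<n. 8 * \<theta> * (H j \<omega> * \<xi> j \<omega>) - 8 * \<theta> * (\<theta> * (H j \<omega>)\<^sup>2))"
        unfolding loglik_def atLeast0LessThan
      proof (rule sum_mono)
        fix j
        have "cgf (q j \<omega>) (K j \<omega>) \<le> (K j \<omega>)\<^sup>2 / 8" by (rule cgf_le_Hoeffding[OF q_range])
        then show "8 * \<theta> * (H j \<omega> * \<xi> j \<omega>) - 8 * \<theta> * (\<theta> * (H j \<omega>)\<^sup>2)
            \<le> K j \<omega> * \<xi> j \<omega> - cgf (q j \<omega>) (K j \<omega>)"
          by (simp add: K_def power2_eq_square mult.assoc)
      qed
      ultimately have "8 * \<theta> * (\<Sum>j<n. H j \<omega> * \<xi> j \<omega>) \<le> real i + 8 * \<theta> * (\<theta> * (\<Sum>j<n. (H j \<omega>)\<^sup>2))"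
        by (simp add: sum_subtractf sum_distrib_left)
      then have "(8 * \<theta>) * (\<Sum>j<n. H j \<omega> * \<xi> j \<omega>) \<le> (8 * \<theta>) * (real i / (8 * \<theta>) + \<theta> * (\<Sum>j<n. (H j \<omega>)\<^sup>2))"
        using \<theta> by (simp add: distrib_left)
      then show ?thesis by (rule mult_left_le_imp_le) (use \<theta> in simp)
    qed
    then show ?case by blast
  qed
qed

lemma martingale_bounded_by_quadratic:
  assumes H: "predictable H" and \<theta>: "\<theta> > 0"
  shows "AE \<omega> in M. \<exists>C. \<forall>n. \<bar>\<Sum>j<n. H j \<omega> * \<xi> j \<omega>\<bar> \<le> C + \<theta> * (\<Sum>j<n. (H j \<omega>)\<^sup>2)"
proof -
  have "predictable (\<lambda>j \<omega>. - H j \<omega>)" using H unfolding predictable_def by auto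
  from martingale_le_quadratic[OF H \<theta>] martingale_le_quadratic[OF this \<theta>] show ?thesis
  proof eventually_elim
    case (elim \<omega>)
    then obtain C C' where C: "\<And>n. (\<Sum>j<n. H j \<omega> * \<xi> j \<omega>) \<le> C + \<theta> * (\<Sum>j<n. (H j \<omega>)\<^sup>2)"
      "\<And>n. - (\<Sum>j<n. H j \<omega> * \<xi> j \<omega>) \<le> C' + \<theta> * (\<Sum>j<n. (H j \<omega>)\<^sup>2)"
      by (auto simp: sum_negf)
    have "\<bar>\<Sum>j<n. H j \<omega> * \<xi> j \<omega>\<bar> \<le> max C C' + \<theta> * (\<Sum>j<n. (H j \<omega>)\<^sup>2)" for n
      using C[of n] by (auto simp: abs_le_iff)
    then show ?case by blast
  qed
qed

end

section \<open>Weighted averages\<close>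

text \<open>The constant collects the finitely many terms with large \<open>x\<close>. An error of
  the form constant plus small multiple can be added to others of this form before any ratio is
  known to be bounded.\<close>

lemma weighted_sum_negligible:
  fixes a x :: "nat \<Rightarrow> real"
  assumes a: "\<And>n. a n \<ge> 0" and x: "x \<longlonglongrightarrow> 0" and \<epsilon>: "\<epsilon> > 0"
  shows "\<exists>C. \<forall>n. \<bar>\<Sum>j<n. a j * x j\<bar> \<le> C + \<epsilon> * (\<Sum>j<n. a j)"
proof -
  obtain J where J: "\<forall>j\<ge>J. \<bar>x j\<bar> < \<epsilon>" using LIMSEQ_D[OF x \<epsilon>] by auto
  have "\<bar>\<Sum>j<n. a j * x j\<bar> \<le> (\<Sum>j<J. a j * \<bar>x j\<bar>) + \<epsilon> * (\<Sum>j<n. a j)" for n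
  proof -
    have "\<bar>\<Sum>j<n. a j * x j\<bar> \<le> (\<Sum>j<n. a j * \<bar>x j\<bar>)"
      using a by (intro order_trans[OF sum_abs] sum_mono) (simp add: abs_mult)
    also have "\<dots> \<le> (\<Sum>j<n. (if j < J then a j * \<bar>x j\<bar> else 0) + \<epsilon> * a j)"
    proof (rule sum_mono)
      fix j
      show "a j * \<bar>x j\<bar> \<le> (if j < J then a j * \<bar>x j\<bar> else 0) + \<epsilon> * a j"
        using J a[of j] \<epsilon> mult_left_mono[of "\<bar>x j\<bar>" \<epsilon> "a j"] by (cases "j < J") (auto simp: mult.commute less_imp_le)
    qed
    also have "\<dots> = (\<Sum>j<n. if j < J then a j * \<bar>x j\<bar> else 0) + \<epsilon> * (\<Sum>j<n. a j)"
      by (simp add: sum.distrib sum_distrib_left)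
    also have "(\<Sum>j<n. if j < J then a j * \<bar>x j\<bar> else 0) \<le> (\<Sum>j<max n J. if j < J then a j * \<bar>x j\<bar> else 0)"
      using a by (intro sum_mono2) auto
    also have "\<dots> = (\<Sum>j<J. a j * \<bar>x j\<bar>)"
      by (rule sum.mono_neutral_cong_right) auto
    finally show ?thesis by simp
  qed
  then show ?thesis by blast
qed

lemma toeplitz_average:
  fixes a x :: "nat \<Rightarrow> real"
  assumes a: "\<And>n. a n \<ge> 0" and A: "filterlim (\<lambda>n. \<Sum>j<n. a j) at_top sequentially"
    and x: "x \<longlonglongrightarrow> L"
  shows "(\<lambda>n. (\<Sum>j<n. a j * x j) / (\<Sum>j<n. a j)) \<longlonglongrightarrow> L"
proof (rule LIMSEQ_I)
  fix \<epsilon> :: real assume \<epsilon>: "\<epsilon> > 0"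
  have "(\<lambda>n. x n - L) \<longlonglongrightarrow> 0" using x by (simp add: LIM_zero_iff)
  from weighted_sum_negligible[where a = a, OF a this, of "\<epsilon> / 2"] \<epsilon>
  obtain C where C: "\<And>n. \<bar>\<Sum>j<n. a j * (x j - L)\<bar> \<le> C + \<epsilon> / 2 * (\<Sum>j<n. a j)" by auto
  have "eventually (\<lambda>n. (\<Sum>j<n. a j) > max 0 (2 * C / \<epsilon>)) sequentially"
    using A unfolding filterlim_at_top_dense by blast
  then obtain n0 where n0: "\<And>n. n \<ge> n0 \<Longrightarrow> (\<Sum>j<n. a j) > max 0 (2 * C / \<epsilon>)"
    unfolding eventually_sequentially by blast
  show "\<exists>no. \<forall>n\<ge>no. norm ((\<Sum>j<n. a j * x j) / (\<Sum>j<n. a j) - L) < \<epsilon>"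
  proof (intro exI[of _ n0] allI impI)
    fix n assume n: "n \<ge> n0"
    define A' where "A' = (\<Sum>j<n. a j)"
    have A': "A' > 0" "2 * C / \<epsilon> < A'" using n0[OF n] by (auto simp: A'_def)
    have "(\<Sum>j<n. a j * (x j - L)) = (\<Sum>j<n. a j * x j) - A' * L"
      by (simp add: A'_def right_diff_distrib sum_subtractf sum_distrib_right)
    then have "(\<Sum>j<n. a j * x j) / A' - L = (\<Sum>j<n. a j * (x j - L)) / A'"
      using A' by (simp add: diff_divide_distrib)
    also have "\<bar>\<dots>\<bar> \<le> (C + \<epsilon> / 2 * A') / A'"
      using A' C[of n] by (simp add: A'_def divide_right_mono)
    also have "\<dots> < \<epsilon>" using A' \<epsilon> by (simp add: field_simps)
    finally show "norm ((\<Sum>j<n. a j * x j) / (\<Sum>j<n. a j) - L) < \<epsilon>" by (simp add: A'_def)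
  qed
qed

lemma sum_inverse_Suc_at_top: "filterlim (\<lambda>n. \<Sum>j<n. 1 / real (Suc j)) at_top sequentially"
  and sum_inverse_Suc_asymp: "(\<lambda>n. (\<Sum>j<n. 1 / real (Suc j)) / ln (real n)) \<longlonglongrightarrow> 1"
proof -
  have h: "(\<Sum>j<n. 1 / real (Suc j)) = harm n" for n
    unfolding harm_def
    by (rule sum.reindex_bij_witness[of _ "\<lambda>i. i - 1" Suc]) (auto simp: field_simps)
  show "filterlim (\<lambda>n. \<Sum>j<n. 1 / real (Suc j)) at_top sequentially"
    unfolding h by (rule harm_at_top)
  have l: "filterlim (\<lambda>n. ln (real n)) at_top sequentially" by real_asymp
  have "(\<lambda>n. (harm n - ln (real n)) / ln (real n)) \<longlonglongrightarrow> 0"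
    by (rule tendsto_divide_0[OF euler_mascheroni_LIMSEQ filterlim_at_top_imp_at_infinity[OF l]])
  then have "(\<lambda>n. (harm n - ln (real n)) / ln (real n) + 1) \<longlonglongrightarrow> 0 + 1" by (intro tendsto_intros)
  moreover have "eventually (\<lambda>n. (harm n - ln (real n)) / ln (real n) + 1 = harm n / ln (real n)) sequentially"
    using eventually_gt_at_top[of 1] by eventually_elim (auto simp: field_simps)
  ultimately show "(\<lambda>n. (\<Sum>j<n. 1 / real (Suc j)) / ln (real n)) \<longlonglongrightarrow> 1"
    unfolding h by (auto elim: Lim_transform_eventually)
qed

lemma log_average:
  fixes x :: "nat \<Rightarrow> real"
  assumes "x \<longlonglongrightarrow> L"
  shows "(\<lambda>n. (\<Sum>j<n. x j / real (Suc j)) / ln (real n)) \<longlonglongrightarrow> L"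
proof -
  have "(\<lambda>n. (\<Sum>j<n. 1 / real (Suc j) * x j) / (\<Sum>j<n. 1 / real (Suc j))
      * ((\<Sum>j<n. 1 / real (Suc j)) / ln (real n))) \<longlonglongrightarrow> L * 1"
    by (intro tendsto_mult toeplitz_average sum_inverse_Suc_at_top sum_inverse_Suc_asymp assms) simp
  moreover have "eventually (\<lambda>n. (\<Sum>j<n. 1 / real (Suc j) * x j) / (\<Sum>j<n. 1 / real (Suc j))
      * ((\<Sum>j<n. 1 / real (Suc j)) / ln (real n)) = (\<Sum>j<n. x j / real (Suc j)) / ln (real n)) sequentially"
    using eventually_gt_at_top[of 0]
  proof eventually_elim
    case (elim n)
    then have "(\<Sum>j<n. 1 / real (Suc j)) > 0" by (intro sum_pos) auto
    then show ?case by simp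
  qed
  ultimately show ?thesis by (auto elim: Lim_transform_eventually)
qed

section \<open>Asymptotics of the weights\<close>

text \<open>The factor \<open>growth 0\<close> can be zero or negative when \<open>m < 0\<close>, so \<open>\<pi>\<close> starts with \<open>growth 1\<close>.\<close>

locale urn_weights =
  fixes m S \<tau> :: real
  assumes S: "S > 0" and \<tau>: "\<tau> > 0" and m: "m \<ge> - S" and small: "m / S < 1 / 2"
begin

definition growth :: "nat \<Rightarrow> real" where
  "growth n = 1 + m / (\<tau> + real n * S)"

definition \<pi> :: "nat \<Rightarrow> real" where
  "\<pi> n = (\<Prod>k=1..<n. growth k)"

definition w :: "nat \<Rightarrow> real" where
  "w n = 1 / \<pi> (Suc n)"

definition V :: "nat \<Rightarrow> real" where
  "V n = (\<Sum>j<n. (w j)\<^sup>2)"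

text \<open>The quantity with which \<open>V\<close> is compared. It telescopes into the squared
  weights times factors with limit 1 - 2 * (m / S), so the limit of \<open>D n / V n\<close> is a
  weighted average of these factors.\<close>

definition D :: "nat \<Rightarrow> real" where
  "D n = real n / (\<pi> n)\<^sup>2"

lemma growth_pos: "n \<ge> 1 \<Longrightarrow> growth n > 0"
proof -
  assume n: "n \<ge> 1"
  then have "1 * S \<le> real n * S" using S by (intro mult_right_mono) auto
  then have "- m < \<tau> + real n * S" "0 < \<tau> + real n * S" using \<tau> m S by linarith+
  then show ?thesis by (simp add: growth_def field_simps)
qed

lemma \<pi>_pos: "\<pi> n > 0"
  unfolding \<pi>_def by (intro prod_pos) (auto intro: growth_pos)

lemma \<pi>_Suc: "n \<ge> 1 \<Longrightarrow> \<pi> (Suc n) = \<pi> n * growth n"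
  by (simp add: \<pi>_def)

lemma D_Suc: "D (Suc n) = D n + (w n)\<^sup>2 * (real n + 1 - real n * (growth n)\<^sup>2)"
proof (cases "n = 0")
  case False
  then have "\<pi> (Suc n) = \<pi> n * growth n" "growth n > 0" using growth_pos[of n] \<pi>_Suc[of n] by auto
  then show ?thesis using \<pi>_pos[of n] by (simp add: D_def w_def power_mult_distrib field_simps)
qed (simp add: D_def w_def power_divide)

lemma D_eq: "D n = (\<Sum>j<n. (w j)\<^sup>2 * (real j + 1 - real j * (growth j)\<^sup>2))"
  by (induction n) (simp_all add: D_Suc, simp add: D_def)

lemma drift_limit: "(\<lambda>n. real n + 1 - real n * (growth n)\<^sup>2) \<longlonglongrightarrow> 1 - 2 * (m / S)"
proof -
  have a: "(\<lambda>n. real n / (\<tau> + real n * S)) \<longlonglongrightarrow> 1 / S" using S by (real_asymp simp: field_simps)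
  have b: "(\<lambda>n. 1 / (\<tau> + real n * S)) \<longlonglongrightarrow> 0" using S by real_asymp
  have "(\<lambda>n. 1 - 2 * m * (real n / (\<tau> + real n * S)) - m\<^sup>2 * (real n / (\<tau> + real n * S)) * (1 / (\<tau> + real n * S)))
     \<longlonglongrightarrow> 1 - 2 * m * (1 / S) - m\<^sup>2 * (1 / S) * 0"
    by (intro tendsto_intros a b)
  moreover have "1 - 2 * m * (real n / (\<tau> + real n * S)) - m\<^sup>2 * (real n / (\<tau> + real n * S)) * (1 / (\<tau> + real n * S))
     = real n + 1 - real n * (growth n)\<^sup>2" for n
    unfolding growth_def by (simp add: power2_eq_square algebra_simps)
  moreover have "1 - 2 * m * (1 / S) - m\<^sup>2 * (1 / S) * 0 = 1 - 2 * (m / S)" by simp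
  ultimately show ?thesis by (simp only:)
qed

text \<open>The increments of ln (D n) are x_j / (j + 1) with x_j tending to 1 - 2 * (m / S), and
  these have a logarithmic average. This order of magnitude gives the divergence of \<open>D\<close>
  and the size of ln (V n).\<close>

lemma ln_D_asymp: "(\<lambda>n. ln (D n) / ln (real n)) \<longlonglongrightarrow> 1 - 2 * (m / S)"
proof -
  \<comment> \<open>Since D 1 = 1 has logarithm 0, the telescoping starts at j = 1 and the entry at
    j = 0 is set to 0.\<close>
  define x where "x j = (if j = 0 then 0 else real (Suc j) * (ln (1 + 1 / real j) - 2 * ln (growth j)))" for j
  have g0: "(\<lambda>n. m / (\<tau> + real n * S)) \<longlonglongrightarrow> 0" using S by real_asymp
  have g1: "(\<lambda>n. real (Suc n) * (m / (\<tau> + real n * S))) \<longlonglongrightarrow> m / S"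
  proof -
    have "(\<lambda>n. real (Suc n) / (\<tau> + real n * S)) \<longlonglongrightarrow> 1 / S" using S by (real_asymp simp: field_simps)
    from tendsto_mult_left[OF this, of m] show ?thesis by (simp add: field_simps)
  qed
  have g2: "(\<lambda>n. real (Suc n) * ln (growth n)) \<longlonglongrightarrow> m / S"
  proof -
    \<comment> \<open>The quotient is completed by its limit 1 at y = 0 because m = 0 is possible,
      and then the argument is identically 0.\<close>
    have d: "((\<lambda>y. if y = 0 then 1 else ln (1 + y) / y) \<longlongrightarrow> (1::real)) (nhds 0)"
    proof -
      have "((\<lambda>y::real. ln (1 + y) / y) \<longlongrightarrow> 1) (at 0)" by real_asymp
      then have "((\<lambda>y::real. if y = 0 then 1 else ln (1 + y) / y) \<longlongrightarrow> 1) (at 0)"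
        by (rule Lim_transform_eventually) (auto simp: eventually_at_filter)
      then show ?thesis unfolding tendsto_nhds_iff by simp
    qed
    have "(\<lambda>n. real (Suc n) * (m / (\<tau> + real n * S)) *
        (if m / (\<tau> + real n * S) = 0 then 1 else ln (1 + m / (\<tau> + real n * S)) / (m / (\<tau> + real n * S)))) \<longlonglongrightarrow> m / S * 1"
      by (intro tendsto_mult g1 filterlim_compose[OF d g0])
    moreover have "real (Suc n) * (m / (\<tau> + real n * S)) *
        (if m / (\<tau> + real n * S) = 0 then 1 else ln (1 + m / (\<tau> + real n * S)) / (m / (\<tau> + real n * S)))
       = real (Suc n) * ln (growth n)" for n
      by (simp add: growth_def)
    ultimately show ?thesis by simp
  qed
  have "(\<lambda>j. real (Suc j) * ln (1 + 1 / real j)) \<longlonglongrightarrow> 1" by real_asymp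
  then have "(\<lambda>j. real (Suc j) * ln (1 + 1 / real j) - 2 * (real (Suc j) * ln (growth j))) \<longlonglongrightarrow> 1 - 2 * (m / S)"
    by (intro tendsto_intros g2)
  moreover have "eventually (\<lambda>j. real (Suc j) * ln (1 + 1 / real j) - 2 * (real (Suc j) * ln (growth j)) = x j) sequentially"
    using eventually_gt_at_top[of 0] by eventually_elim (simp add: x_def algebra_simps)
  ultimately have "x \<longlonglongrightarrow> 1 - 2 * (m / S)" by (rule Lim_transform_eventually)
  from log_average[OF this] have lim: "(\<lambda>n. (\<Sum>j<n. x j / real (Suc j)) / ln (real n)) \<longlonglongrightarrow> 1 - 2 * (m / S)" .
  have "(\<Sum>j<n. x j / real (Suc j)) = ln (D n)" if "n \<ge> 1" for n
    using that
  proof (induction n rule: dec_induct)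
    case base
    then show ?case by (simp add: x_def D_def \<pi>_def)
  next
    case (step n)
    have gp: "growth n > 0" using step growth_pos by auto
    have "D (Suc n) = D n * ((1 + 1 / real n) / (growth n)\<^sup>2)"
      using step(1) gp \<pi>_pos[of n] by (simp add: D_def \<pi>_Suc power_mult_distrib field_simps)
    moreover have "D n > 0" using step(1) \<pi>_pos[of n] by (simp add: D_def)
    ultimately have "ln (D (Suc n)) = ln (D n) + (ln (1 + 1 / real n) - 2 * ln (growth n))"
    proof -
      have "1 + 1 / real n > 0" by (simp add: add_pos_nonneg)
      then show ?thesis
        using gp \<open>D n > 0\<close> by (simp only: \<open>D (Suc n) = _\<close>) (subst ln_mult_pos, auto simp: ln_div ln_realpow)
    qed
    moreover have "x n / real (Suc n) = ln (1 + 1 / real n) - 2 * ln (growth n)"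
      using step(1) by (simp add: x_def)
    ultimately show ?case using step(3) by simp
  qed
  then have sum_eq: "n \<ge> 1 \<Longrightarrow> (\<Sum>j<n. x j / real (Suc j)) = ln (D n)" for n by blast
  have "eventually (\<lambda>n. (\<Sum>j<n. x j / real (Suc j)) / ln (real n) = ln (D n) / ln (real n)) sequentially"
    using eventually_ge_at_top[of 1] by eventually_elim (simp only: sum_eq)
  then show ?thesis using lim by (rule Lim_transform_eventually[rotated])
qed

lemma drift_pos: "1 - 2 * (m / S) > 0"
  using small by (simp add: mult.commute)

lemma D_at_top: "filterlim D at_top sequentially"
proof -
  have "filterlim (\<lambda>n. ln (D n) / ln (real n) * ln (real n)) at_top sequentially"
    by (rule filterlim_tendsto_pos_mult_at_top[OF ln_D_asymp drift_pos]) real_asymp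
  then have "filterlim (\<lambda>n. exp (ln (D n) / ln (real n) * ln (real n))) at_top sequentially"
    by (rule filterlim_compose[OF exp_at_top])
  moreover have "eventually (\<lambda>n. exp (ln (D n) / ln (real n) * ln (real n)) = D n) sequentially"
    using eventually_gt_at_top[of 1]
  proof eventually_elim
    case (elim n)
    then have "D n > 0" using \<pi>_pos[of n] by (simp add: D_def)
    then show ?case using elim by simp
  qed
  ultimately show ?thesis using filterlim_cong[OF refl refl] by fast
qed

text \<open>The factors in \<open>D_eq\<close> are bounded, so \<open>D\<close> is at most a
  multiple of \<open>V\<close>. This divergence has to precede the averaging in
  \<open>D_V_limit\<close>, which relies on it.\<close>

lemma V_at_top: "filterlim V at_top sequentially"
proof -
  obtain K where K: "K > 0" "\<And>n. norm (real n + 1 - real n * (growth n)\<^sup>2) \<le> K"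
    using convergent_imp_Bseq[OF convergentI[OF drift_limit]] by (auto simp: Bseq_def)
  have "D n \<le> K * V n" for n
    unfolding D_eq V_def sum_distrib_left
  proof (rule sum_mono)
    fix j
    have "real j + 1 - real j * (growth j)\<^sup>2 \<le> K" using K(2)[of j] by (simp add: abs_le_iff)
    then have "(w j)\<^sup>2 * (real j + 1 - real j * (growth j)\<^sup>2) \<le> (w j)\<^sup>2 * K" by (intro mult_left_mono) auto
    then show "(w j)\<^sup>2 * (real j + 1 - real j * (growth j)\<^sup>2) \<le> K * (w j)\<^sup>2" by (simp only: mult.commute)
  qed
  then have "D n / K \<le> V n" for n using K(1) by (simp add: divide_le_eq mult.commute)
  moreover have "filterlim (\<lambda>n. D n / K) at_top sequentially"
    using filterlim_tendsto_pos_mult_at_top[OF tendsto_const, of "1 / K", OF _ D_at_top] K(1) by simp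
  ultimately show ?thesis using filterlim_at_top_mono by (metis (mono_tags, lifting) always_eventually)
qed

lemma D_V_limit: "(\<lambda>n. D n / V n) \<longlonglongrightarrow> 1 - 2 * (m / S)"
  unfolding D_eq V_def
  by (rule toeplitz_average[OF _ _ drift_limit]) (use V_at_top in \<open>simp_all add: V_def[abs_def]\<close>)

lemma V_limit: "(\<lambda>n. V n * (\<pi> n)\<^sup>2 / real n) \<longlonglongrightarrow> 1 / (1 - 2 * (m / S))"
proof -
  have "(\<lambda>n. inverse (D n / V n)) \<longlonglongrightarrow> inverse (1 - 2 * (m / S))"
    using drift_pos by (intro tendsto_inverse D_V_limit) linarith
  then show ?thesis by (simp add: D_def field_simps)
qed

lemma ln_V_asymp: "(\<lambda>n. ln (V n) / ln (real n)) \<longlonglongrightarrow> 1 - 2 * (m / S)"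
proof -
  have l: "filterlim (\<lambda>n. ln (real n)) at_top sequentially" by real_asymp
  have "(\<lambda>n. ln (D n / V n)) \<longlonglongrightarrow> ln (1 - 2 * (m / S))" using drift_pos by (intro tendsto_ln D_V_limit) linarith
  from tendsto_divide_0[OF this filterlim_at_top_imp_at_infinity[OF l]]
  have "(\<lambda>n. ln (D n) / ln (real n) - ln (D n / V n) / ln (real n)) \<longlonglongrightarrow> 1 - 2 * (m / S) - 0"
    by (intro tendsto_diff ln_D_asymp)
  moreover have "eventually (\<lambda>n. V n > 0) sequentially" "eventually (\<lambda>n. D n > 0) sequentially"
    using V_at_top D_at_top unfolding filterlim_at_top_dense by blast+
  then have "eventually (\<lambda>n. ln (D n) / ln (real n) - ln (D n / V n) / ln (real n) = ln (V n) / ln (real n)) sequentially"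
    by eventually_elim (simp add: ln_div diff_divide_distrib)
  ultimately show ?thesis by (auto elim: Lim_transform_eventually)
qed

text \<open>The ratio ln (V n) / ln n has a positive limit. Its logarithm converges and disappears
  on division by ln (ln n).\<close>

lemma ln_ln_V_asymp: "(\<lambda>n. ln (ln (V n)) / ln (ln (real n))) \<longlonglongrightarrow> 1"
proof -
  have l: "filterlim (\<lambda>n. ln (ln (real n))) at_top sequentially" by real_asymp
  have "(\<lambda>n. ln (ln (V n) / ln (real n))) \<longlonglongrightarrow> ln (1 - 2 * (m / S))"
    using drift_pos by (intro tendsto_ln ln_V_asymp) linarith
  from tendsto_divide_0[OF this filterlim_at_top_imp_at_infinity[OF l]]
  have lim: "(\<lambda>n. 1 + ln (ln (V n) / ln (real n)) / ln (ln (real n))) \<longlonglongrightarrow> 1 + 0"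
    by (intro tendsto_add tendsto_const)
  have "eventually (\<lambda>n. V n > 1) sequentially"
    using V_at_top unfolding filterlim_at_top_dense by blast
  moreover have "eventually (\<lambda>n. ln (real n) > 0) sequentially" "eventually (\<lambda>n. ln (ln (real n)) > 0) sequentially"
    by real_asymp+
  ultimately have "eventually (\<lambda>n. 1 + ln (ln (V n) / ln (real n)) / ln (ln (real n)) = ln (ln (V n)) / ln (ln (real n))) sequentially"
    by eventually_elim (simp add: ln_div diff_divide_distrib)
  with lim show ?thesis by (auto elim: Lim_transform_eventually)
qed

text \<open>Since w_n^2 = D (n+1) / (n+1), the quotient in question factors into D / V, ln V / ln n
  and ln n / n, all taken at n + 1.\<close>

lemma lil_weights: "lil_weights w V"
proof
  show "V n = (\<Sum>j<n. (w j)\<^sup>2)" for n by (rule V_def)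
  show "filterlim V at_top sequentially" by (rule V_at_top)
  have "(\<lambda>n. ln (real n) / real n) \<longlonglongrightarrow> 0" by real_asymp
  then have "(\<lambda>n. (D n / V n) * (ln (V n) / ln (real n)) * (ln (real n) / real n)) \<longlonglongrightarrow> (1 - 2 * (m / S)) * (1 - 2 * (m / S)) * 0"
    by (intro tendsto_mult D_V_limit ln_V_asymp)
  from LIMSEQ_Suc[OF this]
  have "(\<lambda>n. (D (Suc n) / V (Suc n)) * (ln (V (Suc n)) / ln (real (Suc n))) * (ln (real (Suc n)) / real (Suc n))) \<longlonglongrightarrow> 0" by simp
  moreover have "eventually (\<lambda>n. (D (Suc n) / V (Suc n)) * (ln (V (Suc n)) / ln (real (Suc n))) * (ln (real (Suc n)) / real (Suc n))
     = (w n)\<^sup>2 * ln (V (Suc n)) / V (Suc n)) sequentially"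
    using eventually_gt_at_top[of 0]
  proof eventually_elim
    case (elim n)
    then have "ln (real (Suc n)) \<noteq> 0" by simp
    moreover have "D (Suc n) = (w n)\<^sup>2 * real (Suc n)" by (simp add: D_def w_def power_divide)
    ultimately show ?case by (simp del: of_nat_Suc)
  qed
  ultimately show "(\<lambda>n. (w n)\<^sup>2 * ln (V (Suc n)) / V (Suc n)) \<longlonglongrightarrow> 0" by (rule Lim_transform_eventually)
qed

end

section \<open>Limits of ratios and limits superior\<close>

lemma ratio_limit:
  fixes A H :: "nat \<Rightarrow> real"
  assumes A: "\<And>n. A n \<ge> 0" and H: "eventually (\<lambda>n. H n > 0) sequentially" and c: "c > 0" and L: "L \<ge> 0"
    and dev: "\<And>\<epsilon>. \<epsilon> > 0 \<Longrightarrow> eventually (\<lambda>n. \<bar>c * A n - L * H n\<bar> \<le> \<epsilon> * (A n + H n)) sequentially"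
  shows "(\<lambda>n. A n / H n) \<longlonglongrightarrow> L / c"
proof (rule tendstoI)
  fix \<delta> :: real assume \<delta>: "\<delta> > 0"
  \<comment> \<open>An a priori bound on the ratio: taking \<epsilon> \<le> c / 2 in
    \<open>dev\<close> already shows A n / H n \<le> R. The second entry of the minimum for
    \<epsilon> then makes the error \<epsilon> * (R + 1) small.\<close>
  define R where "R = (L + c / 2) / (c / 2)"
  have R: "R > 0" using c L by (simp add: R_def)
  define \<epsilon> where "\<epsilon> = min (c / 2) (\<delta> * c / (2 * (R + 1)))"
  have \<epsilon>: "\<epsilon> > 0" "\<epsilon> \<le> c / 2" "\<epsilon> * (R + 1) \<le> \<delta> * c / 2"
  proof -
    show "\<epsilon> > 0" using c R \<delta> by (simp add: \<epsilon>_def)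
    show "\<epsilon> \<le> c / 2" unfolding \<epsilon>_def by (rule min.cobounded1)
    have "\<epsilon> * (R + 1) \<le> \<delta> * c / (2 * (R + 1)) * (R + 1)" using R by (intro mult_right_mono) (auto simp: \<epsilon>_def)
    also have "\<delta> * c / (2 * (R + 1)) * (R + 1) = \<delta> * c / 2" using R by (simp add: divide_simps)
    finally show "\<epsilon> * (R + 1) \<le> \<delta> * c / 2" .
  qed
  show "eventually (\<lambda>n. dist (A n / H n) (L / c) < \<delta>) sequentially"
    using dev[OF \<epsilon>(1)] H
  proof eventually_elim
    case (elim n)
    define r where "r = A n / H n"
    have r: "r \<ge> 0" using A[of n] elim(2) by (simp add: r_def)
    have "\<bar>c * r - L\<bar> = \<bar>c * A n - L * H n\<bar> / H n"
    proof -
      have "c * r - L = (c * A n - L * H n) / H n" using elim(2) by (simp add: r_def diff_divide_distrib)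
      then show ?thesis using elim(2) by simp
    qed
    also have "\<dots> \<le> \<epsilon> * (A n + H n) / H n" using elim by (intro divide_right_mono) auto
    also have "\<dots> = \<epsilon> * (r + 1)" using elim(2) by (simp add: r_def field_simps)
    finally have dr: "\<bar>c * r - L\<bar> \<le> \<epsilon> * (r + 1)" .
    have "\<epsilon> * (r + 1) \<le> c / 2 * (r + 1)" using \<epsilon>(2) r by (intro mult_right_mono) auto
    then have "r * (c / 2) \<le> L + c / 2" using dr by (simp add: algebra_simps abs_le_iff)
    then have "r \<le> R" unfolding R_def using c by (subst pos_le_divide_eq) auto
    then have "\<epsilon> * (r + 1) \<le> \<epsilon> * (R + 1)" using \<epsilon>(1) by simp
    then have "\<bar>c * r - L\<bar> \<le> \<delta> * c / 2" using dr \<epsilon>(3) by linarith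
    also have "\<dots> < \<delta> * c" using \<delta> c by simp
    finally have "\<bar>c * r - L\<bar> < \<delta> * c" .
    moreover have "\<bar>c * r - L\<bar> = \<bar>r - L / c\<bar> * c"
    proof -
      have "c * r - L = (r - L / c) * c" using c by (simp add: field_simps)
      then show ?thesis using c by (simp add: abs_mult)
    qed
    ultimately show "dist (A n / H n) (L / c) < \<delta>"
      using c by (simp add: dist_real_def r_def)
  qed
qed

lemma limsup_ereal_eqI:
  fixes f :: "nat \<Rightarrow> real"
  assumes upper: "\<And>\<epsilon>. \<epsilon> > 0 \<Longrightarrow> eventually (\<lambda>n. f n \<le> L + \<epsilon>) sequentially"
    and lower: "\<And>\<epsilon>. \<epsilon> > 0 \<Longrightarrow> frequently (\<lambda>n. f n \<ge> L - \<epsilon>) sequentially"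
  shows "limsup (\<lambda>n. ereal (f n)) = ereal L"
proof (rule antisym)
  show "limsup (\<lambda>n. ereal (f n)) \<le> ereal L"
  proof (rule ereal_le_epsilon2)
    fix \<epsilon> :: real assume "0 < \<epsilon>"
    then show "limsup (\<lambda>n. ereal (f n)) \<le> ereal L + ereal \<epsilon>"
      using upper[of \<epsilon>] by (intro Limsup_bounded) (auto elim: eventually_mono)
  qed
  show "ereal L \<le> limsup (\<lambda>n. ereal (f n))"
  proof (rule ccontr)
    assume "\<not> ?thesis"
    then obtain y where y: "limsup (\<lambda>n. ereal (f n)) < ereal y" "ereal y < ereal L"
      using ereal_dense2 by (metis not_le)
    from Limsup_lessD[OF y(1)] have "eventually (\<lambda>n. ereal (f n) < ereal y) sequentially" .
    moreover have "frequently (\<lambda>n. f n \<ge> L - (L - y)) sequentially" using y by (intro lower) simp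
    ultimately show False by (simp add: frequently_def not_le)
  qed
qed

text \<open>As only the limit superior of \<open>z\<close> is known, \<open>c n\<close> is first
  replaced by its limit; the difference (c n - c0) * z n tends to 0 because \<open>z\<close> is
  bounded.\<close>

lemma limsup_ereal_affine:
  fixes c z r :: "nat \<Rightarrow> real"
  assumes z: "limsup (\<lambda>n. ereal (z n)) = ereal L" "eventually (\<lambda>n. \<bar>z n\<bar> \<le> B) sequentially"
    and c: "c \<longlonglongrightarrow> c0" "c0 \<ge> 0" and r: "r \<longlonglongrightarrow> 0"
  shows "limsup (\<lambda>n. ereal (c n * z n + r n)) = ereal (c0 * L)"
proof -
  have "(\<lambda>n. (c n - c0) * z n) \<longlonglongrightarrow> 0"
  proof (rule Lim_null_comparison)
    show "eventually (\<lambda>n. norm ((c n - c0) * z n) \<le> \<bar>c n - c0\<bar> * B) sequentially"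
      using z(2) by eventually_elim (simp add: abs_mult mult_left_mono)
    have "(\<lambda>n. \<bar>c n - c0\<bar> * B) \<longlonglongrightarrow> \<bar>c0 - c0\<bar> * B" by (intro tendsto_intros c)
    then show "(\<lambda>n. \<bar>c n - c0\<bar> * B) \<longlonglongrightarrow> 0" by simp
  qed
  from tendsto_add[OF this r] have e: "(\<lambda>n. (c n - c0) * z n + r n) \<longlonglongrightarrow> 0" by simp
  have "limsup (\<lambda>n. ereal ((c n - c0) * z n + r n) + ereal (c0 * z n)) = 0 + limsup (\<lambda>n. ereal (c0 * z n))"
    using e by (intro ereal_limsup_lim_add) (auto simp: zero_ereal_def)
  moreover have "limsup (\<lambda>n. ereal (c0 * z n)) = ereal (c0 * L)"
  proof (cases "c0 = 0")
    case False
    have "limsup (\<lambda>n. ereal c0 * ereal (z n)) = ereal c0 * limsup (\<lambda>n. ereal (z n))"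
      using False c(2) by (intro ereal_limsup_lim_mult) auto
    then show ?thesis by (simp add: z(1))
  qed (simp add: Limsup_const zero_ereal_def)
  ultimately show ?thesis by (simp add: algebra_simps)
qed

section \<open>The urn\<close>

context balanced_polya_urn
begin

text \<open>Shifted by one: the ball drawn at time n + 1 has index n, as
  \<open>bernoulli_draws\<close> expects.\<close>

definition draw :: "nat \<Rightarrow> 'a \<Rightarrow> real" where
  "draw n \<omega> = of_bool (red (Suc n) \<omega>)"

definition q :: "nat \<Rightarrow> 'a \<Rightarrow> real" where
  "q n \<omega> = U n \<omega> $ 1 / (U n \<omega> $ 1 + U n \<omega> $ 2)"

definition S :: real where "S = real a + real b"

definition m :: real where "m = real a - real c"

definition \<tau> :: real where "\<tau> = real \<alpha> + real \<beta>"

lemma params: "S > 0" "\<tau> > 0" "m \<ge> - S" "S - m = real b + real c" "m = real d - real b"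
proof -
  have b: "real a + real b = real c + real d" using balanced by (metis of_nat_add)
  have pos: "real i + real j > 0" if "i + j \<ge> 1" for i j :: nat
  proof -
    have "real (i + j) > 0" using that by (simp only: of_nat_0_less_iff)
    then show ?thesis by (simp only: of_nat_add)
  qed
  show "S > 0" unfolding S_def by (rule pos[OF balance_pos])
  show "\<tau> > 0" unfolding \<tau>_def by (rule pos[OF nonempty])
  show "m \<ge> - S" using b by (simp add: m_def S_def)
  show "S - m = real b + real c" by (simp add: m_def S_def)
  show "m = real d - real b" using b by (simp add: m_def)
qed

lemma U_0: "U 0 \<omega> $ 1 = real \<alpha>" "U 0 \<omega> $ 2 = real \<beta>"
  by (simp_all add: U_eq vector_2)

lemma U_Suc:
  "U (Suc n) \<omega> $ 1 = U n \<omega> $ 1 + real c + m * draw n \<omega>"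
  "U (Suc n) \<omega> $ 2 = U n \<omega> $ 2 + real d - m * draw n \<omega>"
  using params(5)
  by (simp_all add: U_eq vector_2 replacement_matrix_def matrix_vector_mult_def transpose_def sum_2
      draw_def m_def algebra_simps)

lemma U_total: "U n \<omega> $ 1 + U n \<omega> $ 2 = \<tau> + real n * S"
proof (induction n)
  case (Suc n)
  have "real c + real d = S" using balanced by (metis S_def of_nat_add)
  then show ?case using Suc by (simp add: U_Suc algebra_simps)
qed (simp add: U_0 \<tau>_def)

lemma draw_01: "draw n \<omega> \<in> {0, 1}"
  by (simp add: draw_def)

lemma U_nonneg: "U n \<omega> $ 1 \<ge> 0" "U n \<omega> $ 2 \<ge> 0"
proof (induction n)
  case (Suc n)
  { case 1 show ?case using Suc draw_01[of n \<omega>] by (auto simp: U_Suc m_def) }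
  { case 2 show ?case using Suc draw_01[of n \<omega>] params(5) by (auto simp: U_Suc) }
qed (simp_all add: U_0)

lemma q_eq: "q n \<omega> = U n \<omega> $ 1 / (\<tau> + real n * S)"
  by (simp add: q_def U_total)

lemma total_pos: "\<tau> + real n * S > 0"
  using params by (simp add: add_pos_nonneg)

lemma q_01: "q n \<omega> \<in> {0..1}"
  using U_nonneg[of n \<omega>] U_total[of n \<omega>] total_pos[of n] by (auto simp: q_eq)

lemma draw_measurable: "draw n \<in> borel_measurable (F (Suc n))"
proof -
  have [measurable]: "Measurable.pred (F (Suc n)) (red (Suc n))" by (rule adapted) simp
  show ?thesis unfolding draw_def of_bool_def[abs_def] by measurable
qed

lemma U_measurable: "(\<lambda>\<omega>. U n \<omega> $ 1) \<in> borel_measurable (F n)"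
proof (induction n)
  case (Suc n)
  have "(\<lambda>\<omega>. U n \<omega> $ 1) \<in> borel_measurable (F (Suc n))"
    using Suc sets_F_mono[of n "Suc n"] space_F unfolding measurable_def by auto
  then show ?case unfolding U_Suc using draw_measurable[of n] by measurable
qed (simp add: U_0)

text \<open>The conditional law of a draw is tested against bounded \<open>F n\<close>-measurable
  functions, by the defining property of the conditional expectation.\<close>

lemma bernoulli_draws: "bernoulli_draws M F draw q"
proof
  show "subalgebra M (F n)" for n by (rule subalgebra_F)
  show "draw n \<omega> \<in> {0, 1}" for n \<omega> by (rule draw_01)
  show "draw n \<in> borel_measurable (F (Suc n))" for n by (rule draw_measurable)
  show qm: "q n \<in> borel_measurable (F n)" for n
    unfolding q_eq[abs_def] using U_measurable[of n] by measurable
  show "q n \<omega> \<in> {0..1}" for n \<omega> by (rule q_01)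
  fix n B and f :: "'a \<Rightarrow> real"
  assume f: "f \<in> borel_measurable (F n)" "\<And>\<omega>. \<bar>f \<omega>\<bar> \<le> B"
  interpret G: finite_measure_subalgebra M "F n"
    using subalgebra_F by unfold_locales
  define g where "g = (indicator {\<omega> \<in> space M. red (Suc n) \<omega>} :: 'a \<Rightarrow> real)"
  have dM: "draw n \<in> borel_measurable M"
    using measurable_from_subalg[OF subalgebra_F draw_measurable] .
  \<comment> \<open>The indicator vanishes outside \<open>space M\<close>, where \<open>draw\<close>
    is unconstrained; the two are exchanged on the space only.\<close>
  have gd: "g \<omega> = draw n \<omega>" if "\<omega> \<in> space M" for \<omega>
    using that by (auto simp: g_def draw_def)
  have gM: "g \<in> borel_measurable M"
    using dM gd by (subst measurable_cong[where g = "draw n"]) auto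
  have fM: "f \<in> borel_measurable M" using measurable_from_subalg[OF subalgebra_F f(1)] .
  have "integrable M (\<lambda>\<omega>. f \<omega> * g \<omega>)"
  proof (rule integrable_const_bound[where B = B])
    show "AE \<omega> in M. norm (f \<omega> * g \<omega>) \<le> B"
      using f(2) by (intro AE_I2) (auto simp: g_def indicator_def intro: order_trans[OF abs_ge_zero])
  qed (use fM gM in measurable)
  from G.real_cond_exp_intg(2)[OF this f(1) gM]
  have "expectation (\<lambda>\<omega>. f \<omega> * g \<omega>) = expectation (\<lambda>\<omega>. f \<omega> * real_cond_exp M (F n) g \<omega>)" by simp
  also have "\<dots> = expectation (\<lambda>\<omega>. f \<omega> * q n \<omega>)"
  proof (rule integral_cong_AE)
    show "AE \<omega> in M. f \<omega> * real_cond_exp M (F n) g \<omega> = f \<omega> * q n \<omega>"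
      using uniform_draw[of n] by (auto simp: g_def q_def)
    show "(\<lambda>\<omega>. f \<omega> * q n \<omega>) \<in> borel_measurable M"
      using fM measurable_from_subalg[OF subalgebra_F qm[of n]] by measurable
    show "(\<lambda>\<omega>. f \<omega> * real_cond_exp M (F n) g \<omega>) \<in> borel_measurable M"
      using fM by measurable
  qed
  also have "expectation (\<lambda>\<omega>. f \<omega> * g \<omega>) = expectation (\<lambda>\<omega>. f \<omega> * draw n \<omega>)"
    using gd by (intro Bochner_Integration.integral_cong) auto
  finally show "expectation (\<lambda>\<omega>. f \<omega> * draw n \<omega>) = expectation (\<lambda>\<omega>. f \<omega> * q n \<omega>)" .
qed

end

section \<open>The small urn as a weighted sum of centred draws\<close>

locale small_polya_urn = balanced_polya_urn +
  assumes small: "(real a - real c) / (real a + real b) < 1 / 2"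
    and bc: "b * c \<noteq> 0"
begin

sublocale weights: urn_weights m S \<tau>
  using params small by unfold_locales (auto simp: m_def S_def)

sublocale draws: bernoulli_draws M F draw q
  by (rule bernoulli_draws)

sublocale sums: weighted_bernoulli_sums M F draw q weights.w weights.V
  by (intro weighted_bernoulli_sums.intro bernoulli_draws weights.lil_weights)

definition p :: real where "p = real c / (real b + real c)"

definition Z :: "nat \<Rightarrow> 'a \<Rightarrow> real" where
  "Z n \<omega> = U n \<omega> $ 1 - p * (\<tau> + real n * S)"

lemma bc_pos: "real b > 0" "real c > 0"
  using bc by auto

lemma p: "0 < p" "p < 1" "p * (S - m) = real c" "p * (1 - p) = real b * real c / (real b + real c)\<^sup>2"
proof -
  have bc0: "real b + real c > 0" using bc_pos by simp
  show "0 < p" "p < 1" using bc_pos bc0 by (auto simp: p_def)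
  show "p * (S - m) = real c" unfolding params(4) using bc0 by (simp add: p_def)
  have "1 - p = real b / (real b + real c)" using bc0 by (simp add: p_def field_simps)
  then show "p * (1 - p) = real b * real c / (real b + real c)\<^sup>2"
    by (simp add: p_def power2_eq_square)
qed

lemma q_Z: "q n \<omega> = p + Z n \<omega> / (\<tau> + real n * S)"
  using total_pos[of n] by (simp add: q_eq Z_def diff_divide_distrib)

text \<open>\<open>p\<close> is the equilibrium proportion: p * (S - m) = c cancels the constant
  part of the mean increment, and no inhomogeneous term remains.\<close>

lemma Z_Suc: "Z (Suc n) \<omega> = weights.growth n * Z n \<omega> + m * draws.\<xi> n \<omega>"
proof -
  have "weights.growth n * Z n \<omega> = Z n \<omega> + m * (Z n \<omega> / (\<tau> + real n * S))"
    by (simp add: weights.growth_def algebra_simps)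
  also have "Z n \<omega> / (\<tau> + real n * S) = q n \<omega> - p" by (simp add: q_Z)
  finally have "weights.growth n * Z n \<omega> + m * draws.\<xi> n \<omega> = Z n \<omega> + m * draw n \<omega> - m * p"
    by (simp add: draws.\<xi>_def algebra_simps)
  moreover have "Z (Suc n) \<omega> = Z n \<omega> + (real c - p * S) + m * draw n \<omega>"
    by (simp add: Z_def U_Suc algebra_simps)
  moreover have "real c - p * S = - (m * p)" using p(3) by (simp add: algebra_simps)
  ultimately show ?thesis by simp
qed

text \<open>Variation of constants from time 1 on. The first step stays apart as
  \<open>growth 0 * Z 0\<close>, because \<open>growth 0\<close> can vanish and cannot be divided
  out.\<close>

lemma Z_mart: "n \<ge> 1 \<Longrightarrow> Z n \<omega> = weights.\<pi> n * (weights.growth 0 * Z 0 \<omega> + m * sums.mart n \<omega>)"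
proof (induction n rule: dec_induct)
  case base
  have "weights.\<pi> 1 = 1" "weights.w 0 = 1" by (simp_all add: weights.\<pi>_def weights.w_def)
  then show ?case using Z_Suc[of 0 \<omega>] by (simp add: sums.mart_def)
next
  case (step n)
  have "weights.\<pi> (Suc n) * weights.w n = 1" using weights.\<pi>_pos[of "Suc n"] by (simp add: weights.w_def)
  then have "weights.\<pi> (Suc n) * (weights.growth 0 * Z 0 \<omega> + m * sums.mart (Suc n) \<omega>)
     = weights.\<pi> (Suc n) * (weights.growth 0 * Z 0 \<omega> + m * sums.mart n \<omega>) + m * draws.\<xi> n \<omega>"
    by (simp add: sums.mart_def algebra_simps)
  moreover have "weights.\<pi> (Suc n) = weights.growth n * weights.\<pi> n"
    using step(1) by (simp add: weights.\<pi>_Suc)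
  then have "weights.growth n * Z n \<omega> = weights.\<pi> (Suc n) * (weights.growth 0 * Z 0 \<omega> + m * sums.mart n \<omega>)"
    unfolding step(3) by (simp only: mult.assoc)
  ultimately show ?case unfolding Z_Suc by simp
qed

text \<open>The square of \<open>\<pi> n * \<phi> n\<close> divided by 2 * n * ln (ln n). It
  separates the deterministic norming from the random factor \<open>normalized\<close>.\<close>

definition norming_ratio :: "nat \<Rightarrow> real" where
  "norming_ratio n = weights.V n * (weights.\<pi> n)\<^sup>2 / real n * (ln (ln (weights.V n)) / ln (ln (real n)))"

definition normalized :: "nat \<Rightarrow> 'a \<Rightarrow> real" where
  "normalized n \<omega> = weights.growth 0 * Z 0 \<omega> / sums.\<phi> n + m * (sums.mart n \<omega> / sums.\<phi> n)"

lemma norming_ratio_limit: "norming_ratio \<longlonglongrightarrow> 1 / (1 - 2 * (m / S))"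
  using tendsto_mult[OF weights.V_limit weights.ln_ln_V_asymp] by (simp add: norming_ratio_def[abs_def])

lemma Z_square: "eventually (\<lambda>n. \<forall>\<omega>. (Z n \<omega>)\<^sup>2 = 2 * real n * ln (ln (real n)) * (norming_ratio n * (normalized n \<omega>)\<^sup>2)) sequentially"
proof -
  have "eventually (\<lambda>n. ln (ln (real n)) > 0) sequentially" by real_asymp
  then show ?thesis using sums.\<phi>_eventually_ge[of 1] eventually_ge_at_top[of 1]
  proof eventually_elim
    case (elim n)
    have "sqrt (2 * weights.V n * ln (ln (weights.V n))) > 0" using elim(2) by (simp add: sums.\<phi>_def)
    then have "2 * weights.V n * ln (ln (weights.V n)) > 0" by simp
    then have \<phi>2: "(sums.\<phi> n)\<^sup>2 = 2 * weights.V n * ln (ln (weights.V n))" unfolding sums.\<phi>_def by simp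
    show ?case
    proof
      fix \<omega>
      have "weights.growth 0 * Z 0 \<omega> + m * sums.mart n \<omega> = sums.\<phi> n * normalized n \<omega>"
        using elim(2) by (simp add: normalized_def field_simps)
      then have "(Z n \<omega>)\<^sup>2 = (weights.\<pi> n)\<^sup>2 * (sums.\<phi> n)\<^sup>2 * (normalized n \<omega>)\<^sup>2"
        using Z_mart[OF elim(3), of \<omega>] by (simp add: power_mult_distrib)
      then show "(Z n \<omega>)\<^sup>2 = 2 * real n * ln (ln (real n)) * (norming_ratio n * (normalized n \<omega>)\<^sup>2)"
        unfolding \<phi>2 norming_ratio_def using elim by simp
    qed
  qed
qed

lemma \<phi>_inverse_limit: "(\<lambda>n. C / sums.\<phi> n) \<longlonglongrightarrow> 0"
  by (rule tendsto_divide_0[OF tendsto_const filterlim_at_top_imp_at_infinity[OF sums.\<phi>_at_top]])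

lemma mart_ratio_bound:
  assumes "eventually (\<lambda>n. \<bar>sums.mart n \<omega>\<bar> \<le> sums.\<phi> n) sequentially"
  shows "eventually (\<lambda>n. \<bar>sums.mart n \<omega> / sums.\<phi> n\<bar> \<le> 1) sequentially"
  using assms sums.\<phi>_eventually_ge[of 1] by eventually_elim simp

lemma normalized_bound:
  assumes "eventually (\<lambda>n. \<bar>sums.mart n \<omega>\<bar> \<le> sums.\<phi> n) sequentially"
  shows "eventually (\<lambda>n. \<bar>normalized n \<omega>\<bar> \<le> 1 + \<bar>m\<bar>) sequentially"
proof -
  have "eventually (\<lambda>n. \<bar>weights.growth 0 * Z 0 \<omega> / sums.\<phi> n\<bar> < 1) sequentially"
    using order_tendstoD(2)[OF tendsto_rabs_zero[OF \<phi>_inverse_limit], of 1] by simp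
  then show ?thesis using mart_ratio_bound[OF assms]
  proof eventually_elim
    case (elim n)
    have "\<bar>m * (sums.mart n \<omega> / sums.\<phi> n)\<bar> \<le> \<bar>m\<bar> * 1"
      unfolding abs_mult using elim(2) by (intro mult_left_mono) auto
    then show ?case unfolding normalized_def using elim(1)
        abs_triangle_ineq[of "weights.growth 0 * Z 0 \<omega> / sums.\<phi> n" "m * (sums.mart n \<omega> / sums.\<phi> n)"]
      by linarith
  qed
qed

text \<open>The crude bound gives (Z n)^2 / n = O(ln (ln n)). Both the convergence of
  \<open>q\<close> and the boundary term of \<open>quadratic_sum\<close> rest on this.\<close>

lemma Z_square_over_n_ln:
  assumes "eventually (\<lambda>n. \<bar>sums.mart n \<omega>\<bar> \<le> sums.\<phi> n) sequentially"
  shows "(\<lambda>n. (Z n \<omega>)\<^sup>2 / real n / ln (real n)) \<longlonglongrightarrow> 0"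
proof (rule Lim_null_comparison)
  define C where "C = (1 / (1 - 2 * (m / S)) + 1) * (1 + \<bar>m\<bar>)\<^sup>2"
  have "eventually (\<lambda>n. norming_ratio n < 1 / (1 - 2 * (m / S)) + 1) sequentially"
    by (rule order_tendstoD(2)[OF norming_ratio_limit]) simp
  moreover have "eventually (\<lambda>n. ln (ln (real n)) > 0) sequentially" "eventually (\<lambda>n. ln (real n) > 0) sequentially"
    by real_asymp+
  ultimately show "eventually (\<lambda>n. norm ((Z n \<omega>)\<^sup>2 / real n / ln (real n))
      \<le> C * (2 * ln (ln (real n)) / ln (real n))) sequentially"
    using normalized_bound[OF assms] Z_square eventually_gt_at_top[of 0]
  proof eventually_elim
    case (elim n)
    have "(normalized n \<omega>)\<^sup>2 \<le> (1 + \<bar>m\<bar>)\<^sup>2" using elim(4) by (simp add: abs_le_square_iff[symmetric])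
    then have "norming_ratio n * (normalized n \<omega>)\<^sup>2 \<le> C"
    proof -
      have "norming_ratio n * (normalized n \<omega>)\<^sup>2 \<le> (1 / (1 - 2 * (m / S)) + 1) * (normalized n \<omega>)\<^sup>2"
        using elim(1) by (intro mult_right_mono) auto
      also have "\<dots> \<le> C" unfolding C_def using \<open>(normalized n \<omega>)\<^sup>2 \<le> _\<close> weights.drift_pos
        by (intro mult_left_mono) (auto intro: add_nonneg_nonneg)
      finally show ?thesis .
    qed
    then have "norming_ratio n * (normalized n \<omega>)\<^sup>2 * (2 * ln (ln (real n)) / ln (real n)) \<le> C * (2 * ln (ln (real n)) / ln (real n))"
      using elim(2,3) by (intro mult_right_mono) auto
    moreover have "(Z n \<omega>)\<^sup>2 / real n / ln (real n) = norming_ratio n * (normalized n \<omega>)\<^sup>2 * (2 * ln (ln (real n)) / ln (real n))"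
      using elim(5,6) by simp
    moreover have "(Z n \<omega>)\<^sup>2 / real n / ln (real n) \<ge> 0" using elim(3) by simp
    ultimately show ?case by simp
  qed
  show "(\<lambda>n. C * (2 * ln (ln (real n)) / ln (real n))) \<longlonglongrightarrow> 0" by real_asymp
qed

lemma Z_over_n:
  assumes "(\<lambda>n. (Z n \<omega>)\<^sup>2 / real n / ln (real n)) \<longlonglongrightarrow> 0"
  shows "(\<lambda>n. Z n \<omega> / real n) \<longlonglongrightarrow> 0"
proof -
  have "(\<lambda>n. ln (real n) / real n) \<longlonglongrightarrow> 0" by real_asymp
  from tendsto_mult[OF assms this]
  have "(\<lambda>n. (Z n \<omega>)\<^sup>2 / real n / ln (real n) * (ln (real n) / real n)) \<longlonglongrightarrow> 0" by simp
  moreover have "eventually (\<lambda>n. (Z n \<omega>)\<^sup>2 / real n / ln (real n) * (ln (real n) / real n) = (Z n \<omega> / real n)\<^sup>2) sequentially"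
    using eventually_gt_at_top[of 1] by eventually_elim (simp add: power2_eq_square)
  ultimately have "(\<lambda>n. (Z n \<omega> / real n)\<^sup>2) \<longlonglongrightarrow> 0" by (rule Lim_transform_eventually)
  from tendsto_real_sqrt[OF this] have "(\<lambda>n. \<bar>Z n \<omega> / real n\<bar>) \<longlonglongrightarrow> 0" by simp
  then show ?thesis by (simp only: tendsto_rabs_zero_iff)
qed

lemma q_limit:
  assumes "(\<lambda>n. Z n \<omega> / real n) \<longlonglongrightarrow> 0"
  shows "(\<lambda>n. q n \<omega>) \<longlonglongrightarrow> p"
proof -
  have "(\<lambda>n. real n / (\<tau> + real n * S)) \<longlonglongrightarrow> 1 / S" using params(1) by (real_asymp simp: field_simps)
  from tendsto_mult[OF assms this]
  have "(\<lambda>n. Z n \<omega> / real n * (real n / (\<tau> + real n * S))) \<longlonglongrightarrow> 0" by simp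
  then have "(\<lambda>n. p + Z n \<omega> / real n * (real n / (\<tau> + real n * S))) \<longlonglongrightarrow> p + 0" by (intro tendsto_intros)
  moreover have "eventually (\<lambda>n. p + Z n \<omega> / real n * (real n / (\<tau> + real n * S)) = q n \<omega>) sequentially"
    using eventually_gt_at_top[of 0] by eventually_elim (simp add: q_Z)
  ultimately show ?thesis by (auto elim: Lim_transform_eventually)
qed

lemma AE_q_limit: "AE \<omega> in M. (\<lambda>n. q n \<omega>) \<longlonglongrightarrow> p"
  using sums.mart_bound_crude
  by eventually_elim (intro q_limit Z_over_n Z_square_over_n_ln)

sublocale conv: convergent_bernoulli_sums M F draw q weights.w weights.V p
  by unfold_locales (use p AE_q_limit in auto)

section \<open>The quadratic strong law\<close>

text \<open>The coefficient of the noise in the increment of \<open>(Z n)\<^sup>2 / n\<close>. That increment is only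
  considered from \<open>n = 1\<close> on, whence the value 0 at \<open>n = 0\<close>; in \<open>square_sum\<close> below the term with
  \<open>j = 0\<close> vanishes because \<open>x / 0 = 0\<close>.\<close>

definition step_coeff :: "nat \<Rightarrow> 'a \<Rightarrow> real" where
  "step_coeff n \<omega> = (if n = 0 then 0 else
     (2 * m * weights.growth n * Z n \<omega> + m\<^sup>2 * (1 - 2 * q n \<omega>)) / real (Suc n))"

lemma Z_measurable: "Z n \<in> borel_measurable (F n)"
  unfolding Z_def using U_measurable[of n] by measurable

lemma Z_bound: "\<bar>Z n \<omega>\<bar> \<le> \<tau> + real n * S"
proof -
  define t where "t = \<tau> + real n * S"
  define P where "P = p * t"
  have "0 \<le> U n \<omega> $ 1" "U n \<omega> $ 1 \<le> t" using U_nonneg[of n \<omega>] U_total[of n \<omega>] by (auto simp: t_def)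
  moreover have "0 \<le> P" "P \<le> t"
    using p total_pos[of n] mult_right_mono[of p 1 t] by (auto simp: P_def t_def)
  ultimately have "\<bar>U n \<omega> $ 1 - P\<bar> \<le> t" by linarith
  then show ?thesis by (simp add: Z_def P_def t_def)
qed

lemma predictable_step_coeff: "draws.predictable step_coeff"
  unfolding draws.predictable_def
proof (intro allI conjI)
  fix n
  show "step_coeff n \<in> borel_measurable (F n)"
    unfolding step_coeff_def using Z_measurable[of n] draws.q_measurable[of n] by measurable
  have "\<bar>step_coeff n \<omega>\<bar> \<le> \<bar>2 * m * weights.growth n\<bar> * (\<tau> + real n * S) + m\<^sup>2" for \<omega>
  proof (cases "n = 0")
    case False
    have "\<bar>2 * m * weights.growth n * Z n \<omega> + m\<^sup>2 * (1 - 2 * q n \<omega>)\<bar>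
        \<le> \<bar>2 * m * weights.growth n\<bar> * \<bar>Z n \<omega>\<bar> + m\<^sup>2 * \<bar>1 - 2 * q n \<omega>\<bar>"
      by (rule order_trans[OF abs_triangle_ineq]) (simp add: abs_mult)
    also have "\<dots> \<le> \<bar>2 * m * weights.growth n\<bar> * (\<tau> + real n * S) + m\<^sup>2 * 1"
      using Z_bound[of n \<omega>] q_01[of n \<omega>] by (intro add_mono mult_left_mono) auto
    finally have *: "\<bar>2 * m * weights.growth n * Z n \<omega> + m\<^sup>2 * (1 - 2 * q n \<omega>)\<bar>
        \<le> \<bar>2 * m * weights.growth n\<bar> * (\<tau> + real n * S) + m\<^sup>2" by simp
    have "\<bar>step_coeff n \<omega>\<bar> \<le> \<bar>2 * m * weights.growth n * Z n \<omega> + m\<^sup>2 * (1 - 2 * q n \<omega>)\<bar>"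
      using False mult_right_mono[of 1 "real (Suc n)" "\<bar>2 * m * weights.growth n * Z n \<omega> + m\<^sup>2 * (1 - 2 * q n \<omega>)\<bar>"]
      by (simp add: step_coeff_def abs_divide divide_le_eq mult.commute)
    then show ?thesis using * by linarith
  qed (use total_pos[of 0] in \<open>simp add: step_coeff_def\<close>)
  then show "\<exists>B. \<forall>\<omega>. \<bar>step_coeff n \<omega>\<bar> \<le> B" by blast
qed

definition square_sum :: "nat \<Rightarrow> 'a \<Rightarrow> real" where
  "square_sum n \<omega> = (\<Sum>j<n. (Z j \<omega> / real j)\<^sup>2)"

definition hsum :: "nat \<Rightarrow> real" where
  "hsum n = (\<Sum>j<n. 1 / real (Suc j))"

text \<open>The squared coefficients are dominated by the two quantities to be compared, so
  \<open>martingale_bounded_by_quadratic\<close> makes the noise an arbitrarily small fraction of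
  them, up to a constant.\<close>

lemma step_coeff_square_sum: "\<exists>K>0. \<forall>n \<omega>. (\<Sum>j<n. (step_coeff j \<omega>)\<^sup>2) \<le> K * (square_sum n \<omega> + hsum n)"
proof -
  define G where "G = (2 * \<bar>m\<bar> * (1 + \<bar>m\<bar> / \<tau>))\<^sup>2"
  \<comment> \<open>From (x + y)^2 \<le> 2 * x^2 + 2 * y^2, where \<open>G\<close> bounds the
    squared coefficient of \<open>Z\<close>. The summand 1 keeps \<open>K\<close> positive when m =
    0.\<close>
  define K where "K = 2 * G + 2 * m ^ 4 + 1"
  have G: "G \<ge> 0" by (simp add: G_def)
  have "(step_coeff j \<omega>)\<^sup>2 \<le> K * ((Z j \<omega> / real j)\<^sup>2 + 1 / real (Suc j))" for j \<omega>
  proof (cases "j = 0")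
    case False
    define u where "u = 2 * m * weights.growth j"
    define v where "v = m\<^sup>2 * (1 - 2 * q j \<omega>)"
    have "\<bar>weights.growth j\<bar> \<le> 1 + \<bar>m\<bar> / \<tau>"
    proof -
      have "\<bar>weights.growth j\<bar> \<le> 1 + \<bar>m / (\<tau> + real j * S)\<bar>"
        unfolding weights.growth_def by (rule order_trans[OF abs_triangle_ineq]) simp
      also have "\<bar>m / (\<tau> + real j * S)\<bar> \<le> \<bar>m\<bar> / \<tau>"
        using total_pos[of j] params(1,2) by (auto simp: abs_divide intro!: divide_left_mono mult_pos_pos)
      finally show ?thesis by simp
    qed
    then have "\<bar>u\<bar> \<le> 2 * \<bar>m\<bar> * (1 + \<bar>m\<bar> / \<tau>)"
      unfolding u_def abs_mult by (intro mult_mono) auto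
    then have u: "u\<^sup>2 \<le> G" unfolding G_def using abs_le_square_iff[of u "2 * \<bar>m\<bar> * (1 + \<bar>m\<bar> / \<tau>)"] by force
    have "\<bar>1 - 2 * q j \<omega>\<bar> \<le> 1" using q_01[of j \<omega>] by auto
    then have "(1 - 2 * q j \<omega>)\<^sup>2 \<le> 1" using abs_le_square_iff[of "1 - 2 * q j \<omega>" 1] by simp
    then have "(m\<^sup>2)\<^sup>2 * (1 - 2 * q j \<omega>)\<^sup>2 \<le> (m\<^sup>2)\<^sup>2 * 1" by (intro mult_left_mono) auto
    then have v: "v\<^sup>2 \<le> m ^ 4" by (simp add: v_def power_mult_distrib)
    have "(u * Z j \<omega> + v)\<^sup>2 \<le> 2 * (u\<^sup>2 * (Z j \<omega>)\<^sup>2) + 2 * v\<^sup>2"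
      using sum_squares_ge_zero[of "u * Z j \<omega> - v" 0] by (simp add: power2_eq_square algebra_simps)
    also have "\<dots> \<le> 2 * (G * (Z j \<omega>)\<^sup>2) + 2 * m ^ 4"
      using u v by (intro add_mono mult_left_mono mult_right_mono) auto
    finally have num: "(u * Z j \<omega> + v)\<^sup>2 \<le> 2 * G * (Z j \<omega>)\<^sup>2 + 2 * m ^ 4" by simp
    have "(step_coeff j \<omega>)\<^sup>2 = (u * Z j \<omega> + v)\<^sup>2 / (real (Suc j))\<^sup>2"
      using False by (simp add: step_coeff_def u_def v_def power_divide)
    also have "\<dots> \<le> (2 * G * (Z j \<omega>)\<^sup>2 + 2 * m ^ 4) / (real (Suc j))\<^sup>2"
      using num by (intro divide_right_mono) auto
    also have "\<dots> = 2 * G * ((Z j \<omega>)\<^sup>2 / (real (Suc j))\<^sup>2) + 2 * m ^ 4 * (1 / (real (Suc j))\<^sup>2)"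
      by (simp add: add_divide_distrib)
    also have "\<dots> \<le> K * (Z j \<omega> / real j)\<^sup>2 + K * (1 / real (Suc j))"
    proof (intro add_mono mult_mono)
      show "(Z j \<omega>)\<^sup>2 / (real (Suc j))\<^sup>2 \<le> (Z j \<omega> / real j)\<^sup>2"
        unfolding power_divide using False by (intro divide_left_mono power_mono) auto
      show "1 / (real (Suc j))\<^sup>2 \<le> 1 / real (Suc j)"
        by (intro divide_left_mono) (auto simp: power2_eq_square)
    qed (use G in \<open>auto simp: K_def\<close>)
    finally show ?thesis by (simp add: distrib_left)
  qed (use G in \<open>simp add: step_coeff_def K_def\<close>)
  then have "(\<Sum>j<n. (step_coeff j \<omega>)\<^sup>2) \<le> (\<Sum>j<n. K * ((Z j \<omega> / real j)\<^sup>2 + 1 / real (Suc j)))" for n \<omega>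
    by (intro sum_mono)
  then have "(\<Sum>j<n. (step_coeff j \<omega>)\<^sup>2) \<le> K * (square_sum n \<omega> + hsum n)" for n \<omega>
    by (simp add: square_sum_def hsum_def sum_distrib_left sum.distrib distrib_left)
  moreover have "K > 0" using G by (simp add: K_def add_nonneg_pos)
  ultimately show ?thesis by blast
qed

text \<open>This is n^2 * (1 / n - growth^2 / (n + 1)): the mean-field loss of (Z n)^2 / n in one
  step, in units of (Z n / n)^2.\<close>

definition drift :: "nat \<Rightarrow> real" where
  "drift n = real n / real (Suc n) * (real n + 1 - real n * (weights.growth n)\<^sup>2)"

lemma drift_limit: "drift \<longlonglongrightarrow> 1 - 2 * (m / S)"
proof -
  have "(\<lambda>n. real n / real (Suc n)) \<longlonglongrightarrow> 1" by real_asymp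
  from tendsto_mult[OF this weights.drift_limit] show ?thesis by (simp add: drift_def[abs_def])
qed

lemma quadratic_step:
  assumes "n \<ge> 1"
  shows "drift n * (Z n \<omega> / real n)\<^sup>2 = (Z n \<omega>)\<^sup>2 / real n - (Z (Suc n) \<omega>)\<^sup>2 / real (Suc n)
     + m\<^sup>2 * (q n \<omega> * (1 - q n \<omega>)) / real (Suc n) + step_coeff n \<omega> * draws.\<xi> n \<omega>"
proof -
  define g where "g = weights.growth n"
  define k where "k = real n"
  define z where "z = Z n \<omega>"
  define t where "t = draws.\<xi> n \<omega>"
  define r where "r = q n \<omega>"
  have k: "k > 0" "real (Suc n) = k + 1" using assms by (auto simp: k_def)
  \<comment> \<open>A draw equals its own square. The squared noise is therefore its conditional
    variance plus a predictable multiple of the noise, and one martingale increment takes up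
    everything random.\<close>
  have t2: "t\<^sup>2 = r * (1 - r) + (1 - 2 * r) * t"
    using draw_01[of n \<omega>] by (auto simp: t_def r_def draws.\<xi>_def power2_eq_square algebra_simps)
  have Zs: "(Z (Suc n) \<omega>)\<^sup>2 = g\<^sup>2 * z\<^sup>2 + 2 * m * g * z * t + m\<^sup>2 * t\<^sup>2"
    unfolding Z_Suc g_def z_def t_def by (simp add: power2_eq_square algebra_simps)
  have h: "step_coeff n \<omega> = (2 * m * g * z + m\<^sup>2 * (1 - 2 * r)) / (k + 1)"
    using assms k(2) by (simp add: step_coeff_def g_def z_def r_def)
  have "drift n * (z / k)\<^sup>2 * (k * (k + 1)) = z\<^sup>2 * (k + 1 - k * g\<^sup>2)"
    unfolding drift_def k(2) using k(1) by (simp add: k_def[symmetric] g_def power2_eq_square)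
  moreover have "(z\<^sup>2 / k - (Z (Suc n) \<omega>)\<^sup>2 / (k + 1) + m\<^sup>2 * (r * (1 - r)) / (k + 1) + step_coeff n \<omega> * t) * (k * (k + 1))
     = z\<^sup>2 * (k + 1 - k * g\<^sup>2)"
  proof -
    have "(z\<^sup>2 / k - (Z (Suc n) \<omega>)\<^sup>2 / (k + 1) + m\<^sup>2 * (r * (1 - r)) / (k + 1) + step_coeff n \<omega> * t) * (k * (k + 1))
      = z\<^sup>2 * (k + 1) - k * (Z (Suc n) \<omega>)\<^sup>2 + k * (m\<^sup>2 * (r * (1 - r))) + k * ((2 * m * g * z + m\<^sup>2 * (1 - 2 * r)) * t)"
      unfolding h using k(1) by (simp add: divide_simps)
    then show ?thesis unfolding Zs t2 by (simp add: algebra_simps)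
  qed
  ultimately have "drift n * (z / k)\<^sup>2 * (k * (k + 1))
    = (z\<^sup>2 / k - (Z (Suc n) \<omega>)\<^sup>2 / (k + 1) + m\<^sup>2 * (r * (1 - r)) / (k + 1) + step_coeff n \<omega> * t) * (k * (k + 1))"
    by simp
  moreover have "k * (k + 1) \<noteq> 0" using k(1) by simp
  ultimately show ?thesis unfolding k(2) by (simp add: z_def k_def r_def t_def)
qed

lemma quadratic_sum:
  assumes "n \<ge> 1"
  shows "(\<Sum>j<n. drift j * (Z j \<omega> / real j)\<^sup>2) = (Z 1 \<omega>)\<^sup>2 - (Z n \<omega>)\<^sup>2 / real n
     + (\<Sum>j=1..<n. m\<^sup>2 * (q j \<omega> * (1 - q j \<omega>)) / real (Suc j)) + (\<Sum>j<n. step_coeff j \<omega> * draws.\<xi> j \<omega>)"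
  using assms
proof (induction n rule: dec_induct)
  case base
  then show ?case by (simp add: step_coeff_def)
next
  case (step n)
  then show ?case using quadratic_step[OF step(1), of \<omega>] by simp
qed

lemma hsum_at_top: "filterlim hsum at_top sequentially"
  using sum_inverse_Suc_at_top by (simp add: hsum_def[abs_def])

lemma hsum_eventually_ge: "eventually (\<lambda>n. hsum n \<ge> C) sequentially"
  using hsum_at_top unfolding filterlim_at_top by blast

text \<open>Each error in \<open>quadratic_sum\<close> is at most a constant plus a small multiple
  of \<open>square_sum n \<omega> + hsum n\<close>. This does not presuppose that
  \<open>square_sum\<close> is of the order of \<open>hsum\<close>; \<open>ratio_limit\<close>
  extracts the bound and the limit together.\<close>

lemma square_sum_hsum_limit:
  assumes Zl: "(\<lambda>n. (Z n \<omega>)\<^sup>2 / real n / ln (real n)) \<longlonglongrightarrow> 0"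
    and mart: "\<And>i. \<exists>C. \<forall>n. \<bar>\<Sum>j<n. step_coeff j \<omega> * draws.\<xi> j \<omega>\<bar> \<le> C + inverse (real (Suc i)) * (\<Sum>j<n. (step_coeff j \<omega>)\<^sup>2)"
  shows "(\<lambda>n. square_sum n \<omega> / hsum n) \<longlonglongrightarrow> m\<^sup>2 * (p * (1 - p)) / (1 - 2 * (m / S))"
proof (rule ratio_limit)
  show "square_sum n \<omega> \<ge> 0" for n by (simp add: square_sum_def sum_nonneg)
  show "eventually (\<lambda>n. hsum n > 0) sequentially" using hsum_at_top unfolding filterlim_at_top_dense by blast
  show "1 - 2 * (m / S) > 0" by (rule weights.drift_pos)
  show "m\<^sup>2 * (p * (1 - p)) \<ge> 0" using p by simp
  define c0 where "c0 = 1 - 2 * (m / S)"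
  define L where "L = m\<^sup>2 * (p * (1 - p))"
  fix \<epsilon> :: real assume \<epsilon>: "\<epsilon> > 0"
  \<comment> \<open>Five errors share \<epsilon>: the noise, the drift, the conditional variance,
    the boundary term (Z n)^2 / n and the collected constants.\<close>
  have \<epsilon>5: "\<epsilon> / 5 > 0" using \<epsilon> by simp
  obtain K where K: "K > 0" "\<And>n \<omega>. (\<Sum>j<n. (step_coeff j \<omega>)\<^sup>2) \<le> K * (square_sum n \<omega> + hsum n)"
    using step_coeff_square_sum by blast
  obtain i where i: "inverse (real (Suc i)) < \<epsilon> / 5 / K"
    using reals_Archimedean[of "\<epsilon> / 5 / K"] K \<epsilon> by auto
  obtain C1 where C1: "\<And>n. \<bar>\<Sum>j<n. step_coeff j \<omega> * draws.\<xi> j \<omega>\<bar> \<le> C1 + inverse (real (Suc i)) * (\<Sum>j<n. (step_coeff j \<omega>)\<^sup>2)"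
    using mart[of i] by blast
  have T: "\<bar>\<Sum>j<n. step_coeff j \<omega> * draws.\<xi> j \<omega>\<bar> \<le> C1 + \<epsilon> / 5 * (square_sum n \<omega> + hsum n)" for n
  proof -
    have "inverse (real (Suc i)) * (\<Sum>j<n. (step_coeff j \<omega>)\<^sup>2) \<le> \<epsilon> / 5 / K * (K * (square_sum n \<omega> + hsum n))"
    proof (intro mult_mono)
      show "0 \<le> \<epsilon> / 5 / K" using K(1) \<epsilon> by simp
    qed (use i K(2)[of \<omega> n] in \<open>auto intro: sum_nonneg less_imp_le\<close>)
    also have "\<dots> = \<epsilon> / 5 * (square_sum n \<omega> + hsum n)" using K(1) by simp
    finally show ?thesis using C1[of n] by linarith
  qed
  have "(\<lambda>n. c0 - drift n) \<longlonglongrightarrow> c0 - c0" unfolding c0_def by (intro tendsto_intros drift_limit)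
  then have "(\<lambda>n. c0 - drift n) \<longlonglongrightarrow> 0" by simp
  from weighted_sum_negligible[OF _ this \<epsilon>5, of "\<lambda>j. (Z j \<omega> / real j)\<^sup>2"]
  obtain C2 where C2: "\<And>n. \<bar>\<Sum>j<n. (Z j \<omega> / real j)\<^sup>2 * (c0 - drift j)\<bar> \<le> C2 + \<epsilon> / 5 * square_sum n \<omega>"
    by (auto simp: square_sum_def)
  have ql: "(\<lambda>n. q n \<omega>) \<longlonglongrightarrow> p" by (rule q_limit[OF Z_over_n[OF Zl]])
  have "(\<lambda>n. m\<^sup>2 * (q n \<omega> * (1 - q n \<omega>)) - L) \<longlonglongrightarrow> m\<^sup>2 * (p * (1 - p)) - L" by (intro tendsto_intros ql)
  then have "(\<lambda>n. m\<^sup>2 * (q n \<omega> * (1 - q n \<omega>)) - L) \<longlonglongrightarrow> 0" by (simp add: L_def)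
  from weighted_sum_negligible[OF _ this \<epsilon>5, of "\<lambda>j. 1 / real (Suc j)"]
  obtain C3 where C3: "\<And>n. \<bar>\<Sum>j<n. 1 / real (Suc j) * (m\<^sup>2 * (q j \<omega> * (1 - q j \<omega>)) - L)\<bar> \<le> C3 + \<epsilon> / 5 * hsum n"
    by (auto simp: hsum_def)
  define C where "C = (Z 1 \<omega>)\<^sup>2 + \<bar>m\<^sup>2 * (q 0 \<omega> * (1 - q 0 \<omega>))\<bar> + C1 + C2 + C3"
  have "eventually (\<lambda>n. (Z n \<omega>)\<^sup>2 / real n \<le> \<epsilon> / 5 * hsum n) sequentially"
  proof -
    have "(\<lambda>n. (Z n \<omega>)\<^sup>2 / real n / ln (real n) / (hsum n / ln (real n))) \<longlonglongrightarrow> 0 / 1"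
      using sum_inverse_Suc_asymp by (intro tendsto_divide Zl) (auto simp: hsum_def)
    then have "eventually (\<lambda>n. (Z n \<omega>)\<^sup>2 / real n / ln (real n) / (hsum n / ln (real n)) < \<epsilon> / 5) sequentially"
      using \<epsilon>5 by (intro order_tendstoD(2)) auto
    then show ?thesis using hsum_eventually_ge[of 1] eventually_gt_at_top[of 1]
    proof eventually_elim
      case (elim n)
      then have "(Z n \<omega>)\<^sup>2 / real n / hsum n < \<epsilon> / 5" by simp
      moreover have "0 < hsum n" using elim(2) by simp
      ultimately have "(Z n \<omega>)\<^sup>2 / real n < \<epsilon> / 5 * hsum n" by (simp only: pos_divide_less_eq)
      then show ?case by simp
    qed
  qed
  then show "eventually (\<lambda>n. \<bar>(1 - 2 * (m / S)) * square_sum n \<omega> - m\<^sup>2 * (p * (1 - p)) * hsum n\<bar> \<le> \<epsilon> * (square_sum n \<omega> + hsum n)) sequentially"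
    using hsum_eventually_ge[of "C / (\<epsilon> / 5)"] eventually_ge_at_top[of 1]
  proof eventually_elim
    case (elim n)
    have nn: "square_sum n \<omega> \<ge> 0" "hsum n \<ge> 0" by (auto simp: square_sum_def hsum_def intro!: sum_nonneg)
    have Cn: "C \<le> \<epsilon> / 5 * hsum n" using elim(2) \<epsilon>5 by (simp add: divide_le_eq mult.commute)
    have "{..<n} = insert 0 {1..<n}" using elim(3) by auto
    then have split0: "(\<Sum>j<n. m\<^sup>2 * (q j \<omega> * (1 - q j \<omega>)) / real (Suc j))
        = m\<^sup>2 * (q 0 \<omega> * (1 - q 0 \<omega>)) + (\<Sum>j=1..<n. m\<^sup>2 * (q j \<omega> * (1 - q j \<omega>)) / real (Suc j))"
      by simp
    have s2: "(\<Sum>j<n. (Z j \<omega> / real j)\<^sup>2 * (c0 - drift j)) = c0 * square_sum n \<omega> - (\<Sum>j<n. drift j * (Z j \<omega> / real j)\<^sup>2)"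
      unfolding square_sum_def sum_distrib_left sum_subtractf[symmetric]
      by (intro sum.cong refl) (simp only: right_diff_distrib left_diff_distrib mult.commute)
    have s3: "(\<Sum>j<n. 1 / real (Suc j) * (m\<^sup>2 * (q j \<omega> * (1 - q j \<omega>)) - L))
       = (\<Sum>j<n. m\<^sup>2 * (q j \<omega> * (1 - q j \<omega>)) / real (Suc j)) - L * hsum n"
      unfolding hsum_def sum_distrib_left sum_subtractf[symmetric]
      by (intro sum.cong refl) (simp add: diff_divide_distrib)
    have eq: "c0 * square_sum n \<omega> - L * hsum n = (\<Sum>j<n. (Z j \<omega> / real j)\<^sup>2 * (c0 - drift j))
       + (Z 1 \<omega>)\<^sup>2 - (Z n \<omega>)\<^sup>2 / real n - m\<^sup>2 * (q 0 \<omega> * (1 - q 0 \<omega>))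
       + (\<Sum>j<n. 1 / real (Suc j) * (m\<^sup>2 * (q j \<omega> * (1 - q j \<omega>)) - L)) + (\<Sum>j<n. step_coeff j \<omega> * draws.\<xi> j \<omega>)"
      unfolding s2 s3 quadratic_sum[OF elim(3)] split0 by simp
    have "(Z n \<omega>)\<^sup>2 / real n \<ge> 0" "(Z 1 \<omega>)\<^sup>2 \<ge> 0" by auto
    then have "\<bar>c0 * square_sum n \<omega> - L * hsum n\<bar> \<le> (C2 + \<epsilon> / 5 * square_sum n \<omega>) + (Z 1 \<omega>)\<^sup>2 + \<epsilon> / 5 * hsum n
       + \<bar>m\<^sup>2 * (q 0 \<omega> * (1 - q 0 \<omega>))\<bar> + (C3 + \<epsilon> / 5 * hsum n) + (C1 + \<epsilon> / 5 * (square_sum n \<omega> + hsum n))"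
      unfolding eq using C2[of n] C3[of n] T[of n] elim(1) by linarith
    also have "\<dots> = C + 2 * (\<epsilon> / 5 * square_sum n \<omega>) + 3 * (\<epsilon> / 5 * hsum n)"
      by (simp add: C_def distrib_left)
    also have "\<dots> \<le> \<epsilon> * (square_sum n \<omega> + hsum n)"
      using Cn mult_nonneg_nonneg[OF less_imp_le[OF \<epsilon>5] nn(1)] mult_nonneg_nonneg[OF less_imp_le[OF \<epsilon>5] nn(2)]
      by (simp add: algebra_simps)
    finally show ?case by (simp add: c0_def L_def)
  qed
qed

text \<open>All entries of the outer square, and the squared norm, are quadratics in
  \<open>Z k\<close>. Divided by k^2, their linear and constant parts are o(1) / k, so the
  logarithmic average sees the leading coefficient alone.\<close>

lemma quadratic_average:
  assumes Zn: "(\<lambda>n. Z n \<omega> / real n) \<longlonglongrightarrow> 0" and AH: "(\<lambda>n. square_sum n \<omega> / hsum n) \<longlonglongrightarrow> \<Lambda>"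
  shows "(\<lambda>n. 1 / ln (real n) * (\<Sum>k=1..n. (u * (Z k \<omega>)\<^sup>2 + v * Z k \<omega> + r) / (real k)\<^sup>2)) \<longlonglongrightarrow> u * \<Lambda>"
proof -
  have Zn': "(\<lambda>n. Z (Suc n) \<omega> / real (Suc n)) \<longlonglongrightarrow> 0" using LIMSEQ_Suc[OF Zn] .
  have "(\<lambda>n. v * (Z (Suc n) \<omega> / real (Suc n)) + r * (1 / real (Suc n))) \<longlonglongrightarrow> v * 0 + r * 0"
    by (intro tendsto_intros Zn') real_asymp
  from log_average[OF this]
  have rest: "(\<lambda>n. (\<Sum>j<n. (v * (Z (Suc j) \<omega> / real (Suc j)) + r * (1 / real (Suc j))) / real (Suc j)) / ln (real n)) \<longlonglongrightarrow> 0"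
    by simp
  have "(\<lambda>n. square_sum n \<omega> / hsum n * (hsum n / ln (real n))) \<longlonglongrightarrow> \<Lambda> * 1"
    using sum_inverse_Suc_asymp by (intro tendsto_mult AH) (simp add: hsum_def)
  moreover have "eventually (\<lambda>n. square_sum n \<omega> / hsum n * (hsum n / ln (real n)) = square_sum n \<omega> / ln (real n)) sequentially"
    using hsum_eventually_ge[of 1] by eventually_elim simp
  ultimately have A: "(\<lambda>n. square_sum n \<omega> / ln (real n)) \<longlonglongrightarrow> \<Lambda>" by (auto elim: Lim_transform_eventually)
  \<comment> \<open>\<open>square_sum n\<close> ends at n - 1, the sum in the claim at n; the
    missing term (Z n / n)^2 is negligible.\<close>
  have "(\<lambda>n. 1 / ln (real n)) \<longlonglongrightarrow> 0" by real_asymp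
  then have "(\<lambda>n. (Z n \<omega> / real n)\<^sup>2 * (1 / ln (real n))) \<longlonglongrightarrow> 0\<^sup>2 * 0" by (intro tendsto_intros Zn)
  from tendsto_add[OF tendsto_mult_left[OF tendsto_add[OF A this], of u] rest]
  have "(\<lambda>n. u * (square_sum n \<omega> / ln (real n) + (Z n \<omega> / real n)\<^sup>2 * (1 / ln (real n)))
     + (\<Sum>j<n. (v * (Z (Suc j) \<omega> / real (Suc j)) + r * (1 / real (Suc j))) / real (Suc j)) / ln (real n)) \<longlonglongrightarrow> u * \<Lambda>"
    by simp
  moreover have "u * (square_sum n \<omega> / ln (real n) + (Z n \<omega> / real n)\<^sup>2 * (1 / ln (real n)))
     + (\<Sum>j<n. (v * (Z (Suc j) \<omega> / real (Suc j)) + r * (1 / real (Suc j))) / real (Suc j)) / ln (real n)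
    = 1 / ln (real n) * (\<Sum>k=1..n. (u * (Z k \<omega>)\<^sup>2 + v * Z k \<omega> + r) / (real k)\<^sup>2)" for n
  proof -
    have s: "(\<Sum>k=1..n. f k) = (\<Sum>j<n. f (Suc j))" for f :: "nat \<Rightarrow> real"
      by (rule sum.reindex_bij_witness[of _ Suc "\<lambda>i. i - 1"]) auto
    have A': "square_sum n \<omega> + (Z n \<omega> / real n)\<^sup>2 = (\<Sum>j<n. (Z (Suc j) \<omega> / real (Suc j))\<^sup>2)"
    proof -
      have "square_sum n \<omega> + (Z n \<omega> / real n)\<^sup>2 = (\<Sum>j<Suc n. (Z j \<omega> / real j)\<^sup>2)" by (simp add: square_sum_def)
      also have "\<dots> = (\<Sum>j<n. (Z (Suc j) \<omega> / real (Suc j))\<^sup>2)" by (subst sum.lessThan_Suc_shift) simp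
      finally show ?thesis .
    qed
    have "u * (square_sum n \<omega> / ln (real n) + (Z n \<omega> / real n)\<^sup>2 * (1 / ln (real n)))
        = u * (square_sum n \<omega> + (Z n \<omega> / real n)\<^sup>2) / ln (real n)"
      by (simp add: distrib_left add_divide_distrib)
    then show ?thesis unfolding A' s sum_distrib_left
      by (simp add: sum_divide_distrib sum.distrib[symmetric] add_divide_distrib power2_eq_square add.assoc del: of_nat_Suc)
  qed
  ultimately show ?thesis by simp
qed

section \<open>The law of the iterated logarithm and the passage to the composition\<close>

lemma limsup_mart_ratio:
  assumes upper: "\<And>i. eventually (\<lambda>n. \<bar>sums.mart n \<omega>\<bar> \<le> (1 + inverse (real (Suc i))) * conv.s * sums.\<phi> n) sequentially"
    and lower: "\<And>i. frequently (\<lambda>n. sums.mart n \<omega> \<ge> (1 - inverse (real (Suc i))) * conv.s * sums.\<phi> n) sequentially"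
  shows "limsup (\<lambda>n. ereal ((sums.mart n \<omega> / sums.\<phi> n)\<^sup>2)) = ereal (p * (1 - p))"
proof (rule limsup_ereal_eqI)
  fix \<epsilon> :: real assume \<epsilon>: "\<epsilon> > 0"
  \<comment> \<open>For d \<le> 1 the squares (1 \<plusminus> d)^2 differ from 1 by at most 3 * d,
    and conv.s \<le> 1; so 3 * d < \<epsilon> suffices.\<close>
  define i where "i = nat \<lceil>3 / \<epsilon>\<rceil>"
  define d where "d = inverse (real (Suc i))"
  have "3 / \<epsilon> \<le> real i" unfolding i_def by (rule real_nat_ceiling_ge)
  then have "3 / \<epsilon> < real (Suc i)" by simp
  then have "3 * d < \<epsilon>" using \<epsilon> by (simp add: d_def field_simps)
  have d: "0 < d" "d \<le> 1" "3 * d < \<epsilon>"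
    using \<open>3 * d < \<epsilon>\<close> by (auto simp: d_def inverse_le_1_iff)
  have s1: "conv.s\<^sup>2 \<le> 1" using conv.s(1,2) by (simp add: power_le_one)
  have sq: "(1 + d)\<^sup>2 * conv.s\<^sup>2 \<le> conv.s\<^sup>2 + \<epsilon>" "conv.s\<^sup>2 - \<epsilon> \<le> (1 - d)\<^sup>2 * conv.s\<^sup>2"
  proof -
    have dd: "d * d \<le> d" using d by (simp add: mult_left_le)
    have "(2 * d + d * d) * conv.s\<^sup>2 \<le> (2 * d + d * d) * 1" using d s1 by (intro mult_left_mono) auto
    then show "(1 + d)\<^sup>2 * conv.s\<^sup>2 \<le> conv.s\<^sup>2 + \<epsilon>"
      using d(3) dd by (simp add: power2_sum algebra_simps power2_eq_square)
    have "(2 * d) * conv.s\<^sup>2 \<le> (2 * d) * 1" using d s1 by (intro mult_left_mono) auto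
    moreover have "(d * d) * conv.s\<^sup>2 \<ge> 0" by simp
    ultimately show "conv.s\<^sup>2 - \<epsilon> \<le> (1 - d)\<^sup>2 * conv.s\<^sup>2"
    proof -
      have "(1 - d)\<^sup>2 * conv.s\<^sup>2 = conv.s\<^sup>2 - 2 * d * conv.s\<^sup>2 + d * d * conv.s\<^sup>2"
        by (simp add: power2_eq_square algebra_simps)
      moreover assume "2 * d * conv.s\<^sup>2 \<le> 2 * d * 1" "0 \<le> d * d * conv.s\<^sup>2"
      ultimately show ?thesis using d(1,3) by linarith
    qed
  qed
  show "eventually (\<lambda>n. (sums.mart n \<omega> / sums.\<phi> n)\<^sup>2 \<le> p * (1 - p) + \<epsilon>) sequentially"
    using upper[of i] sums.\<phi>_eventually_ge[of 1]
  proof eventually_elim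
    case (elim n)
    then have "\<bar>sums.mart n \<omega> / sums.\<phi> n\<bar> \<le> \<bar>(1 + d) * conv.s\<bar>"
      using conv.s(1) d by (simp add: d_def[symmetric] divide_le_eq del: of_nat_Suc)
    then have "(sums.mart n \<omega> / sums.\<phi> n)\<^sup>2 \<le> (1 + d)\<^sup>2 * conv.s\<^sup>2"
      unfolding abs_le_square_iff by (simp add: power_mult_distrib)
    then show ?case using sq(1) conv.s(3) by linarith
  qed
  show "frequently (\<lambda>n. (sums.mart n \<omega> / sums.\<phi> n)\<^sup>2 \<ge> p * (1 - p) - \<epsilon>) sequentially"
  proof (rule frequently_mono[OF _ frequently_eventually_frequently[OF lower[of i] sums.\<phi>_eventually_ge[of 1]]],
      intro allI impI)
    fix n assume n: "(1 - inverse (real (Suc i))) * conv.s * sums.\<phi> n \<le> sums.mart n \<omega> \<and> 1 \<le> sums.\<phi> n"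
    then have "(1 - d) * conv.s \<le> sums.mart n \<omega> / sums.\<phi> n"
      by (simp add: d_def le_divide_eq del: of_nat_Suc)
    then have "((1 - d) * conv.s)\<^sup>2 \<le> (sums.mart n \<omega> / sums.\<phi> n)\<^sup>2"
      using d conv.s(1) by (intro power_mono) auto
    then show "(sums.mart n \<omega> / sums.\<phi> n)\<^sup>2 \<ge> p * (1 - p) - \<epsilon>"
      using sq(2) conv.s(3) by (simp add: power_mult_distrib)
  qed
qed

text \<open>The initial value, the cross term and the lower-order terms of the quadratic are
  gathered in \<open>err\<close>, which tends to 0. What is left is the squared martingale ratio
  times a factor whose limit is nonnegative because of u \<ge> 0, so that it passes through the
  limit superior.\<close>

lemma limsup_quadratic:
  assumes crude: "eventually (\<lambda>n. \<bar>sums.mart n \<omega>\<bar> \<le> sums.\<phi> n) sequentially"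
    and ls: "limsup (\<lambda>n. ereal ((sums.mart n \<omega> / sums.\<phi> n)\<^sup>2)) = ereal (p * (1 - p))"
    and u: "u \<ge> 0"
  shows "limsup (\<lambda>n. ereal ((u * (Z n \<omega>)\<^sup>2 + v * Z n \<omega> + r) / (2 * real n * ln (ln (real n)))))
     = ereal (u * (m\<^sup>2 * (p * (1 - p)) / (1 - 2 * (m / S))))"
proof -
  define y where "y n = sums.mart n \<omega> / sums.\<phi> n" for n
  define k where "k n = weights.growth 0 * Z 0 \<omega> / sums.\<phi> n" for n
  have k: "k \<longlonglongrightarrow> 0" unfolding k_def by (rule \<phi>_inverse_limit)
  have yb: "eventually (\<lambda>n. \<bar>y n\<bar> \<le> 1) sequentially" unfolding y_def by (rule mart_ratio_bound[OF crude])
  have Zn: "(\<lambda>n. Z n \<omega> / real n) \<longlonglongrightarrow> 0" by (rule Z_over_n[OF Z_square_over_n_ln[OF crude]])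
  define err where "err n = u * norming_ratio n * (k n)\<^sup>2 + 2 * u * m * (norming_ratio n * (k n * y n))
     + (v * (Z n \<omega> / real n) + r * (1 / real n)) * (1 / (2 * ln (ln (real n))))" for n
  have ky: "(\<lambda>n. k n * y n) \<longlonglongrightarrow> 0"
  proof (rule Lim_null_comparison)
    show "eventually (\<lambda>n. norm (k n * y n) \<le> \<bar>k n\<bar>) sequentially"
      using yb by eventually_elim (simp add: abs_mult mult_left_le)
    show "(\<lambda>n. \<bar>k n\<bar>) \<longlonglongrightarrow> 0" using k by (rule tendsto_rabs_zero)
  qed
  have "(\<lambda>n. 1 / real n) \<longlonglongrightarrow> 0" "(\<lambda>n. 1 / (2 * ln (ln (real n)))) \<longlonglongrightarrow> 0" by real_asymp+
  then have "err \<longlonglongrightarrow> u * (1 / (1 - 2 * (m / S))) * 0\<^sup>2 + 2 * u * m * (1 / (1 - 2 * (m / S)) * 0) + (v * 0 + r * 0) * 0"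
    unfolding err_def by (intro tendsto_intros norming_ratio_limit k ky Zn)
  then have err: "err \<longlonglongrightarrow> 0" by simp
  have cl: "(\<lambda>n. u * m\<^sup>2 * norming_ratio n) \<longlonglongrightarrow> u * m\<^sup>2 * (1 / (1 - 2 * (m / S)))"
    by (intro tendsto_intros norming_ratio_limit)
  have "eventually (\<lambda>n. \<bar>(y n)\<^sup>2\<bar> \<le> 1) sequentially"
    using yb by eventually_elim (simp add: abs_square_le_1)
  moreover have "u * m\<^sup>2 * (1 / (1 - 2 * (m / S))) \<ge> 0" using u weights.drift_pos by simp
  ultimately have "limsup (\<lambda>n. ereal (u * m\<^sup>2 * norming_ratio n * (y n)\<^sup>2 + err n))
      = ereal (u * m\<^sup>2 * (1 / (1 - 2 * (m / S))) * (p * (1 - p)))"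
    using ls cl err by (intro limsup_ereal_affine[where B = 1]) (auto simp: y_def)
  moreover have "limsup (\<lambda>n. ereal ((u * (Z n \<omega>)\<^sup>2 + v * Z n \<omega> + r) / (2 * real n * ln (ln (real n)))))
    = limsup (\<lambda>n. ereal (u * m\<^sup>2 * norming_ratio n * (y n)\<^sup>2 + err n))"
  proof (rule Limsup_eq)
    have "eventually (\<lambda>n. ln (ln (real n)) > 0) sequentially" by real_asymp
    then show "eventually (\<lambda>n. ereal ((u * (Z n \<omega>)\<^sup>2 + v * Z n \<omega> + r) / (2 * real n * ln (ln (real n))))
       = ereal (u * m\<^sup>2 * norming_ratio n * (y n)\<^sup>2 + err n)) sequentially"
      using Z_square eventually_gt_at_top[of 0]
    proof eventually_elim
      case (elim n)
      define l where "l = 2 * real n * ln (ln (real n))"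
      have l: "l > 0" using elim by (simp add: l_def)
      have "(Z n \<omega>)\<^sup>2 / l = norming_ratio n * (k n + m * y n)\<^sup>2"
      proof -
        have "(Z n \<omega>)\<^sup>2 = l * (norming_ratio n * (k n + m * y n)\<^sup>2)"
          using elim(2) by (simp only: l_def normalized_def k_def y_def)
        then show ?thesis using l by simp
      qed
      also have "\<dots> = norming_ratio n * (k n)\<^sup>2 + 2 * m * (norming_ratio n * (k n * y n)) + m\<^sup>2 * norming_ratio n * (y n)\<^sup>2"
        by (simp add: power2_eq_square algebra_simps)
      finally have Z2: "(Z n \<omega>)\<^sup>2 / l = norming_ratio n * (k n)\<^sup>2 + 2 * m * (norming_ratio n * (k n * y n)) + m\<^sup>2 * norming_ratio n * (y n)\<^sup>2" .
      have "(u * (Z n \<omega>)\<^sup>2 + v * Z n \<omega> + r) / l = u * ((Z n \<omega>)\<^sup>2 / l) + (v * Z n \<omega> + r) / l"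
        by (simp add: add_divide_distrib)
      moreover have "(v * Z n \<omega> + r) / l = (v * (Z n \<omega> / real n) + r * (1 / real n)) * (1 / (2 * ln (ln (real n))))"
        unfolding l_def using elim by (simp add: field_simps)
      ultimately show ?case unfolding Z2 l_def[symmetric] err_def by (simp add: algebra_simps)
    qed
  qed
  ultimately show ?thesis by simp
qed

text \<open>The coefficients are quantified inside the almost sure event: one null set serves all
  entries of the matrix, although there are uncountably many triples u, v, r.\<close>

lemma AE_quadratic:
  "AE \<omega> in M.
     (\<forall>u v r. (\<lambda>n. 1 / ln (real n) * (\<Sum>k=1..n. (u * (Z k \<omega>)\<^sup>2 + v * Z k \<omega> + r) / (real k)\<^sup>2))
        \<longlonglongrightarrow> u * (m\<^sup>2 * (p * (1 - p)) / (1 - 2 * (m / S)))) \<and>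
     (\<forall>u v r. u \<ge> 0 \<longrightarrow>
        limsup (\<lambda>n. ereal ((u * (Z n \<omega>)\<^sup>2 + v * Z n \<omega> + r) / (2 * real n * ln (ln (real n)))))
        = ereal (u * (m\<^sup>2 * (p * (1 - p)) / (1 - 2 * (m / S)))))"
proof -
  \<comment> \<open>The tolerances run through 1 / (i + 1), so that countably many almost sure
    events are intersected.\<close>
  have "AE \<omega> in M. \<forall>i. \<exists>C. \<forall>n. \<bar>\<Sum>j<n. step_coeff j \<omega> * draws.\<xi> j \<omega>\<bar>
      \<le> C + inverse (real (Suc i)) * (\<Sum>j<n. (step_coeff j \<omega>)\<^sup>2)"
    unfolding AE_all_countable
    by (intro allI draws.martingale_bounded_by_quadratic predictable_step_coeff) simp
  moreover have "AE \<omega> in M. \<forall>i. eventually (\<lambda>n. \<bar>sums.mart n \<omega>\<bar>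
      \<le> (1 + inverse (real (Suc i))) * conv.s * sums.\<phi> n) sequentially"
    unfolding AE_all_countable by (intro allI conv.upper_LIL) simp
  moreover have "AE \<omega> in M. \<forall>i. frequently (\<lambda>n. sums.mart n \<omega>
      \<ge> (1 - inverse (real (Suc i))) * conv.s * sums.\<phi> n) sequentially"
    unfolding AE_all_countable by (intro allI conv.lower_LIL) simp
  ultimately show ?thesis
    using sums.mart_bound_crude
  proof eventually_elim
    case (elim \<omega>)
    have Zl: "(\<lambda>n. (Z n \<omega>)\<^sup>2 / real n / ln (real n)) \<longlonglongrightarrow> 0" by (rule Z_square_over_n_ln[OF elim(4)])
    have "(\<lambda>n. square_sum n \<omega> / hsum n) \<longlonglongrightarrow> m\<^sup>2 * (p * (1 - p)) / (1 - 2 * (m / S))"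
      by (rule square_sum_hsum_limit[OF Zl]) (use elim(1) in blast)
    moreover have "limsup (\<lambda>n. ereal ((sums.mart n \<omega> / sums.\<phi> n)\<^sup>2)) = ereal (p * (1 - p))"
      using elim(2,3) by (intro limsup_mart_ratio) blast+
    ultimately show ?case
      using quadratic_average[OF Z_over_n[OF Zl]] limsup_quadratic[OF elim(4)] by blast
  qed
qed

end

theorem theorem3p2:
  fixes M :: "'a measure" and F :: "nat \<Rightarrow> 'a measure"
    and a b c d \<alpha> \<beta> :: nat
    and red :: "nat \<Rightarrow> 'a \<Rightarrow> bool"
    and U :: "nat \<Rightarrow> 'a \<Rightarrow> real^2"
    and S m \<sigma> :: real and v1 :: "real^2"
  assumes urn: "balanced_polya_urn M F a b c d \<alpha> \<beta> red U"
    and S: "S = real a + real b"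
    and m: "m = real a - real c"
    and \<sigma>: "\<sigma> = m / S"
    and v1: "v1 = (S / (real b + real c)) *\<^sub>R vector [real c, real b]"
    and small: "\<sigma> < 1 / 2"
    and bc: "b * c \<noteq> 0"
  shows "(AE \<omega> in M.
          (\<lambda>n. (1 / ln (real n)) *\<^sub>R
             (\<Sum>k=1..n. (1 / (real k)\<^sup>2) *\<^sub>R outer_square (U k \<omega> - real k *\<^sub>R v1)))
          \<longlonglongrightarrow> (1 / (1 - 2 * \<sigma>) * (real b * real c * m\<^sup>2 / (real b + real c)\<^sup>2)) *\<^sub>R
             (vector [vector [1, - 1], vector [- 1, 1]] :: real^2^2))
       \<and> (AE \<omega> in M.
          (\<lambda>n. 1 / ln (real n) * (\<Sum>k=1..n. (norm (U k \<omega> - real k *\<^sub>R v1))\<^sup>2 / (real k)\<^sup>2))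
          \<longlonglongrightarrow> 2 / (1 - 2 * \<sigma>) * (real b * real c * m\<^sup>2 / (real b + real c)\<^sup>2))
       \<and> (AE \<omega> in M.
          limsup (\<lambda>n. ereal ((norm (U n \<omega> - real n *\<^sub>R v1))\<^sup>2 / (2 * real n * ln (ln (real n)))))
          = ereal (2 / (1 - 2 * \<sigma>) * (real b * real c * m\<^sup>2 / (real b + real c)\<^sup>2)))"
proof -
  interpret urn: small_polya_urn M F a b c d \<alpha> \<beta> red U
    using urn small bc by (simp add: small_polya_urn_def small_polya_urn_axioms_def S m \<sigma>)
  \<comment> \<open>The constant vector left over: U_k - k * v1 = Z_k * (1,-1) + (A, B), since U_k
    has total \<tau> + k * S and v1 is S * (p, 1 - p).\<close>
  define A where "A = urn.p * urn.\<tau>"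
  define B where "B = (1 - urn.p) * urn.\<tau>"
  define \<Lambda> where "\<Lambda> = 1 / (1 - 2 * \<sigma>) * (real b * real c * m\<^sup>2 / (real b + real c)\<^sup>2)"
  have Sm: "urn.S = S" "urn.m = m" by (simp_all add: urn.S_def urn.m_def S m)
  have \<Lambda>: "urn.m\<^sup>2 * (urn.p * (1 - urn.p)) / (1 - 2 * (urn.m / urn.S)) = \<Lambda>"
    unfolding urn.p(4) Sm \<Lambda>_def \<sigma> by (simp add: mult.commute)
  have v: "v1 $ 1 = urn.p * S" "v1 $ 2 = S - urn.p * S"
  proof -
    have bc0: "real b + real c > 0" using urn.bc_pos by simp
    show "v1 $ 1 = urn.p * S" by (simp add: v1 urn.p_def)
    show "v1 $ 2 = S - urn.p * S" using bc0 by (simp add: v1 urn.p_def field_simps)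
  qed
  have W: "(U k \<omega> - real k *\<^sub>R v1) $ 1 = urn.Z k \<omega> + A" "(U k \<omega> - real k *\<^sub>R v1) $ 2 = B - urn.Z k \<omega>" for k \<omega>
    using urn.U_total[of k \<omega>] by (simp_all add: urn.Z_def v A_def B_def Sm algebra_simps)
  have N: "(norm (U k \<omega> - real k *\<^sub>R v1))\<^sup>2
      = 2 * (urn.Z k \<omega>)\<^sup>2 + (2 * A - 2 * B) * urn.Z k \<omega> + (A\<^sup>2 + B\<^sup>2)" for k \<omega>
    unfolding power2_norm_eq_inner inner_vec_def sum_2 W by (simp add: power2_eq_square algebra_simps add_divide_distrib diff_divide_distrib)
  have O: "outer_square y $ i $ j = y $ i * y $ j" for y :: "real^2" and i j
    by (simp add: outer_square_def matrix_matrix_mult_def columnvector_def rowvector_def)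
  from urn.AE_quadratic have "AE \<omega> in M.
          (\<lambda>n. (1 / ln (real n)) *\<^sub>R
             (\<Sum>k=1..n. (1 / (real k)\<^sup>2) *\<^sub>R outer_square (U k \<omega> - real k *\<^sub>R v1)))
          \<longlonglongrightarrow> \<Lambda> *\<^sub>R (vector [vector [1, - 1], vector [- 1, 1]] :: real^2^2)"
  proof eventually_elim
    case (elim \<omega>)
    have lim: "(\<lambda>n. 1 / ln (real n) * (\<Sum>k=1..n. (u * (urn.Z k \<omega>)\<^sup>2 + v * urn.Z k \<omega> + r) / (real k)\<^sup>2))
        \<longlonglongrightarrow> u * \<Lambda>" for u v r
      using elim unfolding \<Lambda> by blast
    have e: "(\<lambda>n. 1 / ln (real n) * (\<Sum>k=1..n. 1 / (real k)\<^sup>2 *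
         ((U k \<omega> - real k *\<^sub>R v1) $ i * (U k \<omega> - real k *\<^sub>R v1) $ j)))
         \<longlonglongrightarrow> \<Lambda> * (vector [vector [1, - 1], vector [- 1, 1]] :: real^2^2) $ i $ j" for i j
    proof -
      \<comment> \<open>The products of the components Z + A and B - Z have leading coefficients 1,
        -1 and 1, the entries of the limit matrix; A and B affect lower-order terms only.\<close>
      have "\<forall>i j. (\<lambda>n. 1 / ln (real n) * (\<Sum>k=1..n. 1 / (real k)\<^sup>2 *
         ((U k \<omega> - real k *\<^sub>R v1) $ i * (U k \<omega> - real k *\<^sub>R v1) $ j)))
         \<longlonglongrightarrow> \<Lambda> * (vector [vector [1, - 1], vector [- 1, 1]] :: real^2^2) $ i $ j"
        unfolding forall_2 W vector_2
        using lim[of 1 "2 * A" "A\<^sup>2"] lim[of "-1" "B - A" "A * B"] lim[of 1 "- 2 * B" "B\<^sup>2"]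
        by (simp add: power2_eq_square algebra_simps add_divide_distrib diff_divide_distrib)
      then show ?thesis by blast
    qed
    show ?case
      by (intro vec_tendstoI) (use e in \<open>simp add: O sum_component\<close>)
  qed
  moreover from urn.AE_quadratic have "AE \<omega> in M.
          (\<lambda>n. 1 / ln (real n) * (\<Sum>k=1..n. (norm (U k \<omega> - real k *\<^sub>R v1))\<^sup>2 / (real k)\<^sup>2))
          \<longlonglongrightarrow> 2 * \<Lambda>"
    unfolding N \<Lambda> by eventually_elim blast
  moreover from urn.AE_quadratic have "AE \<omega> in M.
          limsup (\<lambda>n. ereal ((norm (U n \<omega> - real n *\<^sub>R v1))\<^sup>2 / (2 * real n * ln (ln (real n)))))
          = ereal (2 * \<Lambda>)"
    unfolding N \<Lambda> by eventually_elim auto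
  ultimately show ?thesis by (simp add: \<Lambda>_def)
qed

end
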